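(* Let $1<p<\infty$ and let $\{u^\varepsilon\}_{\varepsilon>0}$ be weak solutions of $(P_\varepsilon)$ in $B_1$. Then for every ball $B\Subset B_1$ the tensor $T_{lm}(\nabla u^\varepsilon)=p|\nabla u^\varepsilon|^{p-2}\partial_lu^\varepsilon\partial_mu^\varepsilon-|\nabla u^\varepsilon|^p\delta_{lm}$ admits a decomposition $T_{lm}=T^0_{lm}+\widehat T_{lm}$ in $B$, where $\sum_m\partial_m T^0_{lm}=0$ in the sense of distributions in $B$ for each $l$, and $\widehat T\in BMO(B)$ with $\sup_{\varepsilon>0}\|\widehat T\|_{BMO(B)}<\infty$.
   Context: $\Delta_p v=\operatorname{div}(|\nabla v|^{p-2}\nabla v)$. Fix $\beta\in C_0^\infty((0,1))$ with $\beta\ge 0$ and $M:=\int_0^1\beta>0$; $\beta_\varepsilon(t)=\frac1\varepsilon\beta(t/\varepsilon)$. A function $u^\varepsilon\in W^{1,p}(B_1)$ is a weak solution of $(P_\varepsilon)$ in $B_1$ if $|u^\varepsilon|\le 1$ in $B_1$ and $-\int_{B_1}|\nabla u^\varepsilon|^{p-2}\nabla u^\varepsilon\cdot\nabla\psi=\int_{B_1}\beta_\varepsilon(u^\varepsilon)\psi$ for all $\psi\in W^{1,p}_0(B_1)$. $\delta_{lm}$ is the Kronecker delta. $BMO$ seminorm: $\|f\|_{BMO(B)}=\sup_{B'\subset B}\frac1{|B'|}\int_{B'}|f-f_{B'}|$ over balls $B'$. *)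

theory Defs
  imports "HOL-Analysis.Analysis"
begin

fun dpart :: "'n::finite list \<Rightarrow> (real^'n \<Rightarrow> real) \<Rightarrow> real^'n \<Rightarrow> real" where
  "dpart [] f = f"
| "dpart (i # is) f = (\<lambda>x. frechet_derivative (dpart is f) (at x) (axis i 1))"

definition smooth_on :: "(real^'n::finite) set \<Rightarrow> (real^'n \<Rightarrow> real) \<Rightarrow> bool" where
  "smooth_on U f \<longleftrightarrow> (\<forall>is. dpart is f differentiable_on U \<and> continuous_on U (dpart is f))"

definition test_fun :: "(real^'n::finite) set \<Rightarrow> (real^'n \<Rightarrow> real) \<Rightarrow> bool" where
  "test_fun U \<phi> \<longleftrightarrow> smooth_on UNIV \<phi> \<and> compact (closure {x. \<phi> x \<noteq> 0})
      \<and> closure {x. \<phi> x \<noteq> 0} \<subseteq> U"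

definition smooth_real :: "(real \<Rightarrow> real) \<Rightarrow> bool" where
  "smooth_real f \<longleftrightarrow> (\<forall>k x. ((deriv ^^ k) f) differentiable (at x))"

definition Cc_infty_01 :: "(real \<Rightarrow> real) \<Rightarrow> bool" where
  "Cc_infty_01 f \<longleftrightarrow> smooth_real f \<and> compact (closure {t. f t \<noteq> 0})
      \<and> closure {t. f t \<noteq> 0} \<subseteq> {0<..<1}"

definition beta_eps :: "(real \<Rightarrow> real) \<Rightarrow> real \<Rightarrow> real \<Rightarrow> real" where
  "beta_eps \<beta> \<epsilon> t = (1 / \<epsilon>) * \<beta> (t / \<epsilon>)"

definition loc_integrable :: "(real^'n::finite) set \<Rightarrow> (real^'n \<Rightarrow> real) \<Rightarrow> bool" where
  "loc_integrable U f \<longleftrightarrow> (\<forall>K. compact K \<and> K \<subseteq> U \<longrightarrow> set_integrable lebesgue K f)"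

definition Lp :: "(real^'n::finite) set \<Rightarrow> real \<Rightarrow> (real^'n \<Rightarrow> real) \<Rightarrow> bool" where
  "Lp U p f \<longleftrightarrow> f \<in> borel_measurable (lebesgue_on U)
      \<and> set_integrable lebesgue U (\<lambda>x. \<bar>f x\<bar> powr p)"

definition weak_gradient ::
  "(real^'n::finite) set \<Rightarrow> (real^'n \<Rightarrow> real) \<Rightarrow> (real^'n \<Rightarrow> real^'n) \<Rightarrow> bool" where
  "weak_gradient U u g \<longleftrightarrow> loc_integrable U u \<and> (\<forall>i. loc_integrable U (\<lambda>x. g x $ i))
     \<and> (\<forall>\<phi> i. test_fun U \<phi> \<longrightarrow>
          (LINT x:U|lebesgue. u x * dpart [i] \<phi> x) = - (LINT x:U|lebesgue. g x $ i * \<phi> x))"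

definition sobolev :: "(real^'n::finite) set \<Rightarrow> real \<Rightarrow> (real^'n \<Rightarrow> real) \<Rightarrow> (real^'n \<Rightarrow> real^'n) \<Rightarrow> bool" where
  "sobolev U p u g \<longleftrightarrow> Lp U p u \<and> (\<forall>i. Lp U p (\<lambda>x. g x $ i)) \<and> weak_gradient U u g"

definition sobolev0 :: "(real^'n::finite) set \<Rightarrow> real \<Rightarrow> (real^'n \<Rightarrow> real) \<Rightarrow> (real^'n \<Rightarrow> real^'n) \<Rightarrow> bool" where
  "sobolev0 U p u g \<longleftrightarrow> sobolev U p u g \<and>
     (\<exists>\<phi>::nat \<Rightarrow> real^'n \<Rightarrow> real. (\<forall>k. test_fun U (\<phi> k))
        \<and> (\<lambda>k. LINT x:U|lebesgue. \<bar>\<phi> k x - u x\<bar> powr p) \<longlonglongrightarrow> 0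
        \<and> (\<forall>i. (\<lambda>k. LINT x:U|lebesgue. \<bar>dpart [i] (\<phi> k) x - g x $ i\<bar> powr p) \<longlonglongrightarrow> 0))"

definition weak_solution ::
  "real \<Rightarrow> (real \<Rightarrow> real) \<Rightarrow> real \<Rightarrow> (real^'n::finite \<Rightarrow> real) \<Rightarrow> (real^'n \<Rightarrow> real^'n) \<Rightarrow> bool" where
  "weak_solution p \<beta> \<epsilon> u g \<longleftrightarrow> sobolev (ball 0 1) p u g
     \<and> (AE x in lebesgue. x \<in> ball 0 1 \<longrightarrow> \<bar>u x\<bar> \<le> 1)
     \<and> (\<forall>\<psi> h. sobolev0 (ball 0 1) p \<psi> h \<longrightarrow>
          - (LINT x:ball 0 1|lebesgue. (norm (g x) powr (p - 2)) * (g x \<bullet> h x))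
          = (LINT x:ball 0 1|lebesgue. beta_eps \<beta> \<epsilon> (u x) * \<psi> x))"

definition Ttensor :: "real \<Rightarrow> real^'n::finite \<Rightarrow> real^'n^'n" where
  "Ttensor p v = (\<chi> l m. p * norm v powr (p - 2) * v $ l * v $ m
                        - norm v powr p * (if l = m then 1 else 0))"

definition div_free :: "(real^'n::finite) set \<Rightarrow> (real^'n \<Rightarrow> real^'n^'n) \<Rightarrow> bool" where
  "div_free U T \<longleftrightarrow> (\<forall>l m. loc_integrable U (\<lambda>x. T x $ l $ m))
     \<and> (\<forall>\<phi> l. test_fun U \<phi> \<longrightarrow>
          (\<Sum>m\<in>UNIV. LINT x:U|lebesgue. T x $ l $ m * dpart [m] \<phi> x) = 0)"

definition ball_avg :: "(real^'n::finite) set \<Rightarrow> (real^'n \<Rightarrow> real) \<Rightarrow> real" where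
  "ball_avg B f = (LINT x:B|lebesgue. f x) / measure lebesgue B"

definition bmo_seminorm :: "(real^'n::finite) set \<Rightarrow> (real^'n \<Rightarrow> real) \<Rightarrow> ereal" where
  "bmo_seminorm B f = (SUP B' \<in> {ball c r | c r. 0 < r \<and> ball c r \<subseteq> B}.
        ereal (ball_avg B' (\<lambda>x. \<bar>f x - ball_avg B' f\<bar>)))"

definition in_BMO :: "(real^'n::finite) set \<Rightarrow> (real^'n \<Rightarrow> real) \<Rightarrow> bool" where
  "in_BMO B f \<longleftrightarrow> loc_integrable B f \<and> bmo_seminorm B f < \<infinity>"

end

(* No regularity theory is needed. For a test function phi >= 0 and the energy density
   F(v) = |v|^p / p with A = grad F, convexity gives
     int phi (F(Du(x+y)) - F(Du(x))) dx >= int phi A(Du(x)) . (Du(x+y) - Du(x)) dx   for small y,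
   with equality at y = 0. The equation, tested with phi times mollifications of u(. + y), turns the
   right-hand side into a pairing of the fixed L^q function A(Du) . grad phi + beta_eps(u) phi with the
   translates of u, which is differentiable in y; the left-hand side is differentiable because the
   translation can be moved to phi. Vanishing of the derivative at y = 0 is the inner variation
   identity. The same argument with a convex function of u in place of F gives the chain rule for
   B(u) = int_0^u beta_eps, and together they say that T - p B(u) Id has divergence-free rows. The
   remainder p B(u) Id is bounded by p int beta uniformly in eps, hence bounded in BMO. *)

theory Submission
  imports Defs
begin

subsection \<open>Smooth functions and test functions\<close>

text \<open>The obstacle is that u lies only in W^{1,p}: without second derivatives the equation
  cannot be tested with \<phi> times a partial derivative of u. Comparing u with its translates
  avoids second derivatives, because an inequality that is sharp at y = 0 yields, by Fermat's rule,
  an equation between first derivatives in y. Mollification enters because the equation is exploited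
  only for smooth test functions: \<phi> u(. + y) is not smooth, but its averages in y against a
  kernel are \<phi> times a smooth function. The tested equation, as a function of y, is continuous
  and has vanishing averages near 0, so it vanishes for each small y. The convexity inequality
  survives multiplication by \<phi> only when \<phi> >= 0; a general \<phi> is written as (\<phi> +
  K \<eta>) - K \<eta> with a cutoff \<eta> that is 1 on the support of \<phi> and K a bound for
  |\<phi>|. Each pairing with an L^q function is handled by approximating that function by test
  functions, uniformly in the translation, so that differentiation in y is carried out on smooth
  objects.\<close>

lemma dpart_singleton_eq:
  assumes "(f has_derivative D) (at x)"
  shows "dpart [i] f x = D (axis i 1)"
  using frechet_derivative_at[OF assms] by simp

lemma dpart_Cons: "dpart (i # js) f = dpart [i] (dpart js f)"
  by simp

text \<open>From here on \<open>dpart [i] f\<close> is an opaque partial derivative; unfolding it to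
  \<open>frechet_derivative\<close> would hide it from the product, chain and translation
  rules.\<close>

declare dpart.simps(2) [simp del]

text \<open>A family of differentiable functions that is closed under partial derivatives contains
  all iterated ones, so smoothness follows without any formula for higher derivatives. Continuity of
  each derivative comes from its own differentiability.\<close>

lemma smooth_on_UNIV_coinduct:
  assumes "f \<in> S"
    and diff: "\<And>f x. f \<in> S \<Longrightarrow> f differentiable (at x)"
    and step: "\<And>f i. f \<in> S \<Longrightarrow> dpart [i] f \<in> S"
  shows "smooth_on UNIV f"
proof -
  have "dpart is f \<in> S" for "is"
  proof (induction "is")
    case (Cons i js)
    then show ?case using step[OF Cons] dpart_Cons[of i js f] by metis
  qed (use assms in simp)
  then have "dpart is f differentiable_on UNIV" for "is"
    by (meson diff differentiable_at_imp_differentiable_on)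
  then show ?thesis
    unfolding smooth_on_def using differentiable_imp_continuous_on by blast
qed

lemma smooth_on_UNIV_differentiable:
  assumes "smooth_on UNIV f" shows "f differentiable (at x)"
  using assms[unfolded smooth_on_def, THEN spec[of _ "[]"]]
  by (simp add: differentiable_on_def)

lemma dpart_append: "dpart (is @ js) f = dpart is (dpart js f)"
  by (induction "is") (simp_all add: dpart_Cons[of _ "_ @ _"] dpart_Cons[of _ "_ # _"] dpart.simps)

lemma smooth_on_UNIV_dpart:
  assumes "smooth_on UNIV f" shows "smooth_on UNIV (dpart js f)"
  unfolding smooth_on_def
proof
  fix "is"
  show "dpart is (dpart js f) differentiable_on UNIV \<and> continuous_on UNIV (dpart is (dpart js f))"
    using assms[unfolded smooth_on_def, THEN spec[of _ "is @ js"]] by (simp add: dpart_append)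
qed

lemma smooth_on_UNIV_continuous:
  assumes "smooth_on UNIV f" shows "continuous_on A f"
  using assms[unfolded smooth_on_def, THEN spec[of _ "[]"]] continuous_on_subset by fastforce

definition grad :: "(real^'n::finite \<Rightarrow> real) \<Rightarrow> real^'n \<Rightarrow> real^'n" where
  "grad f x = (\<chi> i. dpart [i] f x)"

lemma grad_nth [simp]: "grad f x $ i = dpart [i] f x"
  by (simp add: grad_def)

lemma has_derivative_grad:
  assumes "f differentiable (at x)"
  shows "(f has_derivative (\<lambda>h. grad f x \<bullet> h)) (at x)"
proof -
  let ?D = "frechet_derivative f (at x)"
  have D: "(f has_derivative ?D) (at x)" using assms frechet_derivative_works by blast
  then have "linear ?D" by (simp add: has_derivative_linear)
  have "?D h = grad f x \<bullet> h" for h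
  proof -
    have "?D h = ?D (\<Sum>i\<in>UNIV. h $ i *\<^sub>R axis i 1)"
      by (simp add: basis_expansion scalar_mult_eq_scaleR[symmetric])
    also have "\<dots> = (\<Sum>i\<in>UNIV. h $ i * ?D (axis i 1))"
      using \<open>linear ?D\<close> by (simp add: linear_sum linear_scale)
    finally show ?thesis by (simp add: inner_vec_def mult.commute dpart.simps)
  qed
  then show ?thesis using D by (metis (no_types, lifting) ext)
qed

lemma continuous_grad:
  assumes "smooth_on UNIV f" shows "continuous_on A (grad f)"
  unfolding grad_def[abs_def]
  by (intro continuous_intros smooth_on_UNIV_continuous smooth_on_UNIV_dpart assms)

lemma smooth_real_field_derivative:
  assumes "smooth_real \<rho>"
  shows "((deriv ^^ k) \<rho> has_field_derivative (deriv ^^ Suc k) \<rho> t) (at t)"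
  using assms DERIV_deriv_iff_real_differentiable unfolding smooth_real_def by fastforce

text \<open>An algebra of functions that contains all its partial derivatives, which makes the
  coinductive characterisation of smoothness applicable to products and compositions.\<close>

inductive smooth_expr :: "(real^'n::finite \<Rightarrow> real) \<Rightarrow> bool" where
  base: "smooth_on UNIV f \<Longrightarrow> smooth_expr f"
| add: "smooth_expr f \<Longrightarrow> smooth_expr g \<Longrightarrow> smooth_expr (\<lambda>x. f x + g x)"
| mult: "smooth_expr f \<Longrightarrow> smooth_expr g \<Longrightarrow> smooth_expr (\<lambda>x. f x * g x)"
| comp: "smooth_real \<rho> \<Longrightarrow> smooth_expr f \<Longrightarrow> smooth_expr (\<lambda>x. (deriv ^^ k) \<rho> (f x))"

lemma smooth_expr_differentiable: "smooth_expr f \<Longrightarrow> f differentiable (at x)"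
proof (induction rule: smooth_expr.induct)
  case (comp \<rho> f k)
  have "(deriv ^^ k) \<rho> differentiable (at (f x))"
    using comp unfolding smooth_real_def by blast
  from differentiable_chain_at[OF comp(3) this] show ?case by (simp add: o_def)
qed (auto simp: smooth_on_UNIV_differentiable)

lemma dpart_add:
  assumes "f differentiable (at x)" "g differentiable (at x)"
  shows "dpart [i] (\<lambda>x. f x + g x) x = dpart [i] f x + dpart [i] g x"
  by (subst dpart_singleton_eq[OF has_derivative_add[OF has_derivative_grad has_derivative_grad]])
    (auto simp: assms inner_axis)

lemma dpart_mult:
  assumes "f differentiable (at x)" "g differentiable (at x)"
  shows "dpart [i] (\<lambda>x. f x * g x) x = f x * dpart [i] g x + dpart [i] f x * g x"
  by (subst dpart_singleton_eq[OF has_derivative_mult[OF has_derivative_grad has_derivative_grad]])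
    (auto simp: assms inner_axis)

lemma dpart_comp:
  assumes "(\<rho> has_field_derivative d) (at (f x))" "f differentiable (at x)"
  shows "dpart [i] (\<lambda>x. \<rho> (f x)) x = d * dpart [i] f x"
proof -
  have "((\<lambda>x. \<rho> (f x)) has_derivative (\<lambda>h. d * (grad f x \<bullet> h))) (at x)"
    using diff_chain_at[OF has_derivative_grad[OF assms(2)] assms(1)[unfolded has_field_derivative_def]]
    by (simp add: o_def)
  from dpart_singleton_eq[OF this, of i] show ?thesis by (simp add: inner_axis)
qed

text \<open>In the composition case differentiation raises the order of the outer derivative by one,
  which is why that generator speaks of \<open>(deriv ^^ k) \<rho>\<close> for every k and not of
  \<rho> alone.\<close>

lemma smooth_expr_dpart: "smooth_expr f \<Longrightarrow> smooth_expr (dpart [i] f)"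
proof (induction rule: smooth_expr.induct)
  case (base f)
  then show ?case by (intro smooth_expr.base smooth_on_UNIV_dpart)
next
  case (add f g)
  then have "dpart [i] (\<lambda>x. f x + g x) = (\<lambda>x. dpart [i] f x + dpart [i] g x)"
    by (intro ext dpart_add smooth_expr_differentiable)
  then show ?case using add by (auto intro: smooth_expr.add)
next
  case (mult f g)
  then have "dpart [i] (\<lambda>x. f x * g x) = (\<lambda>x. f x * dpart [i] g x + dpart [i] f x * g x)"
    by (intro ext dpart_mult smooth_expr_differentiable)
  then show ?case using mult by (auto intro: smooth_expr.add smooth_expr.mult)
next
  case (comp \<rho> f k)
  then have "dpart [i] (\<lambda>x. (deriv ^^ k) \<rho> (f x)) = (\<lambda>x. (deriv ^^ Suc k) \<rho> (f x) * dpart [i] f x)"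
    by (intro ext dpart_comp smooth_real_field_derivative smooth_expr_differentiable)
  then show ?case
    using smooth_expr.mult[OF smooth_expr.comp[OF comp(1) comp(2), of "Suc k"] comp(3)]
    by (simp del: funpow.simps)
qed

lemma smooth_expr_smooth:
  assumes "smooth_expr f" shows "smooth_on UNIV f"
proof (rule smooth_on_UNIV_coinduct[of f "Collect smooth_expr"])
  show "f \<in> Collect smooth_expr" using assms by simp
  show "f differentiable (at x)" if "f \<in> Collect smooth_expr" for f :: "real^'a \<Rightarrow> real" and x
    using that smooth_expr_differentiable by blast
  show "dpart [i] f \<in> Collect smooth_expr" if "f \<in> Collect smooth_expr" for f :: "real^'a \<Rightarrow> real" and i
    using that smooth_expr_dpart by blast
qed

lemma smooth_on_UNIV_add:
  "smooth_on UNIV f \<Longrightarrow> smooth_on UNIV g \<Longrightarrow> smooth_on UNIV (\<lambda>x. f x + g x)"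
  using smooth_expr_smooth[OF smooth_expr.add[OF smooth_expr.base smooth_expr.base]] .

lemma smooth_on_UNIV_mult:
  "smooth_on UNIV f \<Longrightarrow> smooth_on UNIV g \<Longrightarrow> smooth_on UNIV (\<lambda>x. f x * g x)"
  using smooth_expr_smooth[OF smooth_expr.mult[OF smooth_expr.base smooth_expr.base]] .

lemma smooth_on_UNIV_comp:
  "smooth_real \<rho> \<Longrightarrow> smooth_on UNIV f \<Longrightarrow> smooth_on UNIV (\<lambda>x. \<rho> (f x))"
  using smooth_expr.comp[OF _ smooth_expr.base, of \<rho> f 0] smooth_expr_smooth by simp

text \<open>Polynomials are the raw material of both constructions below: the squared distance
  inside cutoffs, and the Stone-Weierstrass approximants of continuous functions.\<close>

lemma smooth_on_UNIV_real_polynomial: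
  fixes f :: "real^'n::finite \<Rightarrow> real"
  assumes "real_polynomial_function f"
  shows "smooth_on UNIV f"
proof (rule smooth_on_UNIV_coinduct[of f "Collect real_polynomial_function"])
  fix f :: "real^'n \<Rightarrow> real" and x
  assume "f \<in> Collect real_polynomial_function"
  then show "f differentiable (at x)"
    by (simp add: differentiable_at_real_polynomial_function)
next
  fix f :: "real^'n \<Rightarrow> real" and i
  assume "f \<in> Collect real_polynomial_function"
  then have "real_polynomial_function f" by simp
  then have "real_polynomial_function (dpart [i] f)"
  proof (induction rule: real_polynomial_function.induct)
    case (linear f)
    then have "(f has_derivative f) (at x)" for x by (rule bounded_linear.has_derivative) simp
    then have "dpart [i] f = (\<lambda>x. f (axis i 1))" by (intro ext dpart_singleton_eq)
    then show ?case by (simp add: real_polynomial_function.intros(2))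
  next
    case (const c)
    have "dpart [i] (\<lambda>x. c) = (\<lambda>x. 0)"
      by (intro ext) (simp add: dpart.simps frechet_derivative_const)
    then show ?case by (simp add: real_polynomial_function.intros(2))
  next
    case (add f g)
    then have "dpart [i] (\<lambda>x. f x + g x) = (\<lambda>x. dpart [i] f x + dpart [i] g x)"
      by (intro ext dpart_add differentiable_at_real_polynomial_function)
    then show ?case using add by (simp add: real_polynomial_function.intros(3))
  next
    case (mult f g)
    then have "dpart [i] (\<lambda>x. f x * g x) = (\<lambda>x. f x * dpart [i] g x + dpart [i] f x * g x)"
      by (intro ext dpart_mult differentiable_at_real_polynomial_function)
    then show ?case using mult
      by (auto intro: real_polynomial_function.intros(3) real_polynomial_function.intros(4))
  qed
  then show "dpart [i] f \<in> Collect real_polynomial_function" by simp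
qed (use assms in simp)

lemma smooth_on_UNIV_const: "smooth_on UNIV (\<lambda>x. c)"
  by (simp add: smooth_on_UNIV_real_polynomial real_polynomial_function.intros(2))

lemma zero_outside_closure_support: "x \<notin> closure {x. f x \<noteq> 0} \<Longrightarrow> f x = (0::real)"
  using closure_subset[of "{x. f x \<noteq> 0}"] by blast

lemma test_fun_support: "test_fun U \<phi> \<Longrightarrow> x \<notin> U \<Longrightarrow> \<phi> x = 0"
  unfolding test_fun_def using zero_outside_closure_support[of x \<phi>] by blast

lemma closed_subset_compact:
  "compact K \<Longrightarrow> closure S \<subseteq> K \<Longrightarrow> compact (closure S)"
  by (metis closed_closure compact_Int_closed inf.absorb_iff2)

lemma test_funI:
  assumes "smooth_on UNIV \<phi>" "compact K" "K \<subseteq> U" "\<And>x. x \<notin> K \<Longrightarrow> \<phi> x = 0"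
  shows "test_fun U \<phi>"
proof -
  have "closure {x. \<phi> x \<noteq> 0} \<subseteq> K"
    by (rule closure_minimal) (use assms compact_imp_closed in auto)
  then show ?thesis
    unfolding test_fun_def using assms(1,3) closed_subset_compact[OF assms(2)] by auto
qed

lemma test_fun_smooth: "test_fun U \<phi> \<Longrightarrow> smooth_on UNIV \<phi>"
  by (simp add: test_fun_def)

lemma test_fun_mono: "test_fun U \<phi> \<Longrightarrow> U \<subseteq> V \<Longrightarrow> test_fun V \<phi>"
  unfolding test_fun_def by blast

lemma test_fun_mult:
  assumes "test_fun U \<phi>" "smooth_on UNIV f" shows "test_fun U (\<lambda>x. \<phi> x * f x)"
proof (rule test_funI)
  show "smooth_on UNIV (\<lambda>x. \<phi> x * f x)"
    using assms smooth_on_UNIV_mult test_fun_smooth by blast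
  show "compact (closure {x. \<phi> x \<noteq> 0})" "closure {x. \<phi> x \<noteq> 0} \<subseteq> U"
    using assms unfolding test_fun_def by auto
  show "\<phi> x * f x = 0" if "x \<notin> closure {x. \<phi> x \<noteq> 0}" for x
    using zero_outside_closure_support[OF that] by simp
qed

lemma test_fun_add:
  assumes "test_fun U f" "test_fun U g" shows "test_fun U (\<lambda>x. f x + g x)"
proof (rule test_funI)
  show "smooth_on UNIV (\<lambda>x. f x + g x)"
    using assms smooth_on_UNIV_add test_fun_smooth by blast
  show "compact (closure {x. f x \<noteq> 0} \<union> closure {x. g x \<noteq> 0})"
    "closure {x. f x \<noteq> 0} \<union> closure {x. g x \<noteq> 0} \<subseteq> U"
    using assms unfolding test_fun_def by auto
  show "f x + g x = 0" if "x \<notin> closure {x. f x \<noteq> 0} \<union> closure {x. g x \<noteq> 0}" for x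
    using that zero_outside_closure_support[of x f] zero_outside_closure_support[of x g] by simp
qed

lemma dpart_zero_outside_support:
  assumes "x \<notin> closure {x. \<phi> x \<noteq> 0}" shows "dpart [i] \<phi> x = 0"
proof -
  let ?S = "- closure {x. \<phi> x \<noteq> 0}"
  have "(\<phi> has_derivative (\<lambda>h. 0)) (at x)"
  proof (rule has_derivative_transform_within_open[where s = ?S])
    show "((\<lambda>x. 0) has_derivative (\<lambda>h. 0)) (at x)" by simp
    show "0 = \<phi> y" if "y \<in> ?S" for y using that zero_outside_closure_support[of y \<phi>] by simp
  qed (use assms in auto)
  then show ?thesis by (simp only: dpart_singleton_eq)
qed

lemma test_fun_dpart:
  assumes "test_fun U \<phi>" shows "test_fun U (dpart [i] \<phi>)"
  using assms dpart_zero_outside_support[of _ \<phi> i]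
  by (intro test_funI[where K = "closure {x. \<phi> x \<noteq> 0}"] smooth_on_UNIV_dpart)
    (auto simp: test_fun_def)

lemma test_fun_bounded:
  assumes "test_fun U \<phi>" obtains C where "C > 0" "\<And>x. \<bar>\<phi> x\<bar> \<le> C"
proof -
  let ?K = "closure {x. \<phi> x \<noteq> 0}"
  have "compact (\<phi> ` ?K)"
    using assms unfolding test_fun_def
    by (intro compact_continuous_image smooth_on_UNIV_continuous) auto
  then obtain C where C: "C > 0" "\<And>y. y \<in> \<phi> ` ?K \<Longrightarrow> \<bar>y\<bar> \<le> C"
    using compact_imp_bounded bounded_pos by (metis real_norm_def)
  have "\<bar>\<phi> x\<bar> \<le> C" for x
    using C zero_outside_closure_support[of x \<phi>] by (cases "\<phi> x = 0") auto
  then show thesis using that C by blast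
qed

lemma test_fun_translate:
  assumes "test_fun U \<phi>" "\<And>x. x \<in> closure {x. \<phi> x \<noteq> 0} \<Longrightarrow> x + y \<in> V"
  shows "test_fun V (\<lambda>x. \<phi> (x - y))" "dpart [i] (\<lambda>x. \<phi> (x - y)) x = dpart [i] \<phi> (x - y)"
proof -
  have d: "dpart [i] (\<lambda>x. f (x - y)) = (\<lambda>x. dpart [i] f (x - y))"
    "(\<lambda>x. f (x - y)) differentiable (at x)"
    if "smooth_on UNIV f" for f i x
  proof -
    have *: "((\<lambda>x. f (x - y)) has_derivative (\<lambda>h. grad f (x - y) \<bullet> h)) (at x)" for x
    proof -
      have "((\<lambda>x. x - y) has_derivative (\<lambda>h. h)) (at x)" by (auto intro!: derivative_eq_intros)
      from diff_chain_at[OF this has_derivative_grad[OF smooth_on_UNIV_differentiable[OF that]]]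
      show ?thesis by (simp add: o_def)
    qed
    show "(\<lambda>x. f (x - y)) differentiable (at x)" using * differentiable_def by blast
    show "dpart [i] (\<lambda>x. f (x - y)) = (\<lambda>x. dpart [i] f (x - y))"
      by (rule ext, subst dpart_singleton_eq[OF *]) (simp add: inner_axis)
  qed
  show "dpart [i] (\<lambda>x. \<phi> (x - y)) x = dpart [i] \<phi> (x - y)"
    using d(1)[of \<phi> i] test_fun_smooth[OF assms(1)] by metis
  let ?S = "(\<lambda>f x. f (x - y)) ` {f. smooth_on UNIV f}"
  have sm: "smooth_on UNIV (\<lambda>x. \<phi> (x - y))"
  proof (rule smooth_on_UNIV_coinduct[of _ ?S])
    show "(\<lambda>x. \<phi> (x - y)) \<in> ?S" using test_fun_smooth[OF assms(1)] by auto
    show "f differentiable (at x)" if "f \<in> ?S" for f x using that d(2) by auto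
    show "dpart [i] f \<in> ?S" if fS: "f \<in> ?S" for f i
    proof -
      obtain g where g: "f = (\<lambda>x. g (x - y))" "smooth_on UNIV g" using fS by auto
      have "dpart [i] f = (\<lambda>x. dpart [i] g (x - y))" using d(1)[OF g(2)] g by metis
      then show ?thesis using smooth_on_UNIV_dpart[OF g(2)] by blast
    qed
  qed
  show "test_fun V (\<lambda>x. \<phi> (x - y))"
  proof (rule test_funI[OF sm])
    let ?K = "closure {x. \<phi> x \<noteq> 0}"
    show "compact ((\<lambda>x. x + y) ` ?K)"
      using assms unfolding test_fun_def by (intro compact_continuous_image continuous_intros) auto
    show "(\<lambda>x. x + y) ` ?K \<subseteq> V" using assms by auto
    show "\<phi> (x - y) = 0" if "x \<notin> (\<lambda>x. x + y) ` ?K" for x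
      using that zero_outside_closure_support[of "x - y" \<phi>] by (metis diff_add_cancel image_eqI)
  qed
qed

subsection \<open>Cutoff functions\<close>

text \<open>\<beta> plays two roles: it is the nonlinearity of the equation, and its normalised
  primitive is the smooth step function from which all cutoffs are made. The positive integral is
  what permits the normalisation.\<close>

locale bump =
  fixes \<beta> :: "real \<Rightarrow> real"
  assumes beta_smooth: "Cc_infty_01 \<beta>" and beta_nonneg: "\<And>t. 0 \<le> \<beta> t"
    and beta_integral_pos: "(LBINT t=0..1. \<beta> t) > 0"
begin

text \<open>For \<epsilon> > 0, \<open>primitive (t / \<epsilon>)\<close> is the integral of
  \<open>beta_eps \<beta> \<epsilon>\<close> from 0 to t. The dependence on \<epsilon> sits entirely
  in the argument, so every global bound on \<open>primitive\<close> is uniform in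
  \<epsilon>.\<close>

definition primitive :: "real \<Rightarrow> real" where
  "primitive t = (LBINT s=0..t. \<beta> s)"

lemma beta_differentiable: "(deriv ^^ k) \<beta> differentiable (at t)"
  using beta_smooth unfolding Cc_infty_01_def smooth_real_def by blast

lemma continuous_beta: "continuous_on A \<beta>"
  using beta_differentiable[of 0]
  by (auto simp: differentiable_imp_continuous_within continuous_at_imp_continuous_on)

lemma beta_zero: "t \<le> 0 \<or> 1 \<le> t \<Longrightarrow> \<beta> t = 0"
  using beta_smooth zero_outside_closure_support[of t \<beta>] unfolding Cc_infty_01_def
  by (meson greaterThanLessThan_iff not_le subsetD)

lemma beta_bounded: obtains C where "0 < C" "\<And>t. \<bar>\<beta> t\<bar> \<le> C"
proof -
  have "bounded (\<beta> ` {0..1})"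
    by (intro compact_imp_bounded compact_continuous_image continuous_beta) auto
  then obtain C where C: "C > 0" "\<And>t. t \<in> {0..1} \<Longrightarrow> \<bar>\<beta> t\<bar> \<le> C"
    unfolding bounded_pos by auto
  have "\<bar>\<beta> t\<bar> \<le> C" for t
  proof (cases "t \<in> {0..1}")
    case False
    then have "\<beta> t = 0" using beta_zero[of t] by auto
    then show ?thesis using C by simp
  qed (rule C(2))
  then show thesis using that C(1) by blast
qed

lemma primitive_deriv: "(primitive has_field_derivative \<beta> t) (at t)"
proof -
  \<comment> \<open>The interval contains both 0 and t, and the margin 1 puts t in its interior, so
    the one-sided filter of the fundamental theorem becomes \<open>at t\<close>.\<close>
  let ?a = "min 0 t - 1" and ?b = "max 0 t + 1"
  have "(primitive has_vector_derivative \<beta> t) (at t within {?a..?b})"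
    using interval_integral_FTC2[of ?a 0 ?b \<beta> t] continuous_beta
    unfolding primitive_def[abs_def] by (auto simp: zero_ereal_def)
  moreover have "at t within {?a..?b} = at t" by (rule at_within_Icc_at) auto
  ultimately show ?thesis
    unfolding has_real_derivative_iff_has_vector_derivative by metis
qed

lemma primitive_mono: "s \<le> t \<Longrightarrow> primitive s \<le> primitive t"
  by (rule DERIV_nonneg_imp_nondecreasing[of s t primitive]) (use primitive_deriv beta_nonneg in blast)+

lemma primitive_0: "primitive 0 = 0"
  by (simp add: primitive_def zero_ereal_def)

lemma primitive_nonpos: "t \<le> 0 \<Longrightarrow> primitive t = 0"
proof -
  assume "t \<le> 0"
  have "primitive 0 \<le> primitive t"
    by (rule DERIV_nonpos_imp_nonincreasing[OF \<open>t \<le> 0\<close>])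
      (use primitive_deriv beta_zero in force)
  then show ?thesis using primitive_mono[OF \<open>t \<le> 0\<close>] primitive_0 by simp
qed

lemma primitive_ge_1: "1 \<le> t \<Longrightarrow> primitive t = primitive 1"
proof -
  assume "1 \<le> t"
  have "primitive t \<le> primitive 1"
    by (rule DERIV_nonpos_imp_nonincreasing[OF \<open>1 \<le> t\<close>])
      (use primitive_deriv beta_zero in force)
  then show ?thesis using primitive_mono[OF \<open>1 \<le> t\<close>] by simp
qed

lemma primitive_bounds: "0 \<le> primitive t" "primitive t \<le> primitive 1"
  using primitive_mono[of 0 t] primitive_nonpos[of t] primitive_mono[of t 1] primitive_ge_1[of t]
    primitive_0 primitive_mono[of 0 1] by (linarith, linarith)

lemma primitive_1_pos: "primitive 1 > 0"
  using beta_integral_pos by (simp add: primitive_def one_ereal_def)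

lemma primitive_smooth: "smooth_real primitive"
  unfolding smooth_real_def
proof (intro allI)
  fix k t
  have d: "deriv primitive = \<beta>" using primitive_deriv DERIV_imp_deriv by blast
  show "(deriv ^^ k) primitive differentiable (at t)"
  proof (cases k)
    case 0
    then show ?thesis using primitive_deriv real_differentiable_def by auto
  next
    case (Suc j)
    then have "(deriv ^^ k) primitive = (deriv ^^ j) \<beta>"
      by (simp add: d funpow_swap1)
    then show ?thesis using beta_differentiable by metis
  qed
qed

text \<open>Bounds the second derivative of \<open>primitive\<close> from below, so that adding a
  large enough quadratic makes it convex.\<close>

lemma beta_deriv_bounded: obtains L where "L > 0" "\<And>t. \<bar>deriv \<beta> t\<bar> \<le> L"
proof -
  have "continuous_on {0..1} (deriv \<beta>)"
    using beta_differentiable[of 1]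
    by (auto simp: differentiable_imp_continuous_within continuous_at_imp_continuous_on)
  then have "bounded (deriv \<beta> ` {0..1})"
    by (intro compact_imp_bounded compact_continuous_image) auto
  then obtain L where L: "L > 0" "\<And>t. t \<in> {0..1} \<Longrightarrow> \<bar>deriv \<beta> t\<bar> \<le> L"
    unfolding bounded_pos by auto
  have "deriv \<beta> t = 0" if "t \<notin> {0..1}" for t
  proof (rule DERIV_imp_deriv, rule has_field_derivative_transform_within_open[where S = "- {0..1}"])
    show "((\<lambda>t. 0) has_real_derivative 0) (at t)" by simp
    show "open (- {0..1::real})" by (simp add: open_Compl)
    show "0 = \<beta> s" if "s \<in> - {0..1}" for s using that beta_zero[of s] by auto
  qed (use that in auto)
  then have "\<bar>deriv \<beta> t\<bar> \<le> L" for t using L by (cases "t \<in> {0..1}") auto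
  then show thesis using that L by blast
qed

text \<open>The rescaled squared distance \<open>q\<close> is at most 0 on the inner ball and at
  least 1 outside the outer one; \<open>1 - primitive q / primitive 1\<close> then descends from 1
  to 0. Squaring the distance keeps \<open>q\<close> a polynomial, hence smooth at the centre as
  well.\<close>

lemma cutoff_exists:
  fixes c :: "real^'n::finite"
  assumes "0 \<le> r" "r < s"
  obtains \<eta> where "smooth_on UNIV \<eta>" "\<And>x. 0 \<le> \<eta> x" "\<And>x. \<eta> x \<le> 1"
    "\<And>x. x \<in> cball c r \<Longrightarrow> \<eta> x = 1" "\<And>x. x \<notin> ball c s \<Longrightarrow> \<eta> x = 0"
proof
  define q where "q x = ((x - c) \<bullet> (x - c) - r\<^sup>2) * (1 / (s\<^sup>2 - r\<^sup>2))" for x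
  define \<eta> where "\<eta> x = 1 + (- 1 / primitive 1) * primitive (q x)" for x
  have pos: "s\<^sup>2 - r\<^sup>2 > 0" using assms by (simp add: power_strict_mono)
  have lin: "real_polynomial_function (\<lambda>x::real^'n. (x - c) $ i)" for i
  proof -
    have "real_polynomial_function (\<lambda>x::real^'n. x $ i + (- c $ i))"
      by (intro real_polynomial_function.intros bounded_linear_vec_nth)
    then show ?thesis by simp
  qed
  have "real_polynomial_function q"
    unfolding q_def[abs_def] inner_vec_def inner_real_def diff_conv_add_uminus[of "sum _ _"]
    by (intro real_polynomial_function.intros real_polynomial_function_sum lin) auto
  then show "smooth_on UNIV \<eta>"
    unfolding \<eta>_def[abs_def]
    using smooth_on_UNIV_add[OF smooth_on_UNIV_const[of 1] smooth_on_UNIV_mult[OF smooth_on_UNIV_const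
      smooth_on_UNIV_comp[OF primitive_smooth smooth_on_UNIV_real_polynomial]]] by blast
  show "0 \<le> \<eta> x" "\<eta> x \<le> 1" for x
    using primitive_bounds[of "q x"] primitive_1_pos unfolding \<eta>_def by (auto simp: field_simps)
  have q: "q x = ((dist c x)\<^sup>2 - r\<^sup>2) / (s\<^sup>2 - r\<^sup>2)" for x
    by (simp add: q_def dist_norm norm_minus_commute[of c] power2_norm_eq_inner)
  show "\<eta> x = 1" if "x \<in> cball c r" for x
  proof -
    have "(dist c x)\<^sup>2 \<le> r\<^sup>2" using that by (simp add: power_mono)
    then have "q x \<le> 0" using pos by (simp add: q divide_le_0_iff)
    then show ?thesis by (simp add: \<eta>_def primitive_nonpos)
  qed
  show "\<eta> x = 0" if "x \<notin> ball c s" for x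
  proof -
    have "s\<^sup>2 \<le> (dist c x)\<^sup>2" using that assms by (simp add: power_mono)
    then have "q x \<ge> 1" using pos by (simp add: q)
    then show ?thesis using primitive_1_pos by (simp add: \<eta>_def primitive_ge_1[of "q x"])
  qed
qed

end

section \<open>Uniform first-order expansion of test functions\<close>

lemma test_fun_bounded_support:
  assumes "test_fun U \<phi>"
  shows "\<exists>R>0. \<forall>x. R < norm x \<longrightarrow> \<phi> x = 0 \<and> grad \<phi> x = 0"
proof -
  let ?K = "closure {x. \<phi> x \<noteq> 0}"
  have "bounded ?K" using assms compact_imp_bounded unfolding test_fun_def by blast
  then obtain R where R: "R > 0" "\<And>x. x \<in> ?K \<Longrightarrow> norm x \<le> R"
    unfolding bounded_pos by auto
  have "\<phi> x = 0 \<and> grad \<phi> x = 0" if "R < norm x" for x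
  proof -
    have "x \<notin> ?K" using R(2)[of x] that by linarith
    then show ?thesis
      using zero_outside_closure_support[of x \<phi>] dpart_zero_outside_support[of x \<phi>]
      by (simp add: vec_eq_iff)
  qed
  then show ?thesis using R(1) by blast
qed

lemma grad_uniformly_continuous:
  assumes "test_fun U \<phi>" "e > 0"
  obtains d where "d > 0" "\<And>x y. norm (y - x) < d \<Longrightarrow> norm (grad \<phi> y - grad \<phi> x) \<le> e"
proof -
  obtain R where R: "R > 0" "\<forall>x. R < norm x \<longrightarrow> \<phi> x = 0 \<and> grad \<phi> x = 0"
    using test_fun_bounded_support[OF assms(1)] by blast
  have "uniformly_continuous_on (cball 0 (R + 1)) (grad \<phi>)"
    by (intro compact_uniformly_continuous continuous_grad test_fun_smooth[OF assms(1)]) auto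
  then obtain d where d: "d > 0"
    "\<And>x y. x \<in> cball 0 (R + 1) \<Longrightarrow> y \<in> cball 0 (R + 1) \<Longrightarrow> dist y x < d \<Longrightarrow> dist (grad \<phi> y) (grad \<phi> x) < e"
    using assms(2) unfolding uniformly_continuous_on_def by metis
  show thesis
  proof
    \<comment> \<open>With points less than 1 apart, either both lie in the ball of radius
      \<open>R + 1\<close>, where uniform continuity applies, or both lie outside radius
      \<open>R\<close>, where the gradient is 0.\<close>
    show "min d 1 > 0" using d by simp
    show "norm (grad \<phi> y - grad \<phi> x) \<le> e" if "norm (y - x) < min d 1" for x y
    proof (cases "norm x \<le> R + 1 \<and> norm y \<le> R + 1")
      case True
      then show ?thesis using d(2)[of x y] that by (simp add: dist_norm)
    next
      case False
      then have "R < norm x" "R < norm y"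
        using that norm_triangle_ineq2[of y x] norm_triangle_ineq2[of x y] norm_minus_commute[of x y]
        by (auto simp: not_le)
      then show ?thesis using R(2) assms(2) by simp
    qed
  qed
qed

text \<open>The mean value inequality is applied to \<phi> minus its linear part at x, whose
  gradient is small near x. Uniformity in x is what allows differentiation under the integral
  against a merely integrable function.\<close>

lemma test_fun_uniformly_differentiable:
  assumes "test_fun U \<phi>" "e > 0"
  obtains d where "d > 0" "\<And>x h. norm h < d \<Longrightarrow> \<bar>\<phi> (x + h) - \<phi> x - grad \<phi> x \<bullet> h\<bar> \<le> e * norm h"
proof -
  obtain d where d: "d > 0" "\<And>x y. norm (y - x) < d \<Longrightarrow> norm (grad \<phi> y - grad \<phi> x) \<le> e"
    using grad_uniformly_continuous[OF assms] by metis
  have "\<bar>\<phi> (x + h) - \<phi> x - grad \<phi> x \<bullet> h\<bar> \<le> e * norm h" if "norm h < d" for x h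
  proof -
    have "norm ((\<phi> (x + h) - grad \<phi> x \<bullet> (x + h)) - (\<phi> x - grad \<phi> x \<bullet> x)) \<le> e * norm (x + h - x)"
    proof (rule differentiable_bound[of "ball x d" _ "\<lambda>y h. (grad \<phi> y - grad \<phi> x) \<bullet> h"])
      show "((\<lambda>y. \<phi> y - grad \<phi> x \<bullet> y) has_derivative (\<lambda>h. (grad \<phi> y - grad \<phi> x) \<bullet> h)) (at y within ball x d)" for y
      proof -
        have "(\<phi> has_derivative (\<lambda>h. grad \<phi> y \<bullet> h)) (at y within ball x d)"
          using has_derivative_grad[OF smooth_on_UNIV_differentiable[OF test_fun_smooth[OF assms(1)]]]
            has_derivative_at_withinI by blast
        from has_derivative_diff[OF this has_derivative_inner_right[OF has_derivative_ident, of "grad \<phi> x"]]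
        show ?thesis by (simp add: inner_diff_left)
      qed
      show "onorm (\<lambda>h. (grad \<phi> y - grad \<phi> x) \<bullet> h) \<le> e" if "y \<in> ball x d" for y
      proof (rule onorm_bound)
        have "norm (grad \<phi> y - grad \<phi> x) \<le> e"
          using d(2)[of y x] that by (simp add: dist_norm norm_minus_commute)
        then show "norm ((grad \<phi> y - grad \<phi> x) \<bullet> h) \<le> e * norm h" for h
          using order_trans[OF Cauchy_Schwarz_ineq2 mult_right_mono[OF _ norm_ge_zero]] by simp
      qed (use assms in simp)
    qed (use that d in \<open>auto simp: dist_norm\<close>)
    then show ?thesis by (simp add: inner_add_right algebra_simps)
  qed
  then show thesis using that d by blast
qed

subsection \<open>Correlation with a test function and integration by parts\<close>

lemma lborel_integral_shift:
  fixes f :: "real^'n::finite \<Rightarrow> real"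
  assumes "f \<in> borel_measurable borel"
  shows "(\<integral>x. f (x + a) \<partial>lborel) = (\<integral>x. f x \<partial>lborel)"
    and "integrable lborel (\<lambda>x. f (x + a)) \<longleftrightarrow> integrable lborel f"
proof -
  have m: "(+) a \<in> measurable lborel borel" by simp
  show "(\<integral>x. f (x + a) \<partial>lborel) = (\<integral>x. f x \<partial>lborel)"
    using integral_distr[OF m assms] by (simp add: lborel_distr_plus add.commute)
  show "integrable lborel (\<lambda>x. f (x + a)) \<longleftrightarrow> integrable lborel f"
    using integrable_distr_eq[OF m assms] by (simp add: lborel_distr_plus add.commute)
qed

lemma integrable_bounded_mult:
  fixes f V :: "real^'n::finite \<Rightarrow> real"
  assumes "f \<in> borel_measurable borel" "\<And>x. \<bar>f x\<bar> \<le> C" "integrable lborel V"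
  shows "integrable lborel (\<lambda>x. f x * V x)"
proof (rule Bochner_Integration.integrable_bound)
  show "integrable lborel (\<lambda>x. C * \<bar>V x\<bar>)" using assms by simp
  show "(\<lambda>x. f x * V x) \<in> borel_measurable lborel" using assms by simp
  have "\<bar>f x\<bar> * \<bar>V x\<bar> \<le> \<bar>C\<bar> * \<bar>V x\<bar>" for x
    by (rule mult_right_mono) (use assms(2)[of x] in auto)
  then show "AE x in lborel. norm (f x * V x) \<le> norm (C * \<bar>V x\<bar>)"
    by (simp add: abs_mult)
qed

lemma smooth_measurable [measurable]: "smooth_on UNIV f \<Longrightarrow> f \<in> borel_measurable borel"
  by (intro borel_measurable_continuous_onI smooth_on_UNIV_continuous)

lemma test_fun_measurable: "test_fun U \<phi> \<Longrightarrow> \<phi> \<in> borel_measurable borel"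
  using smooth_measurable test_fun_smooth by blast

lemma test_fun_shift_mult_integrable:
  fixes \<phi> V :: "real^'n::finite \<Rightarrow> real"
  assumes "test_fun U \<phi>" "integrable lborel V"
  shows "integrable lborel (\<lambda>x. \<phi> (x - y) * V x)"
proof -
  obtain C where "\<And>x. \<bar>\<phi> x\<bar> \<le> C" using test_fun_bounded[OF assms(1)] by metis
  then show ?thesis
    using test_fun_measurable[OF assms(1)] by (intro integrable_bounded_mult[OF _ _ assms(2)]) auto
qed

lemma integrable_indicator_cball: "integrable lborel (indicator (cball c r) :: real^'n::finite \<Rightarrow> real)"
  by (rule integrable_real_indicator) (use emeasure_bounded_finite in auto)

lemma test_fun_integrable:
  fixes \<phi> :: "real^'n::finite \<Rightarrow> real"
  assumes "test_fun U \<phi>" shows "integrable lborel \<phi>"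
proof -
  obtain R where R: "\<forall>x. R < norm x \<longrightarrow> \<phi> x = 0 \<and> grad \<phi> x = 0"
    using test_fun_bounded_support[OF assms] by blast
  then have "(\<lambda>x. \<phi> x * indicator (cball 0 R) x) = \<phi>"
    by (intro ext) (auto simp: indicator_def)
  then show ?thesis
    using test_fun_shift_mult_integrable[OF assms integrable_indicator_cball, of 0 0 R] by simp
qed

text \<open>This is the convolution of V with the reflected \<phi>. Placing the translation on
  \<phi> makes it smooth in y; a change of variables places it on V instead, which is the form in
  which translates of the solution occur.\<close>

definition correlation :: "(real^'n::finite \<Rightarrow> real) \<Rightarrow> (real^'n \<Rightarrow> real) \<Rightarrow> real^'n \<Rightarrow> real" where
  "correlation \<phi> V y = (\<integral>x. \<phi> (x - y) * V x \<partial>lborel)"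

text \<open>The Taylor remainder of \<phi> is uniformly small relative to the increment, so its
  integral against V is small relative to the increment times the L^1 norm of V. The minus sign
  comes from y entering through \<open>x - y\<close>.\<close>

lemma correlation_has_derivative:
  fixes \<phi> V :: "real^'n::finite \<Rightarrow> real"
  assumes t: "test_fun U \<phi>" and V: "integrable lborel V"
  shows "(correlation \<phi> V has_derivative (\<lambda>h. (\<chi> i. - correlation (dpart [i] \<phi>) V y) \<bullet> h)) (at y)"
  unfolding has_derivative_at_alt
proof (intro conjI allI impI)
  let ?E = "(\<chi> i. - correlation (dpart [i] \<phi>) V y) :: real^'n"
  show "bounded_linear (\<lambda>h. ?E \<bullet> h)" by (rule bounded_linear_inner_right)
  fix e :: real assume e: "e > 0"
  \<comment> \<open>The added 1 keeps \<open>B\<close> positive when V vanishes almost everywhere,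
    so that \<open>e / B\<close> is a legitimate tolerance.\<close>
  define B where "B = (\<integral>x. \<bar>V x\<bar> \<partial>lborel) + 1"
  have B: "B > 0" unfolding B_def by (simp add: add_nonneg_pos)
  obtain d where d: "d > 0" "\<And>x h. norm h < d \<Longrightarrow> \<bar>\<phi> (x + h) - \<phi> x - grad \<phi> x \<bullet> h\<bar> \<le> (e / B) * norm h"
    using test_fun_uniformly_differentiable[OF t, of "e / B"] e B by auto
  have int: "integrable lborel (\<lambda>x. \<phi> (x - z) * V x)" "integrable lborel (\<lambda>x. dpart [i] \<phi> (x - z) * V x)" for z i
    using test_fun_shift_mult_integrable[OF _ V] t test_fun_dpart[OF t] by blast+
  have "norm (correlation \<phi> V z - correlation \<phi> V y - ?E \<bullet> (z - y)) \<le> e * norm (z - y)" if z: "norm (z - y) < d" for z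
  proof -
    \<comment> \<open>The increment is reversed because \<open>x - z\<close> equals
      \<open>(x - y) + (y - z)\<close>.\<close>
    let ?h = "y - z"
    have g: "(\<lambda>x. (grad \<phi> (x - y) \<bullet> ?h) * V x) = (\<lambda>x. \<Sum>i\<in>UNIV. ?h $ i * (dpart [i] \<phi> (x - y) * V x))"
      by (intro ext) (simp only: inner_vec_def inner_real_def grad_nth sum_distrib_right sum_distrib_left mult_ac)
    have ig: "integrable lborel (\<lambda>x. (grad \<phi> (x - y) \<bullet> ?h) * V x)"
      unfolding g using int by (intro Bochner_Integration.integrable_sum) simp
    have "(\<integral>x. (grad \<phi> (x - y) \<bullet> ?h) * V x \<partial>lborel) = (\<Sum>i\<in>UNIV. ?h $ i * correlation (dpart [i] \<phi>) V y)"
      unfolding g correlation_def using int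
      by (subst Bochner_Integration.integral_sum) auto
    also have "\<dots> = ?E \<bullet> (z - y)"
      by (simp add: inner_vec_def sum_negf[symmetric] algebra_simps)
    finally have "correlation \<phi> V z - correlation \<phi> V y - ?E \<bullet> (z - y)
      = (\<integral>x. (\<phi> ((x - y) + ?h) - \<phi> (x - y) - grad \<phi> (x - y) \<bullet> ?h) * V x \<partial>lborel)"
      unfolding correlation_def using int ig by (simp add: left_diff_distrib)
    also have "norm \<dots> \<le> (\<integral>x. (e / B * norm ?h) * \<bar>V x\<bar> \<partial>lborel)"
    proof (rule Bochner_Integration.integral_norm_bound_integral)
      have "(\<lambda>x. (\<phi> ((x - y) + ?h) - \<phi> (x - y) - grad \<phi> (x - y) \<bullet> ?h) * V x)
        = (\<lambda>x. \<phi> (x - z) * V x - \<phi> (x - y) * V x - (grad \<phi> (x - y) \<bullet> ?h) * V x)"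
        by (simp add: left_diff_distrib)
      then show "integrable lborel (\<lambda>x. (\<phi> ((x - y) + ?h) - \<phi> (x - y) - grad \<phi> (x - y) \<bullet> ?h) * V x)"
        using int ig by simp
      show "norm ((\<phi> ((x - y) + ?h) - \<phi> (x - y) - grad \<phi> (x - y) \<bullet> ?h) * V x) \<le> e / B * norm ?h * \<bar>V x\<bar>" for x
        using mult_right_mono[OF d(2)[of ?h "x - y"] abs_ge_zero[of "V x"]] z
        by (simp add: abs_mult norm_minus_commute)
    qed (use V in simp)
    also have "\<dots> = e * norm ?h * ((\<integral>x. \<bar>V x\<bar> \<partial>lborel) / B)" using B by simp
    also have "\<dots> \<le> e * norm ?h * 1"
      by (rule mult_left_mono) (use B e in \<open>auto simp: B_def\<close>)
    finally show ?thesis by (simp add: norm_minus_commute)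
  qed
  then show "\<exists>d>0. \<forall>z. norm (z - y) < d \<longrightarrow>
      norm (correlation \<phi> V z - correlation \<phi> V y - ?E \<bullet> (z - y)) \<le> e * norm (z - y)"
    using d(1) by blast
qed

lemma dpart_correlation:
  assumes "test_fun U \<phi>" "integrable lborel V"
  shows "dpart [i] (correlation \<phi> V) y = - correlation (dpart [i] \<phi>) V y"
  by (subst dpart_singleton_eq[OF correlation_has_derivative[OF assms]]) (simp add: inner_axis)

lemma continuous_correlation:
  assumes "test_fun U \<phi>" "integrable lborel V"
  shows "continuous_on A (correlation \<phi> V)"
  using correlation_has_derivative[OF assms]
  by (meson continuous_at_imp_continuous_on has_derivative_continuous)

lemma correlation_smooth:
  fixes \<phi> V :: "real^'n::finite \<Rightarrow> real"
  assumes t: "test_fun U \<phi>" and V: "integrable lborel V"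
  shows "smooth_on UNIV (correlation \<phi> V)"
proof (rule smooth_on_UNIV_coinduct)
  \<comment> \<open>The scalar c absorbs the factor -1 produced by each differentiation.\<close>
  let ?S = "{f. \<exists>c \<phi>. test_fun U \<phi> \<and> f = (\<lambda>y. c * correlation \<phi> V y)}"
  show "correlation \<phi> V \<in> ?S" using t by (intro CollectI exI[of _ 1] exI[of _ \<phi>]) auto
  have der: "((\<lambda>y. c * correlation \<phi> V y) has_derivative
      (\<lambda>h. c * ((\<chi> i. - correlation (dpart [i] \<phi>) V y) \<bullet> h))) (at y)" if "test_fun U \<phi>" for c \<phi> y
    by (rule has_derivative_mult_right[OF correlation_has_derivative[OF that V]])
  show "f differentiable (at y)" if "f \<in> ?S" for f y
    using that der unfolding differentiable_def by blast
  show "dpart [i] f \<in> ?S" if "f \<in> ?S" for f i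
  proof -
    obtain c \<phi> where f: "test_fun U \<phi>" "f = (\<lambda>y. c * correlation \<phi> V y)" using \<open>f \<in> ?S\<close> by blast
    have "dpart [i] f = (\<lambda>y. (- c) * correlation (dpart [i] \<phi>) V y)"
      unfolding f(2) by (rule ext, subst dpart_singleton_eq[OF der[OF f(1)]]) (simp add: inner_axis)
    then show ?thesis using test_fun_dpart[OF f(1)] by blast
  qed
qed

text \<open>Translation invariance replaces the divergence theorem: correlated with the indicator of
  a ball one unit larger than the support, \<phi> gives the same value for all shifts shorter than
  1, so the derivative at 0, which is minus the integral sought, is zero.\<close>

lemma integral_dpart_eq_0:
  fixes \<phi> :: "real^'n::finite \<Rightarrow> real"
  assumes t: "test_fun U \<phi>"
  shows "(\<integral>x. dpart [i] \<phi> x \<partial>lborel) = 0"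
proof -
  obtain R where R: "\<forall>x. R < norm x \<longrightarrow> \<phi> x = 0 \<and> grad \<phi> x = 0"
    using test_fun_bounded_support[OF assms] by blast
  define V :: "real^'n \<Rightarrow> real" where "V = indicator (cball 0 (R + 1))"
  have V: "integrable lborel V" unfolding V_def by (rule integrable_indicator_cball)
  have d0: "dpart [i] \<phi> x = 0" if "R < norm x" for x
    using R that by (metis grad_nth zero_index)
  have "correlation \<phi> V z = (\<integral>x. \<phi> x \<partial>lborel)" if "norm z < 1" for z
  proof -
    have "\<phi> (x - z) * V x = \<phi> (x + (- z))" for x
    proof (cases "norm x \<le> R + 1")
      case False
      then have "R < norm (x - z)" using that norm_triangle_ineq2[of x z] by linarith
      then show ?thesis using R by simp
    qed (simp add: V_def)
    then show ?thesis
      unfolding correlation_def by (simp only: lborel_integral_shift[OF test_fun_measurable[OF t]])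
  qed
  then have "((\<lambda>z. (\<integral>x. \<phi> x \<partial>lborel)) has_derivative (\<lambda>h. (\<chi> i. - correlation (dpart [i] \<phi>) V 0) \<bullet> h)) (at 0)"
    by (intro has_derivative_transform_within_open[OF correlation_has_derivative[OF t V], of "ball 0 1"]) auto
  from has_derivative_unique[OF this has_derivative_const]
  have "(\<chi> i. - correlation (dpart [i] \<phi>) V 0) \<bullet> (axis i 1) = (0::real)" by (rule fun_cong)
  then have "correlation (dpart [i] \<phi>) V 0 = 0" by (simp add: inner_axis)
  moreover have "dpart [i] \<phi> x * V x = dpart [i] \<phi> x" for x
    using d0[of x] by (cases "R < norm x") (auto simp: V_def)
  ultimately show ?thesis by (simp add: correlation_def)
qed

lemma integral_by_parts_test_fun:
  fixes \<phi> f :: "real^'n::finite \<Rightarrow> real"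
  assumes t: "test_fun U \<phi>" and f: "smooth_on UNIV f"
  shows "(\<integral>x. f x * dpart [i] \<phi> x \<partial>lborel) = - (\<integral>x. dpart [i] f x * \<phi> x \<partial>lborel)"
proof -
  have "dpart [i] (\<lambda>x. \<phi> x * f x) = (\<lambda>x. \<phi> x * dpart [i] f x + dpart [i] \<phi> x * f x)"
    by (intro ext dpart_mult smooth_on_UNIV_differentiable f test_fun_smooth[OF t])
  moreover have "integrable lborel (\<lambda>x. \<phi> x * dpart [i] f x)" "integrable lborel (\<lambda>x. dpart [i] \<phi> x * f x)"
    using test_fun_integrable test_fun_mult t test_fun_dpart[OF t] f smooth_on_UNIV_dpart[OF f] by blast+
  ultimately show ?thesis
    using integral_dpart_eq_0[OF test_fun_mult[OF t f], of i] by (simp add: mult.commute)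
qed

section \<open>Test functions as members of the Sobolev spaces\<close>

lemma set_integral_lebesgue_eq_lborel:
  fixes f :: "real^'n::finite \<Rightarrow> real"
  assumes "f \<in> borel_measurable borel" "\<And>x. x \<notin> U \<Longrightarrow> f x = 0"
  shows "(LINT x:U|lebesgue. f x) = (\<integral>x. f x \<partial>lborel)"
proof -
  have "(\<lambda>x. indicator U x *\<^sub>R f x) = f" using assms(2) by (intro ext) (auto simp: indicator_def)
  then show ?thesis
    unfolding set_lebesgue_integral_def using integral_completion[of f lborel] assms(1) by simp
qed

lemma test_fun_set_integrable_powr:
  fixes \<phi> :: "real^'n::finite \<Rightarrow> real"
  assumes "test_fun U \<phi>" "open U" "0 < p"
  shows "set_integrable lebesgue U (\<lambda>x. \<bar>\<phi> x\<bar> powr p)"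
proof -
  obtain R where R: "\<forall>x. R < norm x \<longrightarrow> \<phi> x = 0 \<and> grad \<phi> x = 0"
    using test_fun_bounded_support[OF assms(1)] by blast
  obtain C where C: "\<And>x. \<bar>\<phi> x\<bar> \<le> C" using test_fun_bounded[OF assms(1)] by metis
  have "integrable lborel (\<lambda>x. (\<bar>\<phi> x\<bar> powr p) * indicator (cball 0 R) x)"
  proof (rule integrable_bounded_mult[OF _ _ integrable_indicator_cball])
    show "(\<lambda>x. \<bar>\<phi> x\<bar> powr p) \<in> borel_measurable borel" using test_fun_measurable[OF assms(1)] by measurable
    show "\<bar>\<bar>\<phi> x\<bar> powr p\<bar> \<le> C powr p" for x using C[of x] assms by (simp add: powr_mono2)
  qed
  moreover have "(\<bar>\<phi> x\<bar> powr p) * indicator (cball 0 R) x = indicator U x *\<^sub>R \<bar>\<phi> x\<bar> powr p" for x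
    using R test_fun_support[OF assms(1), of x] by (cases "R < norm x") (auto simp: indicator_def)
  ultimately show ?thesis
    unfolding set_integrable_def by (simp add: integrable_completion assms test_fun_measurable[OF assms(1)])
qed

lemma smooth_loc_integrable:
  fixes f :: "real^'n::finite \<Rightarrow> real"
  assumes "smooth_on UNIV f" shows "loc_integrable U f"
  unfolding loc_integrable_def
proof (intro allI impI)
  fix K assume "compact K \<and> K \<subseteq> U"
  then have "set_integrable lborel K f"
    unfolding set_integrable_def
    by (intro borel_integrable_compact smooth_on_UNIV_continuous[OF assms]) auto
  then show "set_integrable lebesgue K f"
    unfolding set_integrable_def
    using integrable_completion[of "\<lambda>x. indicator K x *\<^sub>R f x" lborel] borel_measurable_integrable by blast
qed

text \<open>Licenses test functions in the weak equation. The approximating sequence is constant,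
  and the classical gradient is the weak one by integration by parts.\<close>

lemma test_fun_sobolev0:
  fixes \<psi> :: "real^'n::finite \<Rightarrow> real"
  assumes t: "test_fun U \<psi>" and U: "open U" and p: "1 < p"
  shows "sobolev0 U p \<psi> (grad \<psi>)"
proof -
  have L: "Lp U p \<phi>" if "test_fun U \<phi>" for \<phi>
    unfolding Lp_def
  proof
    have "\<phi> \<in> borel_measurable lebesgue"
      using test_fun_measurable[OF that] by (simp add: measurable_completion)
    then show "\<phi> \<in> borel_measurable (lebesgue_on U)" by (rule measurable_restrict_space1)
    show "set_integrable lebesgue U (\<lambda>x. \<bar>\<phi> x\<bar> powr p)"
      using test_fun_set_integrable_powr[OF that U] p by simp
  qed
  have "weak_gradient U \<psi> (grad \<psi>)"
    unfolding weak_gradient_def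
  proof (intro conjI allI impI)
    show "loc_integrable U \<psi>" "loc_integrable U (\<lambda>x. grad \<psi> x $ i)" for i
      using smooth_loc_integrable test_fun_smooth t test_fun_dpart[OF t, of i] by auto
    fix \<phi> i assume f: "test_fun U \<phi>"
    have m: "(\<lambda>x. \<psi> x * dpart [i] \<phi> x) \<in> borel_measurable borel" "(\<lambda>x. grad \<psi> x $ i * \<phi> x) \<in> borel_measurable borel"
      using test_fun_measurable[OF f] test_fun_measurable[OF t] test_fun_measurable[OF test_fun_dpart[OF f, of i]]
        test_fun_measurable[OF test_fun_dpart[OF t, of i]] by simp_all
    show "(LINT x:U|lebesgue. \<psi> x * dpart [i] \<phi> x) = - (LINT x:U|lebesgue. grad \<psi> x $ i * \<phi> x)"
      using integral_by_parts_test_fun[OF f test_fun_smooth[OF t], of i]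
        set_integral_lebesgue_eq_lborel[OF m(1)] set_integral_lebesgue_eq_lborel[OF m(2)]
        test_fun_support[OF f] test_fun_support[OF t] by simp
  qed
  then have "sobolev U p \<psi> (grad \<psi>)"
    unfolding sobolev_def using L t test_fun_dpart[OF t] by simp
  then show ?thesis
    unfolding sobolev0_def using t p by (intro conjI exI[of _ "\<lambda>k. \<psi>"]) (auto simp: set_lebesgue_integral_def)
qed

subsection \<open>Approximation by test functions in Lebesgue spaces\<close>

text \<open>From |a + b| <= 2 max(|a|, |b|); the constant is crude but holds for every positive
  exponent.\<close>

lemma powr_add_le:
  fixes a b q :: real
  assumes "0 < q"
  shows "\<bar>a + b\<bar> powr q \<le> 2 powr q * (\<bar>a\<bar> powr q + \<bar>b\<bar> powr q)"
proof -
  have "\<bar>a + b\<bar> powr q \<le> (2 * max \<bar>a\<bar> \<bar>b\<bar>) powr q"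
    using assms by (intro powr_mono2) auto
  also have "\<dots> = 2 powr q * (max \<bar>a\<bar> \<bar>b\<bar>) powr q" by (simp add: powr_mult)
  also have "(max \<bar>a\<bar> \<bar>b\<bar>) powr q \<le> \<bar>a\<bar> powr q + \<bar>b\<bar> powr q" by (auto simp: max_def)
  finally show ?thesis by (simp add: mult_left_mono)
qed

lemma integrable_powr_add:
  fixes f g :: "real^'n::finite \<Rightarrow> real"
  assumes "0 < q" "f \<in> borel_measurable borel" "g \<in> borel_measurable borel"
    "integrable lborel (\<lambda>x. \<bar>f x\<bar> powr q)" "integrable lborel (\<lambda>x. \<bar>g x\<bar> powr q)"
  shows "integrable lborel (\<lambda>x. \<bar>f x + g x\<bar> powr q)"
    and "(\<integral>x. \<bar>f x + g x\<bar> powr q \<partial>lborel)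
      \<le> 2 powr q * ((\<integral>x. \<bar>f x\<bar> powr q \<partial>lborel) + (\<integral>x. \<bar>g x\<bar> powr q \<partial>lborel))"
proof -
  have i: "integrable lborel (\<lambda>x. 2 powr q * (\<bar>f x\<bar> powr q + \<bar>g x\<bar> powr q))" using assms by simp
  show 1: "integrable lborel (\<lambda>x. \<bar>f x + g x\<bar> powr q)"
    by (rule Bochner_Integration.integrable_bound[OF i])
      (use assms powr_add_le in \<open>auto simp: abs_of_nonneg\<close>)
  show "(\<integral>x. \<bar>f x + g x\<bar> powr q \<partial>lborel)
      \<le> 2 powr q * ((\<integral>x. \<bar>f x\<bar> powr q \<partial>lborel) + (\<integral>x. \<bar>g x\<bar> powr q \<partial>lborel))"
    using integral_mono[OF 1 i powr_add_le[OF assms(1)]] assms by simp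
qed

text \<open>Truncation to [-k, k]. It reduces L^q approximation to bounded functions, and later
  turns the almost-everywhere bound on u into a pointwise one.\<close>

definition clamp_to :: "real \<Rightarrow> real \<Rightarrow> real" where
  "clamp_to k t = max (- k) (min k t)"

lemma clamp_to_bound: "0 \<le> k \<Longrightarrow> \<bar>clamp_to k t\<bar> \<le> k"
  and clamp_to_id: "\<bar>t\<bar> \<le> k \<Longrightarrow> clamp_to k t = t"
  and clamp_to_diff: "0 \<le> k \<Longrightarrow> \<bar>t - clamp_to k t\<bar> \<le> \<bar>t\<bar>"
  and clamp_to_0: "0 \<le> k \<Longrightarrow> clamp_to k 0 = 0"
  by (auto simp: clamp_to_def)

lemma clamp_to_continuous: "continuous_on A f \<Longrightarrow> continuous_on A (\<lambda>x. clamp_to k (f x))"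
  unfolding clamp_to_def by (intro continuous_intros)

lemma clamp_to_measurable [measurable (raw)]:
  "f \<in> borel_measurable M \<Longrightarrow> (\<lambda>x. clamp_to k (f x)) \<in> borel_measurable M"
  unfolding clamp_to_def by (intro borel_measurable_max borel_measurable_min borel_measurable_const)

lemma clamp_to_tendsto: "(f \<longlongrightarrow> l) F \<Longrightarrow> ((\<lambda>x. clamp_to k (f x)) \<longlongrightarrow> clamp_to k l) F"
  unfolding clamp_to_def by (intro tendsto_intros)

context bump
begin

text \<open>A measurable function is an almost-everywhere limit of continuous ones. These are
  truncated at k, replaced by polynomials within 1/(n+1) on a compact ball, and cut off; the results
  converge almost everywhere under a common bound on that ball, so dominated convergence
  applies.\<close>

lemma bounded_approx_test_fun:
  fixes w :: "real^'n::finite \<Rightarrow> real"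
  assumes w: "w \<in> borel_measurable borel" "\<And>x. \<bar>w x\<bar> \<le> k" "\<And>x. x \<notin> cball c s \<Longrightarrow> w x = 0"
    and s: "0 \<le> s" "s < s'" and q: "0 < q" and e: "0 < e"
  obtains f where "test_fun (ball c s') f" "integrable lborel (\<lambda>x. \<bar>w x - f x\<bar> powr q)"
    "(\<integral>x. \<bar>w x - f x\<bar> powr q \<partial>lborel) < e"
proof -
  \<comment> \<open>A radius strictly in between: the cutoff is 1 on the support of w, and its own
    support is a compact subset of the open ball of radius s'.\<close>
  define s2 where "s2 = (s + s') / 2"
  have s2: "s < s2" "s2 < s'" using s by (auto simp: s2_def)
  obtain \<eta> where \<eta>: "smooth_on UNIV \<eta>" "\<And>x. 0 \<le> \<eta> x" "\<And>x. \<eta> x \<le> 1"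
    "\<And>x. x \<in> cball c s \<Longrightarrow> \<eta> x = 1" "\<And>x. x \<notin> ball c s2 \<Longrightarrow> \<eta> x = 0"
    using cutoff_exists[OF s(1) s2(1), of c] by metis
  have k: "0 \<le> k" using w(2)[of c] by linarith
  have "w \<in> borel_measurable lebesgue" using w(1) by (simp add: measurable_completion)
  then have "w measurable_on UNIV" by (simp add: measurable_on_iff_borel_measurable)
  then obtain N g where N: "negligible N" and gc: "\<And>n. continuous_on UNIV (g n)"
    and g: "\<And>x. x \<notin> N \<Longrightarrow> (\<lambda>n. g n x) \<longlonglongrightarrow> w x"
    unfolding measurable_on_def by auto
  have "\<exists>P. real_polynomial_function P \<and> (\<forall>x\<in>cball c s'. \<bar>clamp_to k (g n x) - P x\<bar> < 1 / real (Suc n))" for n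
  proof -
    have "continuous_on (cball c s') (\<lambda>x. clamp_to k (g n x))"
      by (intro clamp_to_continuous continuous_on_subset[OF gc]) auto
    from Stone_Weierstrass_real_polynomial_function[OF compact_cball this, of "1 / real (Suc n)"]
    show ?thesis by (metis of_nat_0_less_iff zero_less_Suc zero_less_divide_1_iff)
  qed
  then obtain P where P: "\<And>n. real_polynomial_function (P n)"
    and Pb: "\<And>n x. x \<in> cball c s' \<Longrightarrow> \<bar>clamp_to k (g n x) - P n x\<bar> < 1 / real (Suc n)"
    by metis
  define f where "f n x = \<eta> x * P n x" for n x
  have ft: "test_fun (ball c s') (f n)" for n
    unfolding f_def
  proof (rule test_funI[of _ "cball c s2"])
    show "smooth_on UNIV (\<lambda>x. \<eta> x * P n x)"
      by (rule smooth_on_UNIV_mult[OF \<eta>(1) smooth_on_UNIV_real_polynomial[OF P]])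
    show "cball c s2 \<subseteq> ball c s'" using s2 by auto
    show "\<eta> x * P n x = 0" if "x \<notin> cball c s2" for x using \<eta>(5)[of x] that by simp
  qed simp
  have lim: "(\<lambda>n. \<bar>w x - f n x\<bar> powr q) \<longlonglongrightarrow> 0" if "x \<notin> N" for x
  proof -
    have "(\<lambda>n. f n x) \<longlonglongrightarrow> w x"
    proof (cases "x \<in> cball c s'")
      case True
      have "(\<lambda>n. clamp_to k (g n x)) \<longlonglongrightarrow> clamp_to k (w x)"
        by (rule clamp_to_tendsto[OF g[OF that]])
      moreover have "(\<lambda>n. clamp_to k (g n x) - P n x) \<longlonglongrightarrow> 0"
      proof (rule Lim_null_comparison[OF _ LIMSEQ_inverse_real_of_nat])
        show "\<forall>\<^sub>F n in sequentially. norm (clamp_to k (g n x) - P n x) \<le> inverse (real (Suc n))"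
          using Pb[OF True] by (intro always_eventually allI) (simp add: less_imp_le inverse_eq_divide)
      qed
      ultimately have "(\<lambda>n. clamp_to k (g n x) - (clamp_to k (g n x) - P n x)) \<longlonglongrightarrow> clamp_to k (w x) - 0"
        by (rule tendsto_diff)
      then have "(\<lambda>n. P n x) \<longlonglongrightarrow> w x" using clamp_to_id[OF w(2)] by simp
      then have "(\<lambda>n. \<eta> x * P n x) \<longlonglongrightarrow> \<eta> x * w x" by (rule tendsto_mult_left)
      moreover have "\<eta> x * w x = w x" using w(3)[of x] \<eta>(4)[of x] by (cases "x \<in> cball c s") simp_all
      ultimately show ?thesis by (simp add: f_def)
    next
      case False
      then have "w x = 0" "\<eta> x = 0" using w(3)[of x] \<eta>(5)[of x] s s2 by auto
      then show ?thesis by (simp add: f_def)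
    qed
    then have "(\<lambda>n. \<bar>w x - f n x\<bar>) \<longlonglongrightarrow> 0"
      using tendsto_rabs_zero[OF LIM_zero[of "\<lambda>n. f n x" "w x"]] by (simp add: abs_minus_commute)
    then have "(\<lambda>n. \<bar>w x - f n x\<bar> powr q) \<longlonglongrightarrow> 0 powr q"
      by (rule tendsto_powr') (use q in auto)
    then show ?thesis by simp
  qed
  \<comment> \<open>k bounds w, and k + 1 bounds the cut-off polynomial, whose distance from a
    function truncated at k is at most 1.\<close>
  have bnd: "\<bar>w x - f n x\<bar> powr q \<le> (2 * k + 1) powr q * indicator (cball c s') x" for n x
  proof (cases "x \<in> cball c s'")
    case True
    have "1 / real (Suc n) \<le> 1" by simp
    then have "\<bar>P n x\<bar> \<le> k + 1"
      using Pb[OF True, of n] clamp_to_bound[OF k, of "g n x"] by linarith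
    then have "\<bar>f n x\<bar> \<le> 1 * (k + 1)"
      unfolding f_def abs_mult using \<eta>(2,3)[of x] by (intro mult_mono) auto
    then have "\<bar>w x - f n x\<bar> \<le> 2 * k + 1" 
      using w(2)[of x] abs_triangle_ineq4[of "w x" "f n x"] by simp
    then show ?thesis using True q by (simp add: powr_mono2)
  next
    case False
    then have "w x = 0" "\<eta> x = 0" using w(3)[of x] \<eta>(5)[of x] s s2 by auto
    then show ?thesis using False by (simp add: f_def)
  qed
  have mf: "f n \<in> borel_measurable borel" for n by (rule test_fun_measurable[OF ft])
  have ib: "integrable lborel (\<lambda>x. (2 * k + 1) powr q * indicator (cball c s') x)"
    by (intro integrable_mult_right integrable_indicator_cball)
  have ae: "AE x in lborel. (\<lambda>n. \<bar>w x - f n x\<bar> powr q) \<longlonglongrightarrow> 0"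
  proof -
    have "AE x in lebesgue. x \<notin> N" using N AE_not_in negligible_iff_null_sets by blast
    then have "AE x in lborel. x \<notin> N" by (simp add: AE_completion_iff)
    then show ?thesis by (rule AE_mp) (use lim in auto)
  qed
  have m: "(\<lambda>x. \<bar>w x - f n x\<bar> powr q) \<in> borel_measurable lborel" for n using w(1) mf by simp
  have bae: "AE x in lborel. norm (\<bar>w x - f n x\<bar> powr q) \<le> (2 * k + 1) powr q * indicator (cball c s') x" for n
    using bnd by (simp add: abs_of_nonneg)
  have m0: "(\<lambda>x. 0::real) \<in> borel_measurable lborel" by simp
  have int: "integrable lborel (\<lambda>x. \<bar>w x - f n x\<bar> powr q)" for n
    by (rule integrable_dominated_convergence2[OF m0 m ib ae bae])
  have "(\<lambda>n. \<integral>x. \<bar>w x - f n x\<bar> powr q \<partial>lborel) \<longlonglongrightarrow> (\<integral>x. 0 \<partial>(lborel :: (real^'n) measure))"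
    by (rule integral_dominated_convergence[OF m0 m ib ae bae])
  then have "\<forall>\<^sub>F n in sequentially. (\<integral>x. \<bar>w x - f n x\<bar> powr q \<partial>lborel) < e"
    using order_tendstoD(2)[of _ 0 sequentially e] e by simp
  then obtain n where "(\<integral>x. \<bar>w x - f n x\<bar> powr q \<partial>lborel) < e"
    unfolding eventually_sequentially by blast
  then show thesis using that[OF ft int] by blast
qed

lemma Lq_approx_test_fun:
  fixes w :: "real^'n::finite \<Rightarrow> real"
  assumes w: "w \<in> borel_measurable borel" "integrable lborel (\<lambda>x. \<bar>w x\<bar> powr q)"
      "\<And>x. x \<notin> cball c s \<Longrightarrow> w x = 0"
    and s: "0 \<le> s" "s < s'" and q: "0 < q" and e: "0 < e"
  obtains f where "test_fun (ball c s') f" "integrable lborel (\<lambda>x. \<bar>w x - f x\<bar> powr q)"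
    "(\<integral>x. \<bar>w x - f x\<bar> powr q \<partial>lborel) < e"
proof -
  define T where "T k x = clamp_to (real k) (w x)" for k x
  \<comment> \<open>Two errors below \<open>d\<close>, truncation and approximation, are added at
    the price of the factor \<open>2 powr q\<close>.\<close>
  define d where "d = e / (2 * 2 powr q)"
  have d: "d > 0" using e by (simp add: d_def)
  have mT: "(\<lambda>x. T k x) \<in> borel_measurable borel" for k
    unfolding T_def using w(1) by measurable
  have m: "(\<lambda>x. \<bar>w x - T k x\<bar> powr q) \<in> borel_measurable lborel" for k
    using w(1) mT by simp
  have ae: "AE x in lborel. (\<lambda>k. \<bar>w x - T k x\<bar> powr q) \<longlonglongrightarrow> 0"
  proof (intro AE_I2 tendsto_eventually)
    fix x
    obtain K where "\<bar>w x\<bar> \<le> real K" using real_arch_simple by blast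
    then have "\<forall>k\<ge>K. \<bar>w x - T k x\<bar> powr q = 0"
      by (auto simp: T_def clamp_to_id)
    then show "\<forall>\<^sub>F k in sequentially. \<bar>w x - T k x\<bar> powr q = 0"
      unfolding eventually_sequentially by blast
  qed
  have bae: "AE x in lborel. norm (\<bar>w x - T k x\<bar> powr q) \<le> \<bar>w x\<bar> powr q" for k
    using q clamp_to_diff[of "real k"] by (simp add: T_def powr_mono2)
  have m0: "(\<lambda>x. 0::real) \<in> borel_measurable lborel" by simp
  have int: "integrable lborel (\<lambda>x. \<bar>w x - T k x\<bar> powr q)" for k
    by (rule integrable_dominated_convergence2[OF m0 m w(2) ae bae])
  have "(\<lambda>k. \<integral>x. \<bar>w x - T k x\<bar> powr q \<partial>lborel) \<longlonglongrightarrow> (\<integral>x. 0 \<partial>(lborel :: (real^'n) measure))"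
    by (rule integral_dominated_convergence[OF m0 m w(2) ae bae])
  then have "\<forall>\<^sub>F k in sequentially. (\<integral>x. \<bar>w x - T k x\<bar> powr q \<partial>lborel) < d"
    using order_tendstoD(2)[of _ 0 sequentially d] d by simp
  then obtain k where k: "(\<integral>x. \<bar>w x - T k x\<bar> powr q \<partial>lborel) < d"
    unfolding eventually_sequentially by blast
  have Tb: "\<bar>T k x\<bar> \<le> real k" for x by (simp add: T_def clamp_to_bound)
  have T0: "T k x = 0" if "x \<notin> cball c s" for x using w(3)[OF that] by (simp add: T_def clamp_to_0)
  obtain f where f: "test_fun (ball c s') f" "integrable lborel (\<lambda>x. \<bar>T k x - f x\<bar> powr q)"
    "(\<integral>x. \<bar>T k x - f x\<bar> powr q \<partial>lborel) < d"
    using bounded_approx_test_fun[OF mT Tb T0 s q d] by blast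
  have mf: "f \<in> borel_measurable borel" by (rule test_fun_measurable[OF f(1)])
  have 1: "(\<lambda>x. w x - T k x) \<in> borel_measurable borel" "(\<lambda>x. T k x - f x) \<in> borel_measurable borel"
    using w(1) mT mf by simp_all
  have "integrable lborel (\<lambda>x. \<bar>w x - f x\<bar> powr q)"
    using integrable_powr_add(1)[OF q 1 int f(2)] by simp
  moreover have "(\<integral>x. \<bar>w x - f x\<bar> powr q \<partial>lborel) \<le> 2 powr q *
      ((\<integral>x. \<bar>w x - T k x\<bar> powr q \<partial>lborel) + (\<integral>x. \<bar>T k x - f x\<bar> powr q \<partial>lborel))"
    using integrable_powr_add(2)[OF q 1 int f(2)] by simp
  moreover have "\<dots> < 2 powr q * (d + d)"
    by (intro mult_strict_left_mono add_strict_mono k f(3)) simp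
  moreover have "2 powr q * (d + d) = e" by (simp add: d_def)
  ultimately show thesis using that[OF f(1)] by linarith
qed

end

subsection \<open>Pairings with translates\<close>

text \<open>Young's inequality for the product of t|w| and |V|/t. The free weight t does the work of
  Hoelder's inequality: it can be fixed to control the V term before w is made small. Translation
  invariance of the integral makes the bound independent of y.\<close>

lemma pairing_integrable_bound:
  fixes w V :: "real^'n::finite \<Rightarrow> real"
  assumes pq: "1 < p" "1 < q" "1 / p + 1 / q = 1"
    and w: "w \<in> borel_measurable borel" "integrable lborel (\<lambda>x. \<bar>w x\<bar> powr q)"
    and V: "V \<in> borel_measurable borel" "integrable lborel (\<lambda>x. \<bar>V x\<bar> powr p)"
  shows "integrable lborel (\<lambda>x. w x * V (x + y))"
    and "0 < t \<Longrightarrow> \<bar>\<integral>x. w x * V (x + y) \<partial>lborel\<bar>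
      \<le> t powr q / q * (\<integral>x. \<bar>w x\<bar> powr q \<partial>lborel) + t powr (- p) / p * (\<integral>x. \<bar>V x\<bar> powr p \<partial>lborel)"
proof -
  have mV: "(\<lambda>x. V (x + y)) \<in> borel_measurable borel" using V(1) by measurable
  have mp: "(\<lambda>x. \<bar>V x\<bar> powr p) \<in> borel_measurable borel" using V(1) by measurable
  have iV: "integrable lborel (\<lambda>x. \<bar>V (x + y)\<bar> powr p)"
    using lborel_integral_shift(2)[OF mp, of y] V(2) by simp
  have eV: "(\<integral>x. \<bar>V (x + y)\<bar> powr p \<partial>lborel) = (\<integral>x. \<bar>V x\<bar> powr p \<partial>lborel)"
    using lborel_integral_shift(1)[OF mp, of y] by simp
  have young: "\<bar>w x * V (x + y)\<bar> \<le> t powr q / q * \<bar>w x\<bar> powr q + t powr (- p) / p * \<bar>V (x + y)\<bar> powr p"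
    if t: "0 < t" for t x
  proof -
    have "(t * \<bar>w x\<bar>) * (\<bar>V (x + y)\<bar> / t) \<le> (t * \<bar>w x\<bar>) powr q / q + (\<bar>V (x + y)\<bar> / t) powr p / p"
      by (rule Youngs_inequality) (use pq t in auto)
    then show ?thesis
      using t by (simp add: abs_mult powr_mult powr_divide powr_minus_divide)
  qed
  have ib: "integrable lborel (\<lambda>x. t powr q / q * \<bar>w x\<bar> powr q + t powr (- p) / p * \<bar>V (x + y)\<bar> powr p)" for t
    using w(2) iV by simp
  show int: "integrable lborel (\<lambda>x. w x * V (x + y))"
    by (rule Bochner_Integration.integrable_bound[OF ib[of 1]])
      (use w(1) mV young[of 1] in \<open>auto intro: order_trans[OF _ abs_ge_self]\<close>)
  show "\<bar>\<integral>x. w x * V (x + y) \<partial>lborel\<bar>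
      \<le> t powr q / q * (\<integral>x. \<bar>w x\<bar> powr q \<partial>lborel) + t powr (- p) / p * (\<integral>x. \<bar>V x\<bar> powr p \<partial>lborel)"
    if t: "0 < t"
  proof -
    have "norm (\<integral>x. w x * V (x + y) \<partial>lborel)
      \<le> (\<integral>x. t powr q / q * \<bar>w x\<bar> powr q + t powr (- p) / p * \<bar>V (x + y)\<bar> powr p \<partial>lborel)"
      by (rule Bochner_Integration.integral_norm_bound_integral[OF int ib]) (use young[OF t] in auto)
    also have "\<dots> = t powr q / q * (\<integral>x. \<bar>w x\<bar> powr q \<partial>lborel) + t powr (- p) / p * (\<integral>x. \<bar>V x\<bar> powr p \<partial>lborel)"
      using w(2) iV by (simp add: eV)
    finally show ?thesis by simp
  qed
qed

lemma pairing_uniformly_small: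
  fixes F :: "nat \<Rightarrow> real^'n::finite \<Rightarrow> real"
  assumes pq: "1 < p" "1 < q" "1 / p + 1 / q = 1"
    and F: "\<And>n. F n \<in> borel_measurable borel" "\<And>n. integrable lborel (\<lambda>x. \<bar>F n x\<bar> powr q)"
      "(\<lambda>n. \<integral>x. \<bar>F n x\<bar> powr q \<partial>lborel) \<longlonglongrightarrow> 0"
    and V: "V \<in> borel_measurable borel" "integrable lborel (\<lambda>x. \<bar>V x\<bar> powr p)"
    and e: "0 < e"
  shows "\<forall>\<^sub>F n in sequentially. \<forall>y. \<bar>\<integral>x. F n x * V (x + y) \<partial>lborel\<bar> < e"
proof -
  define B where "B = (\<integral>x. \<bar>V x\<bar> powr p \<partial>lborel) + 1"
  have V0: "0 \<le> (\<integral>x. \<bar>V x\<bar> powr p \<partial>lborel)" by simp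
  then have B: "B > 0" unfolding B_def by linarith
  \<comment> \<open>The solution of \<open>t powr (- p) / p * B = e / 2\<close>, which leaves the
    other half of e to the term in \<open>F n\<close>.\<close>
  define t where "t = (2 * B / (e * p)) powr (1 / p)"
  have t: "t > 0" using B e pq by (simp add: t_def)
  have "t powr (- p) = e * p / (2 * B)"
    using B e pq by (simp add: t_def powr_powr powr_minus)
  then have "t powr (- p) / p * (\<integral>x. \<bar>V x\<bar> powr p \<partial>lborel) = e / 2 * ((\<integral>x. \<bar>V x\<bar> powr p \<partial>lborel) / B)"
    using pq by simp
  also have "\<dots> \<le> e / 2 * 1"
    by (rule mult_left_mono, subst divide_le_eq_1_pos[OF B]) (use e in \<open>auto simp: B_def\<close>)
  finally have 2: "t powr (- p) / p * (\<integral>x. \<bar>V x\<bar> powr p \<partial>lborel) \<le> e / 2" by simp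
  have "(\<lambda>n. t powr q / q * (\<integral>x. \<bar>F n x\<bar> powr q \<partial>lborel)) \<longlonglongrightarrow> t powr q / q * 0"
    by (rule tendsto_mult_left[OF F(3)])
  then have "\<forall>\<^sub>F n in sequentially. t powr q / q * (\<integral>x. \<bar>F n x\<bar> powr q \<partial>lborel) < e / 2"
    by (rule order_tendstoD) (use e in simp)
  then show ?thesis
  proof (rule eventually_mono, intro allI)
    fix n y assume "t powr q / q * (\<integral>x. \<bar>F n x\<bar> powr q \<partial>lborel) < e / 2"
    then show "\<bar>\<integral>x. F n x * V (x + y) \<partial>lborel\<bar> < e"
      using pairing_integrable_bound(2)[OF pq F(1) F(2) V t, of n y] 2 by linarith
  qed
qed

lemma correlation_eq_pairing:
  fixes f V :: "real^'n::finite \<Rightarrow> real"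
  assumes "f \<in> borel_measurable borel" "V \<in> borel_measurable borel"
  shows "correlation f V y = (\<integral>x. f x * V (x + y) \<partial>lborel)"
proof -
  have "(\<lambda>x. f (x - y) * V x) \<in> borel_measurable borel" using assms by measurable
  from lborel_integral_shift(1)[OF this, of y] show ?thesis by (simp add: correlation_def)
qed

context bump
begin

text \<open>The order of quantifiers matters: the sequence f depends on w alone, so the same
  approximants serve a function and its weak derivative, and the error is uniform over all
  translations.\<close>

lemma pairing_approx:
  fixes w :: "real^'n::finite \<Rightarrow> real"
  assumes pq: "1 < p" "1 < q" "1 / p + 1 / q = 1"
    and w: "w \<in> borel_measurable borel" "integrable lborel (\<lambda>x. \<bar>w x\<bar> powr q)"
      "\<And>x. x \<notin> cball c s \<Longrightarrow> w x = 0"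
    and s: "0 \<le> s" "s < s'"
  shows "\<exists>f :: nat \<Rightarrow> real^'n \<Rightarrow> real. (\<forall>n. test_fun (ball c s') (f n)) \<and>
    (\<forall>V e. V \<in> borel_measurable borel \<longrightarrow> integrable lborel (\<lambda>x. \<bar>V x\<bar> powr p) \<longrightarrow> integrable lborel V \<longrightarrow> 0 < e \<longrightarrow>
      (\<forall>\<^sub>F n in sequentially. \<forall>y. \<bar>(\<integral>x. w x * V (x + y) \<partial>lborel) - correlation (f n) V y\<bar> < e))"
proof -
  have "\<exists>f. test_fun (ball c s') f \<and> integrable lborel (\<lambda>x. \<bar>w x - f x\<bar> powr q) \<and>
    (\<integral>x. \<bar>w x - f x\<bar> powr q \<partial>lborel) < 1 / real (Suc n)" for n
  proof -
    have "0 < q" "0 < 1 / real (Suc n)" using pq by auto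
    show ?thesis
    proof (rule Lq_approx_test_fun[OF w s \<open>0 < q\<close> \<open>0 < 1 / real (Suc n)\<close>])
      fix f assume "test_fun (ball c s') f" "integrable lborel (\<lambda>x. \<bar>w x - f x\<bar> powr q)"
        "(\<integral>x. \<bar>w x - f x\<bar> powr q \<partial>lborel) < 1 / real (Suc n)"
      then show ?thesis by (intro exI[of _ f] conjI)
    qed
  qed
  then have "\<exists>f. \<forall>n. test_fun (ball c s') (f n) \<and> integrable lborel (\<lambda>x. \<bar>w x - f n x\<bar> powr q) \<and>
    (\<integral>x. \<bar>w x - f n x\<bar> powr q \<partial>lborel) < 1 / real (Suc n)"
    by (intro choice allI)
  then obtain f where F: "\<forall>n. test_fun (ball c s') (f n) \<and> integrable lborel (\<lambda>x. \<bar>w x - f n x\<bar> powr q) \<and>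
    (\<integral>x. \<bar>w x - f n x\<bar> powr q \<partial>lborel) < 1 / real (Suc n)" ..
  then have f: "test_fun (ball c s') (f n)" "integrable lborel (\<lambda>x. \<bar>w x - f n x\<bar> powr q)"
    and fl: "(\<integral>x. \<bar>w x - f n x\<bar> powr q \<partial>lborel) < 1 / real (Suc n)" for n
    by simp_all
  have mf: "f n \<in> borel_measurable borel" for n by (rule test_fun_measurable[OF f(1)])
  have m: "(\<lambda>x. w x - f n x) \<in> borel_measurable borel" for n using w(1) mf by simp
  have lim: "(\<lambda>n. \<integral>x. \<bar>w x - f n x\<bar> powr q \<partial>lborel) \<longlonglongrightarrow> 0"
    by (rule Lim_null_comparison[OF _ LIMSEQ_inverse_real_of_nat], intro always_eventually allI)
      (use fl in \<open>simp add: inverse_eq_divide less_imp_le\<close>)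
  show ?thesis
  proof (intro exI[of _ f] conjI allI impI f(1))
    fix V :: "real^'n \<Rightarrow> real" and e :: real
    assume V: "V \<in> borel_measurable borel" "integrable lborel (\<lambda>x. \<bar>V x\<bar> powr p)" and iV: "integrable lborel V"
      and e: "0 < e"
    have "(\<integral>x. (w x - f n x) * V (x + y) \<partial>lborel) = (\<integral>x. w x * V (x + y) \<partial>lborel) - correlation (f n) V y" for n y
    proof -
      have mV: "(\<lambda>x. V (x + y)) \<in> borel_measurable borel" using V(1) by measurable
      have "integrable lborel (\<lambda>x. V (x + y))" using lborel_integral_shift(2)[OF V(1), of y] iV by simp
      from test_fun_shift_mult_integrable[OF f(1) this, of n 0]
      have "integrable lborel (\<lambda>x. f n x * V (x + y))" by simp
      then show ?thesis
        using pairing_integrable_bound(1)[OF pq w(1,2) V, of y]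
        by (simp add: left_diff_distrib correlation_eq_pairing[OF mf V(1)])
    qed
    then show "\<forall>\<^sub>F n in sequentially. \<forall>y. \<bar>(\<integral>x. w x * V (x + y) \<partial>lborel) - correlation (f n) V y\<bar> < e"
      using pairing_uniformly_small[OF pq m f(2) lim V e] by simp
  qed
qed

text \<open>A uniform limit in y of smooth correlations.\<close>

lemma continuous_pairing:
  fixes w V :: "real^'n::finite \<Rightarrow> real"
  assumes pq: "1 < p" "1 < q" "1 / p + 1 / q = 1"
    and w: "w \<in> borel_measurable borel" "integrable lborel (\<lambda>x. \<bar>w x\<bar> powr q)"
      "\<And>x. x \<notin> cball c s \<Longrightarrow> w x = 0"
    and s: "0 \<le> s"
    and V: "V \<in> borel_measurable borel" "integrable lborel (\<lambda>x. \<bar>V x\<bar> powr p)" "integrable lborel V"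
  shows "continuous_on UNIV (\<lambda>y. \<integral>x. w x * V (x + y) \<partial>lborel)"
proof -
  obtain f where "\<forall>n. test_fun (ball c (s + 1)) (f n)"
    and "\<forall>V e. V \<in> borel_measurable borel \<longrightarrow> integrable lborel (\<lambda>x. \<bar>V x\<bar> powr p) \<longrightarrow> integrable lborel V \<longrightarrow> 0 < e \<longrightarrow>
      (\<forall>\<^sub>F n in sequentially. \<forall>y. \<bar>(\<integral>x. w x * V (x + y) \<partial>lborel) - correlation (f n) V y\<bar> < e)"
    using pairing_approx[OF pq w s less_add_one] by blast
  then have f: "\<And>n. test_fun (ball c (s + 1)) (f n)"
    and lim: "\<And>e. 0 < e \<Longrightarrow>
      \<forall>\<^sub>F n in sequentially. \<forall>y. \<bar>(\<integral>x. w x * V (x + y) \<partial>lborel) - correlation (f n) V y\<bar> < e"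
    using V by simp_all
  have "uniform_limit UNIV (\<lambda>n. correlation (f n) V) (\<lambda>y. \<integral>x. w x * V (x + y) \<partial>lborel) sequentially"
    by (rule uniform_limitI) (use lim in \<open>simp add: dist_real_def abs_minus_commute\<close>)
  then show ?thesis
    by (rule uniform_limit_theorem[rotated])
      (use continuous_correlation[OF f V(3)] in auto)
qed

text \<open>v has only a weak derivative, so the pairing is differentiated through its approximants:
  correlations with \<open>f n\<close> are smooth in t, the weak identity turns their t-derivatives
  into correlations with G, and these converge uniformly. Uniform convergence of derivatives
  together with convergence at t = 0 gives differentiability of the limit.\<close>

lemma pairing_has_derivative:
  fixes w v G :: "real^'n::finite \<Rightarrow> real"
  assumes pq: "1 < p" "1 < q" "1 / p + 1 / q = 1"
    and w: "w \<in> borel_measurable borel" "integrable lborel (\<lambda>x. \<bar>w x\<bar> powr q)"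
      "\<And>x. x \<notin> cball c s \<Longrightarrow> w x = 0"
    and s: "0 \<le> s" "s < s'" and U: "cball c s' \<subseteq> U" "open U"
    and v: "v \<in> borel_measurable borel" "integrable lborel (\<lambda>x. \<bar>v x\<bar> powr p)" "integrable lborel v"
    and G: "G \<in> borel_measurable borel" "integrable lborel (\<lambda>x. \<bar>G x\<bar> powr p)" "integrable lborel G"
    and weak: "\<And>f. test_fun U f \<Longrightarrow> (\<integral>x. v x * dpart [i] f x \<partial>lborel) = - (\<integral>x. G x * f x \<partial>lborel)"
  shows "((\<lambda>t. \<integral>x. w x * v (x + t *\<^sub>R axis i 1) \<partial>lborel) has_real_derivative (\<integral>x. w x * G x \<partial>lborel)) (at 0)"
proof -
  define s2 where "s2 = (s + s') / 2"
  have s2: "s < s2" "s2 < s'" using s by (auto simp: s2_def)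
  \<comment> \<open>For |t| below this margin the translated support of \<open>f n\<close> stays
    inside U, so the weak identity is available at every such t and not only at t = 0.\<close>
  define \<delta> where "\<delta> = s' - s2"
  have \<delta>: "\<delta> > 0" using s2 by (simp add: \<delta>_def)
  let ?e = "axis i 1 :: real^'n"
  obtain f where "\<forall>n. test_fun (ball c s2) (f n)"
    and "\<forall>V e. V \<in> borel_measurable borel \<longrightarrow> integrable lborel (\<lambda>x. \<bar>V x\<bar> powr p) \<longrightarrow> integrable lborel V \<longrightarrow> 0 < e \<longrightarrow>
      (\<forall>\<^sub>F n in sequentially. \<forall>y. \<bar>(\<integral>x. w x * V (x + y) \<partial>lborel) - correlation (f n) V y\<bar> < e)"
    using pairing_approx[OF pq w s(1) s2(1)] by blast
  then have f: "\<And>n. test_fun (ball c s2) (f n)"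
    and lim: "\<And>V e. V \<in> borel_measurable borel \<Longrightarrow> integrable lborel (\<lambda>x. \<bar>V x\<bar> powr p) \<Longrightarrow> integrable lborel V \<Longrightarrow> 0 < e \<Longrightarrow>
      \<forall>\<^sub>F n in sequentially. \<forall>y. \<bar>(\<integral>x. w x * V (x + y) \<partial>lborel) - correlation (f n) V y\<bar> < e"
    by simp_all
  have der: "((\<lambda>t. correlation (f n) v (t *\<^sub>R ?e)) has_derivative (\<lambda>h. h * correlation (f n) G (t *\<^sub>R ?e)))
      (at t within ball 0 \<delta>)" if t: "t \<in> ball 0 \<delta>" for n t
  proof -
    have "((\<lambda>t. t *\<^sub>R ?e) has_derivative (\<lambda>h. h *\<^sub>R ?e)) (at t)"
      by (auto intro!: derivative_eq_intros)
    from diff_chain_at[OF this correlation_has_derivative[OF f v(3)]]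
    have 1: "((\<lambda>t. correlation (f n) v (t *\<^sub>R ?e)) has_derivative
        (\<lambda>h. h * (- correlation (dpart [i] (f n)) v (t *\<^sub>R ?e)))) (at t)"
      by (simp add: o_def inner_axis mult.commute)
    have tf: "test_fun U (\<lambda>x. f n (x - t *\<^sub>R ?e))"
    proof (rule test_fun_translate(1)[OF f])
      fix x assume "x \<in> closure {x. f n x \<noteq> 0}"
      then have "dist c x < s2" using f unfolding test_fun_def by (meson mem_ball subsetD)
      moreover have "dist x (x + t *\<^sub>R ?e) < \<delta>" using t by (simp add: dist_norm)
      ultimately have "dist c (x + t *\<^sub>R ?e) \<le> s'"
        using dist_triangle[of c "x + t *\<^sub>R ?e" x] unfolding \<delta>_def by linarith
      then show "x + t *\<^sub>R ?e \<in> U" using U by auto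
    qed
    have "correlation (dpart [i] (f n)) v (t *\<^sub>R ?e) = (\<integral>x. v x * dpart [i] (\<lambda>x. f n (x - t *\<^sub>R ?e)) x \<partial>lborel)"
      unfolding correlation_def
      by (subst test_fun_translate(2)[OF f, where V = UNIV]) (auto simp: mult.commute)
    also have "\<dots> = - correlation (f n) G (t *\<^sub>R ?e)"
      using weak[OF tf] by (simp add: correlation_def mult.commute)
    finally show ?thesis using 1 has_derivative_at_withinI by fastforce
  qed
  have "\<exists>g. \<forall>t\<in>ball 0 \<delta>. (\<lambda>n. correlation (f n) v (t *\<^sub>R ?e)) \<longlonglongrightarrow> g t \<and>
      (g has_derivative (\<lambda>h. h * (\<integral>x. w x * G (x + t *\<^sub>R ?e) \<partial>lborel))) (at t within ball 0 \<delta>)"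
  proof (rule has_derivative_sequence[OF _ der, where l = "\<integral>x. w x * v (x + 0) \<partial>lborel" and ?x0.0 = 0])
    fix e :: real assume e: "e > 0"
    from lim[OF G this]
    show "\<forall>\<^sub>F n in sequentially. \<forall>t\<in>ball 0 \<delta>. \<forall>h. norm (h * correlation (f n) G (t *\<^sub>R ?e)
        - h * (\<integral>x. w x * G (x + t *\<^sub>R ?e) \<partial>lborel)) \<le> e * norm h"
    proof (rule eventually_mono, intro ballI allI)
      fix n t h assume "\<forall>y. \<bar>(\<integral>x. w x * G (x + y) \<partial>lborel) - correlation (f n) G y\<bar> < e"
      then have "\<bar>correlation (f n) G (t *\<^sub>R ?e) - (\<integral>x. w x * G (x + t *\<^sub>R ?e) \<partial>lborel)\<bar> \<le> e"
        by (metis abs_minus_commute less_imp_le)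
      then show "norm (h * correlation (f n) G (t *\<^sub>R ?e) - h * (\<integral>x. w x * G (x + t *\<^sub>R ?e) \<partial>lborel)) \<le> e * norm h"
        using mult_right_mono[OF _ abs_ge_zero[of h]]
        by (simp add: right_diff_distrib[symmetric] abs_mult mult.commute[of "\<bar>h\<bar>"])
    qed
  next
    show "(\<lambda>n. correlation (f n) v (0 *\<^sub>R ?e)) \<longlonglongrightarrow> (\<integral>x. w x * v (x + 0) \<partial>lborel)"
    proof (rule tendstoI)
      fix e :: real assume "e > 0"
      from lim[OF v this]
      show "\<forall>\<^sub>F n in sequentially. dist (correlation (f n) v (0 *\<^sub>R ?e)) (\<integral>x. w x * v (x + 0) \<partial>lborel) < e"
        by (rule eventually_mono) (metis abs_minus_commute dist_real_def scaleR_zero_left)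
    qed
  qed (use \<delta> in auto)
  then obtain g where g: "\<And>t. t \<in> ball 0 \<delta> \<Longrightarrow> (\<lambda>n. correlation (f n) v (t *\<^sub>R ?e)) \<longlonglongrightarrow> g t"
    "\<And>t. t \<in> ball 0 \<delta> \<Longrightarrow> (g has_derivative (\<lambda>h. h * (\<integral>x. w x * G (x + t *\<^sub>R ?e) \<partial>lborel))) (at t within ball 0 \<delta>)"
    by blast
  have geq: "g t = (\<integral>x. w x * v (x + t *\<^sub>R ?e) \<partial>lborel)" if "t \<in> ball 0 \<delta>" for t
  proof (rule LIMSEQ_unique[OF g(1)[OF that]], rule tendstoI)
    fix e :: real assume "e > 0"
    from lim[OF v this]
    show "\<forall>\<^sub>F n in sequentially. dist (correlation (f n) v (t *\<^sub>R ?e)) (\<integral>x. w x * v (x + t *\<^sub>R ?e) \<partial>lborel) < e"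
      by (rule eventually_mono) (metis abs_minus_commute dist_real_def)
  qed
  have "0 \<in> ball (0::real) \<delta>" using \<delta> by simp
  moreover have "at 0 within ball 0 \<delta> = at (0::real)"
    using \<delta> by (intro at_within_open) auto
  ultimately have "(g has_derivative (\<lambda>h. h * (\<integral>x. w x * G x \<partial>lborel))) (at 0)"
    using g(2)[of 0] by simp
  then have "((\<lambda>t. \<integral>x. w x * v (x + t *\<^sub>R ?e) \<partial>lborel) has_derivative (\<lambda>h. h * (\<integral>x. w x * G x \<partial>lborel))) (at 0)"
    by (rule has_derivative_transform_within_open[where s = "ball 0 \<delta>"]) (use \<delta> geq in auto)
  moreover have "(\<lambda>h. h * (\<integral>x. w x * G x \<partial>lborel)) = (*) (\<integral>x. w x * G x \<partial>lborel)"
    by (rule ext) (rule mult.commute)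
  ultimately show ?thesis unfolding has_field_derivative_def by simp
qed

end

section \<open>Averaging over translations and the variational principle\<close>

text \<open>Averaging a pairing over translations against \<kappa> equals pairing once with the
  mollification of V. It connects statements about individual translates with smooth functions that
  may be inserted into the equation.\<close>

lemma fubini_correlation:
  fixes \<kappa> a V :: "real^'n::finite \<Rightarrow> real"
  assumes k: "test_fun U \<kappa>" and a: "a \<in> borel_measurable borel" "integrable lborel a"
    and V: "V \<in> borel_measurable borel" "integrable lborel V"
  shows "integrable lborel (\<lambda>y. \<kappa> y * (\<integral>x. a x * V (x + y) \<partial>lborel))"
    and "integrable lborel (\<lambda>x. a x * correlation \<kappa> V x)"
    and "(\<integral>y. \<kappa> y * (\<integral>x. a x * V (x + y) \<partial>lborel) \<partial>lborel) = (\<integral>x. a x * correlation \<kappa> V x \<partial>lborel)"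
proof -
  define F where "F x y = \<kappa> y * (a x * V (x + y))" for x y
  have [measurable]: "\<kappa> \<in> borel_measurable borel" "a \<in> borel_measurable borel" "V \<in> borel_measurable borel"
    using test_fun_measurable[OF k] a V by auto
  have mF: "case_prod F \<in> borel_measurable (lborel \<Otimes>\<^sub>M lborel)"
    unfolding F_def by measurable
  obtain C where C: "\<And>x. \<bar>\<kappa> x\<bar> \<le> C" using test_fun_bounded[OF k] by metis
  have iV: "integrable lborel (\<lambda>y. V (x + y))" for x
    using lborel_integral_shift(2)[OF V(1), of x] V(2) by (simp add: add.commute)
  have eV: "(\<integral>y. \<bar>V (x + y)\<bar> \<partial>lborel) = (\<integral>y. \<bar>V y\<bar> \<partial>lborel)" for x
    using lborel_integral_shift(1)[of "\<lambda>y. \<bar>V y\<bar>" x] by (simp add: add.commute)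
  have ikV: "integrable lborel (\<lambda>y. \<kappa> y * V (x + y))" for x
    using C by (intro integrable_bounded_mult[OF _ _ iV]) auto
  have iF: "integrable lborel (F x)" for x
    unfolding F_def using integrable_mult_right[OF ikV, of "a x" x] by (simp add: mult_ac)
  have "integrable lborel (\<lambda>x. \<integral>y. norm (F x y) \<partial>lborel)"
  proof (rule Bochner_Integration.integrable_bound)
    show "integrable lborel (\<lambda>x. (C * (\<integral>y. \<bar>V y\<bar> \<partial>lborel)) * a x)" using a by simp
    show "(\<lambda>x. \<integral>y. norm (F x y) \<partial>lborel) \<in> borel_measurable lborel"
      using mF by measurable
    have "(\<integral>y. norm (F x y) \<partial>lborel) \<le> (\<integral>y. (C * \<bar>a x\<bar>) * \<bar>V (x + y)\<bar> \<partial>lborel)" for x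
    proof (rule integral_mono)
      show "integrable lborel (\<lambda>y. norm (F x y))" using iF by simp
      show "integrable lborel (\<lambda>y. (C * \<bar>a x\<bar>) * \<bar>V (x + y)\<bar>)" using iV by simp
      show "norm (F x y) \<le> (C * \<bar>a x\<bar>) * \<bar>V (x + y)\<bar>" for y
        using mult_right_mono[OF C[of y], of "\<bar>a x\<bar> * \<bar>V (x + y)\<bar>"] by (simp add: F_def abs_mult mult.assoc)
    qed
    moreover have "0 \<le> C" using C[of 0] by linarith
    ultimately show "AE x in lborel. norm (\<integral>y. norm (F x y) \<partial>lborel) \<le> norm (C * (\<integral>y. \<bar>V y\<bar> \<partial>lborel) * a x)"
      by (simp add: abs_mult eV mult_ac)
  qed
  then have int: "integrable (lborel \<Otimes>\<^sub>M lborel) (case_prod F)"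
    by (intro lborel_pair.Fubini_integrable[OF mF]) (use iF in auto)
  have inner: "(\<integral>y. F x y \<partial>lborel) = a x * correlation \<kappa> V x" for x
  proof -
    have "(\<integral>y. F x y \<partial>lborel) = a x * (\<integral>y. \<kappa> y * V (y + x) \<partial>lborel)"
      using ikV by (simp add: F_def mult_ac add.commute flip: integral_mult_right_zero)
    then show ?thesis by (simp add: correlation_eq_pairing)
  qed
  have outer: "(\<integral>x. F x y \<partial>lborel) = \<kappa> y * (\<integral>x. a x * V (x + y) \<partial>lborel)" for y
    by (simp add: F_def)
  show "integrable lborel (\<lambda>y. \<kappa> y * (\<integral>x. a x * V (x + y) \<partial>lborel))"
    using lborel_pair.integrable_snd[OF int] by (simp add: outer)
  show "integrable lborel (\<lambda>x. a x * correlation \<kappa> V x)"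
    using lborel_pair.integrable_fst[OF int] by (simp add: inner)
  show "(\<integral>y. \<kappa> y * (\<integral>x. a x * V (x + y) \<partial>lborel) \<partial>lborel) = (\<integral>x. a x * correlation \<kappa> V x \<partial>lborel)"
    using lborel_pair.Fubini_integral[OF int] by (simp add: inner outer)
qed

context bump
begin

text \<open>If \<open>E y\<close> were nonzero, E would keep its sign and at least half its size
  near y. A nonnegative cutoff supported there and equal to 1 on a smaller ball would then give a
  nonzero integral.\<close>

lemma fundamental_lemma:
  fixes E :: "real^'n::finite \<Rightarrow> real"
  assumes cont: "continuous_on UNIV E"
    and zero: "\<And>\<kappa>. test_fun (ball 0 \<delta>) \<kappa> \<Longrightarrow> integrable lborel (\<lambda>y. \<kappa> y * E y) \<and> (\<integral>y. \<kappa> y * E y \<partial>lborel) = 0"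
    and y: "norm y < \<delta>"
  shows "E y = 0"
proof (rule ccontr)
  assume ne: "E y \<noteq> 0"
  define m where "m = \<bar>E y\<bar> / 2"
  have m: "m > 0" using ne by (simp add: m_def)
  obtain r1 where r1: "r1 > 0" "\<And>z. dist z y < r1 \<Longrightarrow> dist (E z) (E y) < m"
    using cont m by (metis UNIV_I continuous_on_iff)
  define r where "r = min r1 (\<delta> - norm y)"
  have r: "r > 0" using r1 y by (simp add: r_def)
  obtain \<eta> where \<eta>: "smooth_on UNIV \<eta>" "\<And>x. 0 \<le> \<eta> x" "\<And>x. \<eta> x \<le> 1"
    "\<And>x. x \<in> cball y (r / 3) \<Longrightarrow> \<eta> x = 1" "\<And>x. x \<notin> ball y (r / 2) \<Longrightarrow> \<eta> x = 0"
    using cutoff_exists[of "r / 3" "r / 2" y] r by auto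
  have sub: "cball y (r / 2) \<subseteq> ball 0 \<delta>"
  proof
    fix z assume "z \<in> cball y (r / 2)"
    then have "norm (z - y) \<le> r / 2" by (simp add: dist_norm norm_minus_commute)
    moreover have "r \<le> \<delta> - norm y" by (simp add: r_def)
    ultimately show "z \<in> ball 0 \<delta>"
      using norm_triangle_ineq2[of z y] r by simp
  qed
  have t: "test_fun (ball 0 \<delta>) \<eta>"
    by (rule test_funI[OF \<eta>(1) compact_cball sub]) (use \<eta>(5) in auto)
  have pos: "m * indicator (cball y (r / 3)) z \<le> (\<eta> z * E z) * sgn (E y)" for z
  proof (cases "z \<in> ball y (r / 2)")
    case True
    then have "dist z y < r1" using r by (simp add: r_def dist_commute)
    from r1(2)[OF this] have "m \<le> E z * sgn (E y)"
      by (auto simp: m_def dist_real_def sgn_if abs_if split: if_splits)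
    then have "\<eta> z * m \<le> \<eta> z * (E z * sgn (E y))" by (rule mult_left_mono) (rule \<eta>(2))
    moreover have "m * indicator (cball y (r / 3)) z \<le> \<eta> z * m"
      using \<eta>(2)[of z] \<eta>(4)[of z] m by (cases "z \<in> cball y (r / 3)") auto
    ultimately show ?thesis by (simp add: mult.assoc)
  next
    case False
    then have "z \<notin> cball y (r / 3)" using r by auto
    then show ?thesis using \<eta>(5)[OF False] by simp
  qed
  have "(\<integral>z. m * indicator (cball y (r / 3)) z \<partial>lborel) \<le> (\<integral>z. (\<eta> z * E z) * sgn (E y) \<partial>lborel)"
    by (rule integral_mono) (use zero[OF t] pos integrable_indicator_cball in auto)
  also have "\<dots> = 0" using zero[OF t] by simp
  finally have "m * measure lborel (cball y (r / 3)) \<le> 0" by simp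
  moreover have "measure lborel (cball y (r / 3)) > 0"
    using content_cball_pos[of "r / 3" y] r by simp
  ultimately show False using m by (simp add: mult_le_0_iff)
qed

text \<open>Along a coordinate axis the right-hand difference minus the left-hand one is
  differentiable in the shift and has a local minimum at 0, so its derivative vanishes: a one-sided
  inequality yields an equality. It serves both the energy density and functions of the
  solution.\<close>

lemma variation_identity:
  fixes w v G h :: "real^'n::finite \<Rightarrow> real"
  assumes pq: "1 < p" "1 < q" "1 / p + 1 / q = 1"
    and w: "w \<in> borel_measurable borel" "integrable lborel (\<lambda>x. \<bar>w x\<bar> powr q)"
      "\<And>x. x \<notin> cball c s \<Longrightarrow> w x = 0"
    and s: "0 \<le> s" "s < s'" and U: "cball c s' \<subseteq> U" "open U"
    and v: "v \<in> borel_measurable borel" "integrable lborel (\<lambda>x. \<bar>v x\<bar> powr p)" "integrable lborel v"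
    and G: "G \<in> borel_measurable borel" "integrable lborel (\<lambda>x. \<bar>G x\<bar> powr p)" "integrable lborel G"
    and weak: "\<And>f. test_fun U f \<Longrightarrow> (\<integral>x. v x * dpart [i] f x \<partial>lborel) = - (\<integral>x. G x * f x \<partial>lborel)"
    and h: "h \<in> borel_measurable borel" "integrable lborel h"
    and \<phi>: "test_fun U \<phi>" and \<delta>: "0 < \<delta>"
    and ineq: "\<And>y. norm y < \<delta> \<Longrightarrow> (\<integral>x. w x * v (x + y) \<partial>lborel) - (\<integral>x. w x * v x \<partial>lborel)
      \<le> (\<integral>x. \<phi> x * h (x + y) \<partial>lborel) - (\<integral>x. \<phi> x * h x \<partial>lborel)"
  shows "(\<integral>x. dpart [i] \<phi> x * h x \<partial>lborel) = - (\<integral>x. w x * G x \<partial>lborel)"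
proof -
  let ?e = "axis i 1 :: real^'n"
  have corr: "correlation \<phi> h y = (\<integral>x. \<phi> x * h (x + y) \<partial>lborel)" for y
    by (rule correlation_eq_pairing[OF test_fun_measurable[OF \<phi>] h(1)])
  have "((\<lambda>t. t *\<^sub>R ?e) has_derivative (\<lambda>h. h *\<^sub>R ?e)) (at 0)"
    by (auto intro!: derivative_eq_intros)
  from diff_chain_at[OF this correlation_has_derivative[OF \<phi> h(2)]]
  have "((\<lambda>t. correlation \<phi> h (t *\<^sub>R ?e)) has_derivative (\<lambda>x. - (x * correlation (dpart [i] \<phi>) h 0))) (at 0)"
    by (simp add: o_def inner_axis)
  moreover have "(\<lambda>x. - (x * correlation (dpart [i] \<phi>) h 0)) = (*) (- correlation (dpart [i] \<phi>) h 0)"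
    by (rule ext) simp
  ultimately have "((\<lambda>t. correlation \<phi> h (t *\<^sub>R ?e)) has_real_derivative - correlation (dpart [i] \<phi>) h 0) (at 0)"
    unfolding has_field_derivative_def by simp
  then have "((\<lambda>t. correlation \<phi> h (t *\<^sub>R ?e) - (\<integral>x. w x * v (x + t *\<^sub>R ?e) \<partial>lborel)) has_real_derivative
      - correlation (dpart [i] \<phi>) h 0 - (\<integral>x. w x * G x \<partial>lborel)) (at 0)"
    using pairing_has_derivative[OF pq w s U v G weak] by (rule DERIV_diff)
  then have "- correlation (dpart [i] \<phi>) h 0 - (\<integral>x. w x * G x \<partial>lborel) = 0"
  proof (rule DERIV_local_min[OF _ \<delta>], intro allI impI)
    fix t :: real assume "\<bar>0 - t\<bar> < \<delta>"
    then have "norm (t *\<^sub>R ?e) < \<delta>" by simp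
    from ineq[OF this]
    show "correlation \<phi> h (0 *\<^sub>R ?e) - (\<integral>x. w x * v (x + 0 *\<^sub>R ?e) \<partial>lborel)
      \<le> correlation \<phi> h (t *\<^sub>R ?e) - (\<integral>x. w x * v (x + t *\<^sub>R ?e) \<partial>lborel)"
      by (simp add: corr)
  qed
  then show ?thesis by (simp add: correlation_def)
qed

end

subsection \<open>The inner variation identity\<close>

lemma norm_powr_le_sum:
  fixes x :: "real^'n::finite"
  assumes "0 < p"
  shows "norm x powr p \<le> real CARD('n) powr p * (\<Sum>i\<in>UNIV. \<bar>x $ i\<bar> powr p)"
proof -
  define M where "M = Max (range (\<lambda>i. \<bar>x $ i\<bar>))"
  have le: "\<bar>x $ i\<bar> \<le> M" for i unfolding M_def by (rule Max_ge) auto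
  have "M \<in> range (\<lambda>i. \<bar>x $ i\<bar>)" unfolding M_def by (rule Max_in) auto
  then obtain j where j: "M = \<bar>x $ j\<bar>" by blast
  have "norm x \<le> (\<Sum>i\<in>UNIV. \<bar>x $ i\<bar>)" by (rule norm_le_l1_cart)
  also have "\<dots> \<le> real CARD('n) * M" using sum_bounded_above[of UNIV "\<lambda>i. \<bar>x $ i\<bar>" M] le by simp
  finally have "norm x powr p \<le> (real CARD('n) * M) powr p" using assms by (intro powr_mono2) auto
  also have "\<dots> = real CARD('n) powr p * \<bar>x $ j\<bar> powr p" by (simp add: powr_mult j)
  also have "\<dots> \<le> real CARD('n) powr p * (\<Sum>i\<in>UNIV. \<bar>x $ i\<bar> powr p)"
    by (intro mult_left_mono member_le_sum) auto
  finally show ?thesis .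
qed

text \<open>On the ball |w| is at most |w|^q + 1, and off it w is zero.\<close>

lemma integrable_of_powr_integrable:
  fixes w :: "real^'n::finite \<Rightarrow> real"
  assumes "1 \<le> q" "w \<in> borel_measurable borel" "integrable lborel (\<lambda>x. \<bar>w x\<bar> powr q)"
    "\<And>x. x \<notin> cball c s \<Longrightarrow> w x = 0"
  shows "integrable lborel w"
proof (rule Bochner_Integration.integrable_bound)
  show "integrable lborel (\<lambda>x. \<bar>w x\<bar> powr q + indicator (cball c s) x)"
    by (intro Bochner_Integration.integrable_add assms(3) integrable_indicator_cball)
  have "\<bar>w x\<bar> \<le> \<bar>w x\<bar> powr q + indicator (cball c s) x" for x
  proof (cases "1 \<le> \<bar>w x\<bar>")
    case True
    then have "\<bar>w x\<bar> powr 1 \<le> \<bar>w x\<bar> powr q" using assms by (intro powr_mono) auto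
    moreover have "(0::real) \<le> indicator (cball c s) x" by simp
    moreover have "\<bar>w x\<bar> powr 1 = \<bar>w x\<bar>" by simp
    ultimately show ?thesis by linarith
  next
    case False
    then show ?thesis using assms(4)[of x] powr_ge_zero[of "\<bar>w x\<bar>" q]
      by (cases "x \<in> cball c s") (auto simp del: powr_ge_zero)
  qed
  then show "AE x in lborel. norm (w x) \<le> norm (\<bar>w x\<bar> powr q + indicator (cball c s) x)"
    by (intro AE_I2) (auto intro: order_trans[OF _ abs_ge_self])
qed (use assms in simp)

text \<open>The data of a weak solution, with Borel representatives extended by zero outside the unit ball.\<close>

locale borel_solution = bump \<beta> for \<beta> +
  fixes p q \<epsilon> :: real and v :: "real^'n::finite \<Rightarrow> real" and G :: "real^'n \<Rightarrow> real^'n"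
  assumes pq: "1 < p" "1 < q" "1 / p + 1 / q = 1"
    and eps: "0 < \<epsilon>"
    and v_meas: "v \<in> borel_measurable borel" and v_bound: "\<And>x. \<bar>v x\<bar> \<le> 1"
    and v_out: "\<And>x. x \<notin> ball 0 1 \<Longrightarrow> v x = 0"
    and G_meas: "G \<in> borel_measurable borel"
    and G_Lp: "\<And>i. integrable lborel (\<lambda>x. \<bar>G x $ i\<bar> powr p)"
    and G_out: "\<And>x. x \<notin> ball 0 1 \<Longrightarrow> G x = 0"
    and weak: "\<And>f i. test_fun (ball 0 1) f \<Longrightarrow>
      (\<integral>x. v x * dpart [i] f x \<partial>lborel) = - (\<integral>x. G x $ i * f x \<partial>lborel)"
    and equation: "\<And>\<psi>. test_fun (ball 0 1) \<psi> \<Longrightarrow>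
      - (\<integral>x. norm (G x) powr (p - 2) * (G x \<bullet> grad \<psi> x) \<partial>lborel) = (\<integral>x. beta_eps \<beta> \<epsilon> (v x) * \<psi> x \<partial>lborel)"
begin

text \<open>Where \<open>G x = 0\<close> the factor is \<open>0 powr (p - 2) = 0\<close>, so A
  vanishes there for every p, also for p < 2 where |G|^(p-2) is singular.\<close>

definition A :: "real^'n \<Rightarrow> real^'n" where
  "A x = norm (G x) powr (p - 2) *\<^sub>R G x"

definition force :: "real^'n \<Rightarrow> real" where
  "force x = beta_eps \<beta> \<epsilon> (v x)"

lemma G_nth_meas: "(\<lambda>x. G x $ i) \<in> borel_measurable borel"
  by (intro borel_measurable_continuous_on[OF _ G_meas] continuous_intros)

lemma A_nth_meas: "(\<lambda>x. A x $ i) \<in> borel_measurable borel"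
  unfolding A_def using G_meas G_nth_meas[of i] by simp

lemma A_meas: "A \<in> borel_measurable borel"
  unfolding A_def using G_meas by simp

lemma force_meas: "force \<in> borel_measurable borel"
proof -
  have "\<beta> \<in> borel_measurable borel" by (intro borel_measurable_continuous_onI continuous_beta)
  moreover have "(\<lambda>x. v x / \<epsilon>) \<in> borel_measurable borel" using v_meas by simp
  ultimately have "(\<lambda>x. \<beta> (v x / \<epsilon>)) \<in> borel_measurable borel" by (rule measurable_compose[rotated])
  then show ?thesis unfolding force_def[abs_def] beta_eps_def by simp
qed

lemma force_bounded: obtains C where "0 < C" "\<And>x. \<bar>force x\<bar> \<le> C"
proof -
  obtain C where C: "0 < C" "\<And>t. \<bar>\<beta> t\<bar> \<le> C" by (rule beta_bounded) blast
  have "\<bar>force x\<bar> \<le> C / \<epsilon>" for x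
    using C(2)[of "v x / \<epsilon>"] eps by (simp add: force_def beta_eps_def divide_right_mono abs_of_pos)
  then show thesis using that[of "C / \<epsilon>"] C(1) eps by simp
qed

lemma v_integrable: "integrable lborel v" "integrable lborel (\<lambda>x. \<bar>v x\<bar> powr p)"
proof -
  have 0: "(\<lambda>x. v x * indicator (cball 0 1) x) = v"
    using v_out by (intro ext) (auto simp: indicator_def)
  have "integrable lborel (\<lambda>x. v x * indicator (cball 0 1) x)"
    by (rule integrable_bounded_mult[OF v_meas v_bound integrable_indicator_cball])
  then show "integrable lborel v" by (simp only: 0)
  have 1: "(\<lambda>x. \<bar>v x\<bar> powr p * indicator (cball 0 1) x) = (\<lambda>x. \<bar>v x\<bar> powr p)"
    using v_out by (intro ext) (auto simp: indicator_def)
  have "integrable lborel (\<lambda>x. \<bar>v x\<bar> powr p * indicator (cball 0 1) x)"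
  proof (rule integrable_bounded_mult[OF _ _ integrable_indicator_cball])
    show "(\<lambda>x. \<bar>v x\<bar> powr p) \<in> borel_measurable borel" using v_meas by simp
    show "\<bar>\<bar>v x\<bar> powr p\<bar> \<le> 1" for x using v_bound[of x] pq by (simp add: powr_le_one_le powr_le1)
  qed
  then show "integrable lborel (\<lambda>x. \<bar>v x\<bar> powr p)" by (simp only: 1)
qed

lemma G_integrable: "integrable lborel (\<lambda>x. G x $ i)"
  by (rule integrable_of_powr_integrable[OF _ G_nth_meas G_Lp, where c = 0 and s = 1])
    (use pq G_out in auto)

lemma norm_G_integrable: "integrable lborel (\<lambda>x. norm (G x) powr p)"
proof (rule Bochner_Integration.integrable_bound)
  show "integrable lborel (\<lambda>x. real CARD('n) powr p * (\<Sum>i\<in>UNIV. \<bar>G x $ i\<bar> powr p))"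
    using G_Lp by (intro integrable_mult_right Bochner_Integration.integrable_sum)
  show "AE x in lborel. norm (norm (G x) powr p) \<le> norm (real CARD('n) powr p * (\<Sum>i\<in>UNIV. \<bar>G x $ i\<bar> powr p))"
    using norm_powr_le_sum[of p] pq by (intro AE_I2) (simp add: sum_nonneg)
qed (use G_meas in simp)

lemma norm_A: "norm (A x) = norm (G x) powr (p - 1)"
proof (cases "G x = 0")
  case False
  then have "norm (G x) powr (p - 2) * norm (G x) powr 1 = norm (G x) powr (p - 1)"
    by (simp only: powr_add[symmetric]) simp
  then show ?thesis by (simp add: A_def)
qed (simp add: A_def)

text \<open>Conjugacy of the exponents means (p - 1) q = p; this is why the flux A lies in
  L^q.\<close>

lemma norm_A_powr: "norm (A x) powr q = norm (G x) powr p"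
proof -
  have "(p - 1) * q = p" using pq by (simp add: field_simps)
  then show ?thesis by (simp add: norm_A powr_powr)
qed

lemma A_inner_G: "A x \<bullet> G x = norm (G x) powr p"
proof (cases "G x = 0")
  case False
  have "A x \<bullet> G x = norm (G x) powr (p - 2) * norm (G x) powr 2"
    using False by (simp add: A_def power2_norm_eq_inner powr_numeral)
  also have "\<dots> = norm (G x) powr p" by (simp only: powr_add[symmetric]) simp
  finally show ?thesis .
qed (simp add: A_def)

text \<open>The gradient inequality in Fenchel form: Young's inequality bounds A.b by |A|^q/q +
  |b|^p/p, and |A|^q = A.G = |G|^p. The argument is the same for p below and above 2 and does not
  differentiate the p-th power of the norm.\<close>

lemma convexity: "A x \<bullet> b - A x \<bullet> G x \<le> norm b powr p / p - norm (G x) powr p / p"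
proof -
  have "A x \<bullet> b \<le> norm (A x) * norm b" by (rule norm_cauchy_schwarz)
  also have "\<dots> \<le> norm (A x) powr q / q + norm b powr p / p"
    by (rule Youngs_inequality) (use pq in auto)
  finally have "A x \<bullet> b \<le> norm (G x) powr p / q + norm b powr p / p" by (simp only: norm_A_powr)
  moreover have "norm (G x) powr p / q = norm (G x) powr p - norm (G x) powr p / p"
  proof -
    have "1 / q = 1 - 1 / p" using pq by simp
    then have "norm (G x) powr p * (1 / q) = norm (G x) powr p * (1 - 1 / p)" by simp
    then show ?thesis by (simp add: right_diff_distrib)
  qed
  ultimately show ?thesis by (simp add: A_inner_G)
qed

text \<open>All functions that are later paired with translates grow at most like the flux plus a
  constant on a ball, so this one bound puts them in L^q.\<close>

lemma Lq_dominated: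
  fixes w :: "real^'n \<Rightarrow> real"
  assumes w: "w \<in> borel_measurable borel" and "0 \<le> C" "0 \<le> D"
    and le: "\<And>x. \<bar>w x\<bar> \<le> C * norm (A x) + D * indicator (cball c s) x"
  shows "integrable lborel (\<lambda>x. \<bar>w x\<bar> powr q)"
proof (rule Bochner_Integration.integrable_bound)
  let ?b = "\<lambda>x. 2 powr q * (C powr q * norm (G x) powr p + D powr q * indicator (cball c s) x)"
  show "integrable lborel ?b"
    by (intro integrable_mult_right Bochner_Integration.integrable_add norm_G_integrable integrable_indicator_cball)
  have "\<bar>w x\<bar> powr q \<le> ?b x" for x
  proof -
    have "\<bar>w x\<bar> powr q \<le> \<bar>C * norm (A x) + D * indicator (cball c s) x\<bar> powr q"
      using le[of x] pq by (intro powr_mono2) auto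
    also have "\<dots> \<le> 2 powr q * (\<bar>C * norm (A x)\<bar> powr q + \<bar>D * indicator (cball c s) x\<bar> powr q)"
      by (rule powr_add_le) (use pq in simp)
    also have "\<bar>C * norm (A x)\<bar> powr q = C powr q * norm (G x) powr p"
      using assms by (simp add: powr_mult norm_A_powr)
    also have "\<bar>D * indicator (cball c s) x\<bar> powr q = D powr q * indicator (cball c s) x"
      using assms by (simp add: indicator_def)
    finally show ?thesis .
  qed
  then show "AE x in lborel. norm (\<bar>w x\<bar> powr q) \<le> norm (?b x)"
    by (intro AE_I2) (auto intro: order_trans[OF _ abs_ge_self])
qed (use w in simp)

end

text \<open>Two radii are carried along: \<phi> is supported in the ball of radius s, and s' - s is
  the length of translations that keep this support inside the unit ball.\<close>

locale borel_solution_test = borel_solution \<beta> p q \<epsilon> v G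
  for \<beta> p q \<epsilon> and v :: "real^'n::finite \<Rightarrow> real" and G +
  fixes \<phi> :: "real^'n \<Rightarrow> real" and c :: "real^'n" and s s' :: real
  assumes phi: "test_fun (ball 0 1) \<phi>" and phi_nonneg: "\<And>x. 0 \<le> \<phi> x"
    and phi_out: "\<And>x. x \<notin> cball c s \<Longrightarrow> \<phi> x = 0"
    and s: "0 \<le> s" "s < s'" and sub: "cball c s' \<subseteq> ball 0 1"
begin

text \<open>The coefficient of the undifferentiated factor when the equation is tested with \<phi>
  times a function: the part of the flux that meets grad \<phi>, plus the force.\<close>

definition w0 :: "real^'n \<Rightarrow> real" where
  "w0 x = A x \<bullet> grad \<phi> x + force x * \<phi> x"

lemma grad_phi_out: "x \<notin> cball c s \<Longrightarrow> grad \<phi> x = 0"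
proof -
  assume x: "x \<notin> cball c s"
  have "closure {x. \<phi> x \<noteq> 0} \<subseteq> cball c s"
    using phi_out by (intro closure_minimal subsetI closed_cball) (metis mem_Collect_eq)
  then have "x \<notin> closure {x. \<phi> x \<noteq> 0}" using x by blast
  then show ?thesis using dpart_zero_outside_support[of x \<phi>] by (simp add: vec_eq_iff)
qed

lemma phi_meas: "\<phi> \<in> borel_measurable borel" and grad_phi_meas: "grad \<phi> \<in> borel_measurable borel"
  using test_fun_measurable[OF phi] continuous_grad[OF test_fun_smooth[OF phi]]
  by (auto intro: borel_measurable_continuous_onI)

lemma phi_bounded: obtains C where "0 < C" "\<And>x. \<bar>\<phi> x\<bar> \<le> C"
  using test_fun_bounded[OF phi] by metis

lemma grad_phi_bounded: obtains C where "0 < C" "\<And>x. norm (grad \<phi> x) \<le> C"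
proof -
  have "bounded (grad \<phi> ` cball c s)"
    by (intro compact_imp_bounded compact_continuous_image continuous_grad test_fun_smooth[OF phi]) auto
  then obtain C where C: "C > 0" "\<And>x. x \<in> cball c s \<Longrightarrow> norm (grad \<phi> x) \<le> C"
    unfolding bounded_pos by auto
  have "norm (grad \<phi> x) \<le> C" for x
    using C grad_phi_out[of x] by (cases "x \<in> cball c s") auto
  then show thesis using that C(1) by blast
qed

lemma w0_meas: "w0 \<in> borel_measurable borel"
  unfolding w0_def[abs_def] using A_meas force_meas phi_meas grad_phi_meas by simp

lemma w0_out: "x \<notin> cball c s \<Longrightarrow> w0 x = 0"
  by (simp add: w0_def grad_phi_out phi_out)

lemma w0_Lq: "integrable lborel (\<lambda>x. \<bar>w0 x\<bar> powr q)"
proof -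
  obtain C1 where C1: "0 < C1" "\<And>x. norm (grad \<phi> x) \<le> C1" by (rule grad_phi_bounded) blast
  obtain C2 where C2: "0 < C2" "\<And>x. \<bar>\<phi> x\<bar> \<le> C2" by (rule phi_bounded) blast
  obtain C3 where C3: "0 < C3" "\<And>x. \<bar>force x\<bar> \<le> C3" by (rule force_bounded) blast
  have "\<bar>w0 x\<bar> \<le> C1 * norm (A x) + (C3 * C2) * indicator (cball c s) x" for x
  proof (cases "x \<in> cball c s")
    case True
    have "\<bar>A x \<bullet> grad \<phi> x\<bar> \<le> norm (A x) * C1"
      by (rule order_trans[OF Cauchy_Schwarz_ineq2 mult_left_mono[OF C1(2) norm_ge_zero]])
    moreover have "\<bar>force x * \<phi> x\<bar> \<le> C3 * C2"
      unfolding abs_mult using C2(2)[of x] C3(2)[of x] C3(1) by (intro mult_mono) auto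
    ultimately show ?thesis using True by (simp add: w0_def mult.commute)
  qed (use w0_out C1 in simp)
  then show ?thesis
    using C1(1) C2(1) C3(1) by (intro Lq_dominated[OF w0_meas, of C1 "C3 * C2" c s]) auto
qed

lemma phi_A_meas: "(\<lambda>x. \<phi> x * A x $ i) \<in> borel_measurable borel"
  using phi_meas A_nth_meas by simp

lemma phi_A_out: "x \<notin> cball c s \<Longrightarrow> \<phi> x * A x $ i = 0"
  by (simp add: phi_out)

lemma phi_A_Lq: "integrable lborel (\<lambda>x. \<bar>\<phi> x * A x $ i\<bar> powr q)"
proof -
  obtain C2 where C2: "0 < C2" "\<And>x. \<bar>\<phi> x\<bar> \<le> C2" by (rule phi_bounded) blast
  have "\<bar>\<phi> x * A x $ i\<bar> \<le> C2 * norm (A x) + 0 * indicator (cball c s) x" for x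
    unfolding abs_mult using C2(2)[of x] C2(1) component_le_norm_cart[of "A x" i] by (auto intro: mult_mono)
  then show ?thesis
    using C2(1) by (intro Lq_dominated[OF phi_A_meas, where C = C2 and D = 0 and c = c and s = s]) auto
qed

lemma w0_integrable: "integrable lborel w0"
  by (rule integrable_of_powr_integrable[OF _ w0_meas w0_Lq w0_out]) (use pq in simp_all)

lemma phi_A_integrable: "integrable lborel (\<lambda>x. \<phi> x * A x $ i)"
  by (rule integrable_of_powr_integrable[OF _ phi_A_meas phi_A_Lq phi_A_out]) (use pq in simp_all)

text \<open>The equation formally tested with \<phi> v(. + y). This product is not smooth, so its
  vanishing is first shown after averaging in y and then recovered for each small y by
  continuity.\<close>

definition E :: "real^'n \<Rightarrow> real" where
  "E y = (\<integral>x. w0 x * v (x + y) \<partial>lborel) + (\<Sum>i\<in>UNIV. \<integral>x. (\<phi> x * A x $ i) * G (x + y) $ i \<partial>lborel)"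

lemma continuous_E: "continuous_on UNIV E"
  unfolding E_def[abs_def]
  by (intro continuous_intros continuous_pairing[OF pq w0_meas w0_Lq w0_out s(1) v_meas v_integrable(2,1)]
      continuous_pairing[OF pq phi_A_meas phi_A_Lq phi_A_out s(1) G_nth_meas G_Lp G_integrable])

text \<open>The equation is tested with \<phi> times the correlation of \<kappa> with v; Fubini then
  rewrites the result as the average of E against \<kappa>.\<close>

lemma mollified_equation:
  assumes k: "test_fun (ball 0 (s' - s)) \<kappa>"
  shows "integrable lborel (\<lambda>y. \<kappa> y * E y)" "(\<integral>y. \<kappa> y * E y \<partial>lborel) = 0"
proof -
  define u where "u = correlation \<kappa> v"
  define U where "U i = correlation \<kappa> (\<lambda>x. G x $ i)" for i
  define \<psi> where "\<psi> x = \<phi> x * u x" for x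
  have us: "smooth_on UNIV u" unfolding u_def by (rule correlation_smooth[OF k v_integrable(1)])
  have \<psi>: "test_fun (ball 0 1) \<psi>" unfolding \<psi>_def by (rule test_fun_mult[OF phi us])
  \<comment> \<open>Differentiating the mollification falls on G only where the shifted support of
    \<kappa> stays in the unit ball. The radius s' - s guarantees this on the support of \<phi>;
    elsewhere the factor \<phi> makes both sides 0.\<close>
  have du: "\<phi> x * dpart [i] u x = \<phi> x * U i x" for x i
  proof (cases "x \<in> cball c s")
    case True
    have tr: "test_fun (ball 0 1) (\<lambda>z. \<kappa> (z - x))"
    proof (rule test_fun_translate(1)[OF k])
      fix z assume "z \<in> closure {x. \<kappa> x \<noteq> 0}"
      then have "norm z < s' - s" using k unfolding test_fun_def by (meson mem_ball_0 subsetD)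
      moreover have "dist c (z + x) \<le> dist c x + dist x (z + x)" by (rule dist_triangle)
      ultimately have "z + x \<in> cball c s'" using True by (simp add: dist_norm)
      then show "z + x \<in> ball 0 1" using sub by blast
    qed
    have "dpart [i] u x = - (\<integral>z. dpart [i] \<kappa> (z - x) * v z \<partial>lborel)"
      unfolding u_def by (simp add: dpart_correlation[OF k v_integrable(1)] correlation_def)
    also have "\<dots> = - (\<integral>z. v z * dpart [i] (\<lambda>z. \<kappa> (z - x)) z \<partial>lborel)"
      by (subst test_fun_translate(2)[OF k, where V = UNIV]) (auto simp: mult.commute)
    also have "\<dots> = U i x" using weak[OF tr] by (simp add: U_def correlation_def mult.commute)
    finally show ?thesis by simp
  qed (simp add: phi_out)
  have g\<psi>: "grad \<psi> x $ i = \<phi> x * U i x + dpart [i] \<phi> x * u x" for x i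
    unfolding grad_nth \<psi>_def du[symmetric]
    by (intro dpart_mult smooth_on_UNIV_differentiable test_fun_smooth[OF phi] us)
  have key: "A x \<bullet> grad \<psi> x + force x * \<psi> x = (\<Sum>i\<in>UNIV. (\<phi> x * A x $ i) * U i x) + w0 x * u x" for x
  proof -
    have "A x \<bullet> grad \<psi> x = (\<Sum>i\<in>UNIV. (\<phi> x * A x $ i) * U i x + (A x $ i * dpart [i] \<phi> x) * u x)"
      by (simp add: inner_vec_def g\<psi>[unfolded grad_nth] algebra_simps)
    also have "\<dots> = (\<Sum>i\<in>UNIV. (\<phi> x * A x $ i) * U i x) + (A x \<bullet> grad \<phi> x) * u x"
      by (simp add: sum.distrib sum_distrib_right inner_vec_def)
    finally show ?thesis by (simp add: w0_def \<psi>_def algebra_simps)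
  qed
  note F1 = fubini_correlation[OF k w0_meas w0_integrable v_meas v_integrable(1), folded u_def]
  note F2 = fubini_correlation[OF k phi_A_meas phi_A_integrable G_nth_meas G_integrable, folded U_def]
  have int: "integrable lborel (\<lambda>x. \<Sum>i\<in>UNIV. (\<phi> x * A x $ i) * U i x)"
    by (intro Bochner_Integration.integrable_sum F2(2))
  obtain C where C: "\<And>x. \<bar>force x\<bar> \<le> C" by (rule force_bounded) blast
  have if\<psi>: "integrable lborel (\<lambda>x. force x * \<psi> x)"
    by (rule integrable_bounded_mult[OF force_meas C test_fun_integrable[OF \<psi>]])
  have iA: "integrable lborel (\<lambda>x. A x \<bullet> grad \<psi> x)"
  proof -
    have "(\<lambda>x. A x \<bullet> grad \<psi> x) = (\<lambda>x. (\<Sum>i\<in>UNIV. (\<phi> x * A x $ i) * U i x) + w0 x * u x - force x * \<psi> x)"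
      using key by (intro ext) (metis add_diff_cancel_right')
    then show ?thesis using int F1(2) if\<psi> by simp
  qed
  have "(\<integral>x. A x \<bullet> grad \<psi> x \<partial>lborel) + (\<integral>x. force x * \<psi> x \<partial>lborel) = 0"
    using equation[OF \<psi>] by (simp add: A_def force_def)
  then have "(\<integral>x. (\<Sum>i\<in>UNIV. (\<phi> x * A x $ i) * U i x) + w0 x * u x \<partial>lborel) = 0"
    using iA if\<psi> by (simp flip: key)
  then have 0: "(\<Sum>i\<in>UNIV. \<integral>x. (\<phi> x * A x $ i) * U i x \<partial>lborel) + (\<integral>x. w0 x * u x \<partial>lborel) = 0"
    using int F1(2) F2(2) by simp
  have kE: "(\<lambda>y. \<kappa> y * E y) = (\<lambda>y. \<kappa> y * (\<integral>x. w0 x * v (x + y) \<partial>lborel) +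
      (\<Sum>i\<in>UNIV. \<kappa> y * (\<integral>x. (\<phi> x * A x $ i) * G (x + y) $ i \<partial>lborel)))"
    by (simp add: E_def distrib_left sum_distrib_left)
  show "integrable lborel (\<lambda>y. \<kappa> y * E y)"
    unfolding kE using F1(1) F2(1) by (intro Bochner_Integration.integrable_add Bochner_Integration.integrable_sum)
  have "(\<integral>y. \<kappa> y * E y \<partial>lborel) = (\<integral>y. \<kappa> y * (\<integral>x. w0 x * v (x + y) \<partial>lborel) \<partial>lborel) +
      (\<Sum>i\<in>UNIV. \<integral>y. \<kappa> y * (\<integral>x. (\<phi> x * A x $ i) * G (x + y) $ i \<partial>lborel) \<partial>lborel)"
    unfolding kE using F1(1) F2(1)
    by (subst Bochner_Integration.integral_add) (auto intro!: Bochner_Integration.integral_sum)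
  also have "\<dots> = 0" unfolding F1(3) F2(3) using 0 by simp
  finally show "(\<integral>y. \<kappa> y * E y \<partial>lborel) = 0" .
qed

lemma E_zero: "norm y < s' - s \<Longrightarrow> E y = 0"
  using fundamental_lemma[OF continuous_E] mollified_equation by blast

text \<open>Convexity compares the energy at translates with the linear term \<phi> A.G(. + y), and
  the equation replaces that term by a pairing with v(. + y). The resulting inequality is exactly
  the hypothesis of \<open>variation_identity\<close>, with weight -\<open>w0\<close>.\<close>

lemma inner_variation:
  "(\<integral>x. dpart [l] \<phi> x * (norm (G x) powr p / p) \<partial>lborel) = (\<integral>x. w0 x * G x $ l \<partial>lborel)"
proof -
  define h where "h x = norm (G x) powr p / p" for x
  have h: "h \<in> borel_measurable borel" "integrable lborel h"
    unfolding h_def[abs_def] using G_meas norm_G_integrable by simp_all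
  have wm: "(\<lambda>x. - w0 x) \<in> borel_measurable borel" using w0_meas by simp
  have wq: "integrable lborel (\<lambda>x. \<bar>- w0 x\<bar> powr q)" using w0_Lq by simp
  have wo: "- w0 x = 0" if "x \<notin> cball c s" for x using w0_out[OF that] by simp
  have iG: "integrable lborel (\<lambda>x. (\<phi> x * A x $ i) * G (x + y) $ i)" for i y
    by (rule pairing_integrable_bound(1)[OF pq phi_A_meas phi_A_Lq G_nth_meas G_Lp])
  have ih: "integrable lborel (\<lambda>x. \<phi> x * h (x + y))" for y
  proof -
    have "integrable lborel (\<lambda>x. h (x + y))" using lborel_integral_shift(2)[OF h(1)] h(2) by blast
    from test_fun_shift_mult_integrable[OF phi this, of 0] show ?thesis by simp
  qed
  have ineq: "(\<integral>x. - w0 x * v (x + y) \<partial>lborel) - (\<integral>x. - w0 x * v x \<partial>lborel)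
      \<le> (\<integral>x. \<phi> x * h (x + y) \<partial>lborel) - (\<integral>x. \<phi> x * h x \<partial>lborel)" if y: "norm y < s' - s" for y
  proof -
    \<comment> \<open>The decisive exchange: translates of G need not be differentiable in y, even
      weakly paired with the flux, but E = 0 trades them for translates of v, whose weak derivative
      is G. The sign of \<open>w0\<close> flips here.\<close>
    have K: "(\<Sum>i\<in>UNIV. \<integral>x. (\<phi> x * A x $ i) * G (x + z) $ i \<partial>lborel) = (\<integral>x. - w0 x * v (x + z) \<partial>lborel)"
      if "norm z < s' - s" for z
      using E_zero[OF that] by (simp add: E_def)
    have "(\<Sum>i\<in>UNIV. \<integral>x. (\<phi> x * A x $ i) * G (x + y) $ i \<partial>lborel) - (\<Sum>i\<in>UNIV. \<integral>x. (\<phi> x * A x $ i) * G (x + 0) $ i \<partial>lborel)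
      = (\<integral>x. (\<Sum>i\<in>UNIV. (\<phi> x * A x $ i) * G (x + y) $ i) - (\<Sum>i\<in>UNIV. (\<phi> x * A x $ i) * G (x + 0) $ i) \<partial>lborel)"
      by (subst Bochner_Integration.integral_diff)
        (auto intro!: Bochner_Integration.integrable_sum iG Bochner_Integration.integral_sum[symmetric]
          arg_cong2[where f = minus] simp del: add_0_right)
    also have "\<dots> \<le> (\<integral>x. \<phi> x * h (x + y) - \<phi> x * h (x + 0) \<partial>lborel)"
    proof (rule integral_mono)
      show "integrable lborel (\<lambda>x. (\<Sum>i\<in>UNIV. (\<phi> x * A x $ i) * G (x + y) $ i) - (\<Sum>i\<in>UNIV. (\<phi> x * A x $ i) * G (x + 0) $ i))"
        by (intro Bochner_Integration.integrable_diff Bochner_Integration.integrable_sum iG)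
      show "integrable lborel (\<lambda>x. \<phi> x * h (x + y) - \<phi> x * h (x + 0))"
        by (intro Bochner_Integration.integrable_diff ih)
      fix x
      have inn: "(\<Sum>i\<in>UNIV. (\<phi> x * A x $ i) * b $ i) = \<phi> x * (A x \<bullet> b)" for b
        by (simp add: inner_vec_def sum_distrib_left mult.assoc)
      \<comment> \<open>Nonnegativity of \<phi> is used here, to multiply the pointwise convexity
        inequality.\<close>
      have "\<phi> x * (A x \<bullet> G (x + y) - A x \<bullet> G x) \<le> \<phi> x * (h (x + y) - h x)"
        unfolding h_def by (rule mult_left_mono[OF convexity phi_nonneg])
      then show "(\<Sum>i\<in>UNIV. (\<phi> x * A x $ i) * G (x + y) $ i) - (\<Sum>i\<in>UNIV. (\<phi> x * A x $ i) * G (x + 0) $ i)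
        \<le> \<phi> x * h (x + y) - \<phi> x * h (x + 0)"
        unfolding inn by (simp add: right_diff_distrib)
    qed
    also have "\<dots> = (\<integral>x. \<phi> x * h (x + y) \<partial>lborel) - (\<integral>x. \<phi> x * h (x + 0) \<partial>lborel)"
      by (rule Bochner_Integration.integral_diff[OF ih ih])
    finally show ?thesis using K[OF y] K[of 0] s by simp
  qed
  have pos: "0 < s' - s" using s by simp
  have "(\<integral>x. dpart [l] \<phi> x * h x \<partial>lborel) = - (\<integral>x. - w0 x * G x $ l \<partial>lborel)"
    by (rule variation_identity[OF pq wm wq wo s sub open_ball v_meas v_integrable(2,1) G_nth_meas G_Lp G_integrable
      weak h phi pos ineq])
  then show ?thesis by (simp add: h_def)
qed

text \<open>The tangent inequality for \<Phi>, multiplied by \<phi> >= 0 and integrated, is again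
  the hypothesis of \<open>variation_identity\<close>. \<open>\<Phi> 0 = 0\<close> makes
  \<open>\<Phi> (v x)\<close> vanish outside the unit ball, hence integrable; bounds on [-1, 1]
  suffice because |v| <= 1.\<close>

lemma convex_chain_rule:
  assumes conv: "\<And>a b. \<Phi>' a * (b - a) \<le> \<Phi> b - \<Phi> a"
    and meas: "\<Phi> \<in> borel_measurable borel" "\<Phi>' \<in> borel_measurable borel"
    and bnd: "\<And>t. \<bar>t\<bar> \<le> 1 \<Longrightarrow> \<bar>\<Phi> t\<bar> \<le> C" "\<And>t. \<bar>t\<bar> \<le> 1 \<Longrightarrow> \<bar>\<Phi>' t\<bar> \<le> C" and zero: "\<Phi> 0 = 0"
  shows "(\<integral>x. dpart [l] \<phi> x * \<Phi> (v x) \<partial>lborel) = - (\<integral>x. (\<phi> x * \<Phi>' (v x)) * G x $ l \<partial>lborel)"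
proof -
  define h where "h x = \<Phi> (v x)" for x
  define w where "w x = \<phi> x * \<Phi>' (v x)" for x
  have C: "0 \<le> C" using bnd(1)[of 0] by linarith
  have hm: "h \<in> borel_measurable borel" unfolding h_def[abs_def] by (rule measurable_compose[OF v_meas meas(1)])
  have hi: "integrable lborel h"
  proof -
    have "(\<lambda>x. h x * indicator (cball 0 1) x) = h"
      using v_out zero by (intro ext) (auto simp: h_def indicator_def)
    moreover have "integrable lborel (\<lambda>x. h x * indicator (cball 0 1) x)"
      by (rule integrable_bounded_mult[OF hm _ integrable_indicator_cball, of C]) (simp add: h_def bnd v_bound)
    ultimately show ?thesis by simp
  qed
  have wm: "w \<in> borel_measurable borel"
    unfolding w_def[abs_def] using phi_meas measurable_compose[OF v_meas meas(2)] by simp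
  obtain C2 where C2: "0 < C2" "\<And>x. \<bar>\<phi> x\<bar> \<le> C2" by (rule phi_bounded) blast
  have wo: "w x = 0" if "x \<notin> cball c s" for x using phi_out[OF that] by (simp add: w_def)
  have "\<bar>w x\<bar> \<le> 0 * norm (A x) + (C2 * C) * indicator (cball c s) x" for x
  proof (cases "x \<in> cball c s")
    case True
    have "\<bar>w x\<bar> \<le> C2 * C"
      unfolding w_def abs_mult using C2 bnd(2)[OF v_bound] by (intro mult_mono) auto
    then show ?thesis using True by simp
  qed (use wo in simp)
  then have wq: "integrable lborel (\<lambda>x. \<bar>w x\<bar> powr q)"
    using C2 C by (intro Lq_dominated[OF wm, of 0 "C2 * C" c s]) auto
  have ih: "integrable lborel (\<lambda>x. \<phi> x * h (x + y))" for y
  proof -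
    have "integrable lborel (\<lambda>x. h (x + y))" using lborel_integral_shift(2)[OF hm] hi by blast
    from test_fun_shift_mult_integrable[OF phi this, of 0] show ?thesis by simp
  qed
  have iw: "integrable lborel (\<lambda>x. w x * v (x + y))" for y
    by (rule pairing_integrable_bound(1)[OF pq wm wq v_meas v_integrable(2)])
  have ineq: "(\<integral>x. w x * v (x + y) \<partial>lborel) - (\<integral>x. w x * v x \<partial>lborel)
      \<le> (\<integral>x. \<phi> x * h (x + y) \<partial>lborel) - (\<integral>x. \<phi> x * h x \<partial>lborel)" if "norm y < s' - s" for y
  proof -
    have "(\<integral>x. w x * v (x + y) - w x * v (x + 0) \<partial>lborel) \<le> (\<integral>x. \<phi> x * h (x + y) - \<phi> x * h (x + 0) \<partial>lborel)"
    proof (rule integral_mono)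
      show "w x * v (x + y) - w x * v (x + 0) \<le> \<phi> x * h (x + y) - \<phi> x * h (x + 0)" for x
        using mult_left_mono[OF conv[of "v x" "v (x + y)"] phi_nonneg[of x]]
        by (simp add: w_def h_def algebra_simps)
    qed (intro Bochner_Integration.integrable_diff iw ih)+
    then show ?thesis
      using Bochner_Integration.integral_diff[OF iw[of y] iw[of 0]] Bochner_Integration.integral_diff[OF ih[of y] ih[of 0]]
      by simp
  qed
  have pos: "0 < s' - s" using s by simp
  have "(\<integral>x. dpart [l] \<phi> x * h x \<partial>lborel) = - (\<integral>x. w x * G x $ l \<partial>lborel)"
    by (rule variation_identity[OF pq wm wq wo s sub open_ball v_meas v_integrable(2,1) G_nth_meas G_Lp G_integrable
      weak hm hi phi pos ineq])
  then show ?thesis by (simp add: h_def w_def)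
qed

end

context borel_solution_test
begin

text \<open>The antiderivative of the force is not convex, but it is a difference of two convex functions.\<close>

lemma force_chain_rule:
  "(\<integral>x. dpart [l] \<phi> x * primitive (v x / \<epsilon>) \<partial>lborel) = - (\<integral>x. (\<phi> x * force x) * G x $ l \<partial>lborel)"
proof -
  obtain L0 where L0: "0 < L0" "\<And>t. \<bar>deriv \<beta> t\<bar> \<le> L0" by (rule beta_deriv_bounded) blast
  \<comment> \<open>The slope of \<open>beta_eps \<beta> \<epsilon>\<close> is at least -L, so the
    second derivative of \<Phi> below is at least L. The dependence on \<epsilon> is harmless, since
    the quadratic is subtracted again.\<close>
  define L where "L = L0 / \<epsilon>\<^sup>2"
  have L: "0 < L" using L0 eps by (simp add: L_def)
  define \<Phi> where "\<Phi> t = primitive (t / \<epsilon>) + L * t\<^sup>2" for t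
  define \<Phi>' where "\<Phi>' t = beta_eps \<beta> \<epsilon> t + 2 * L * t" for t
  have d1: "(\<Phi> has_real_derivative \<Phi>' t) (at t)" for t
  proof -
    have "((\<lambda>t. t / \<epsilon>) has_real_derivative 1 / \<epsilon>) (at t)"
      using eps by (auto intro!: derivative_eq_intros)
    from DERIV_chain2[OF primitive_deriv this]
    have "((\<lambda>t. primitive (t / \<epsilon>)) has_real_derivative \<beta> (t / \<epsilon>) * (1 / \<epsilon>)) (at t)" .
    moreover have "((\<lambda>t. L * t\<^sup>2) has_real_derivative 2 * L * t) (at t)"
      by (auto intro!: derivative_eq_intros)
    ultimately have "(\<Phi> has_real_derivative \<beta> (t / \<epsilon>) * (1 / \<epsilon>) + 2 * L * t) (at t)"
      unfolding \<Phi>_def[abs_def] by (rule DERIV_add)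
    then show ?thesis by (simp add: \<Phi>'_def beta_eps_def)
  qed
  have d2: "(\<Phi>' has_real_derivative deriv \<beta> (t / \<epsilon>) / \<epsilon>\<^sup>2 + 2 * L) (at t)" for t
  proof -
    have b: "(\<beta> has_real_derivative deriv \<beta> s) (at s)" for s
      using beta_differentiable[of 0 s] DERIV_deriv_iff_real_differentiable by simp
    have "((\<lambda>t. t / \<epsilon>) has_real_derivative 1 / \<epsilon>) (at t)"
      using eps by (auto intro!: derivative_eq_intros)
    from DERIV_chain2[OF b this]
    have "((\<lambda>t. \<beta> (t / \<epsilon>)) has_real_derivative deriv \<beta> (t / \<epsilon>) * (1 / \<epsilon>)) (at t)" .
    then have "((\<lambda>t. 1 / \<epsilon> * \<beta> (t / \<epsilon>)) has_real_derivative 1 / \<epsilon> * (deriv \<beta> (t / \<epsilon>) * (1 / \<epsilon>))) (at t)"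
      by (rule DERIV_cmult)
    moreover have "((\<lambda>t. 2 * L * t) has_real_derivative 2 * L) (at t)"
      by (auto intro!: derivative_eq_intros)
    ultimately have "(\<Phi>' has_real_derivative 1 / \<epsilon> * (deriv \<beta> (t / \<epsilon>) * (1 / \<epsilon>)) + 2 * L) (at t)"
      unfolding \<Phi>'_def[abs_def] beta_eps_def by (rule DERIV_add)
    then show ?thesis by (simp add: power2_eq_square)
  qed
  have "0 \<le> deriv \<beta> (t / \<epsilon>) / \<epsilon>\<^sup>2 + 2 * L" for t
  proof -
    have "- L0 / \<epsilon>\<^sup>2 \<le> deriv \<beta> (t / \<epsilon>) / \<epsilon>\<^sup>2"
      using L0(2)[of "t / \<epsilon>"] by (intro divide_right_mono) auto
    then show ?thesis using L by (simp add: L_def)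
  qed
  then have "convex_on UNIV \<Phi>"
    by (intro f''_ge0_imp_convex[OF convex_UNIV d1 d2])
  then have conv: "\<Phi>' a * (b - a) \<le> \<Phi> b - \<Phi> a" for a b
    using convex_on_imp_above_tangent[of UNIV \<Phi> a b "\<Phi>' a"] d1 by simp
  have cont: "continuous_on A \<Phi>" "continuous_on A \<Phi>'" for A
    using d1 d2 by (meson DERIV_isCont continuous_at_imp_continuous_on)+
  have meas: "\<Phi> \<in> borel_measurable borel" "\<Phi>' \<in> borel_measurable borel"
    using cont by (auto intro: borel_measurable_continuous_onI)
  have bdd: "\<exists>C. \<forall>t. \<bar>t\<bar> \<le> 1 \<longrightarrow> \<bar>f t\<bar> \<le> C" if "continuous_on {-1..1} f" for f :: "real \<Rightarrow> real"
  proof -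
    have "bounded (f ` {-1..1})" by (intro compact_imp_bounded compact_continuous_image that) auto
    then obtain C where "\<forall>t\<in>{-1..1}. \<bar>f t\<bar> \<le> C" unfolding bounded_iff by auto
    then show ?thesis by (intro exI[of _ C]) (simp add: abs_le_iff)
  qed
  obtain C1 C2 where C1: "\<forall>t. \<bar>t\<bar> \<le> 1 \<longrightarrow> \<bar>\<Phi> t\<bar> \<le> C1" and C2: "\<forall>t. \<bar>t\<bar> \<le> 1 \<longrightarrow> \<bar>\<Phi>' t\<bar> \<le> C2"
    using bdd[OF cont(1)] bdd[OF cont(2)] by blast
  \<comment> \<open>One bound for both applications of the chain rule: on |t| <= 1 the number 2L
    dominates L t^2 as well as its derivative 2 L t.\<close>
  define C where "C = max (2 * L) (max C1 C2)"
  have Phi_bnd: "\<bar>\<Phi> t\<bar> \<le> C" "\<bar>\<Phi>' t\<bar> \<le> C" if "\<bar>t\<bar> \<le> 1" for t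
    using C1 C2 that unfolding C_def by (meson max.coboundedI1 max.coboundedI2)+
  have 1: "(\<integral>x. dpart [l] \<phi> x * \<Phi> (v x) \<partial>lborel) = - (\<integral>x. (\<phi> x * \<Phi>' (v x)) * G x $ l \<partial>lborel)"
    by (rule convex_chain_rule[OF conv meas Phi_bnd]) (auto simp: \<Phi>_def primitive_0)
  have 2: "(\<integral>x. dpart [l] \<phi> x * (L * (v x)\<^sup>2) \<partial>lborel) = - (\<integral>x. (\<phi> x * (2 * L * v x)) * G x $ l \<partial>lborel)"
  proof (rule convex_chain_rule[where C = C])
    show "2 * L * a * (b - a) \<le> L * b\<^sup>2 - L * a\<^sup>2" for a b
    proof -
      have "0 \<le> L * (b - a)\<^sup>2" using L by simp
      then show ?thesis by (simp add: power2_eq_square algebra_simps)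
    qed
    show "\<bar>L * t\<^sup>2\<bar> \<le> C" if "\<bar>t\<bar> \<le> 1" for t
    proof -
      have "L * t\<^sup>2 \<le> L * 1" using L that by (intro mult_left_mono) (auto simp: abs_square_le_1)
      moreover have "2 * L \<le> C" by (simp add: C_def)
      moreover have "0 \<le> L * t\<^sup>2" using L by simp
      ultimately show ?thesis using L by linarith
    qed
    show "\<bar>2 * L * t\<bar> \<le> C" if "\<bar>t\<bar> \<le> 1" for t
    proof -
      have "\<bar>2 * L * t\<bar> \<le> 2 * L" using L that by (simp add: abs_mult)
      then show ?thesis by (simp add: C_def)
    qed
  qed auto
  have vm: "(\<lambda>x. \<Phi> (v x)) \<in> borel_measurable borel" by (rule measurable_compose[OF v_meas meas(1)])
  have i1: "integrable lborel (\<lambda>x. dpart [l] \<phi> x * \<Phi> (v x))"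
    using integrable_bounded_mult[OF vm Phi_bnd(1)[OF v_bound] test_fun_integrable[OF test_fun_dpart[OF phi]]]
    by (simp add: mult.commute)
  have i2: "integrable lborel (\<lambda>x. dpart [l] \<phi> x * (L * (v x)\<^sup>2))"
  proof -
    have "\<bar>L * (v x)\<^sup>2\<bar> \<le> L" for x
    proof -
      have "L * (v x)\<^sup>2 \<le> L * 1" using L v_bound[of x] by (intro mult_left_mono) (auto simp: abs_square_le_1)
      then show ?thesis using L by simp
    qed
    moreover have "(\<lambda>x. L * (v x)\<^sup>2) \<in> borel_measurable borel" using v_meas by simp
    ultimately have "integrable lborel (\<lambda>x. (L * (v x)\<^sup>2) * dpart [l] \<phi> x)"
      by (intro integrable_bounded_mult[OF _ _ test_fun_integrable[OF test_fun_dpart[OF phi]]])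
    then show ?thesis by (simp add: mult.commute)
  qed
  have gen: "integrable lborel (\<lambda>x. (\<phi> x * f (v x)) * G x $ l)"
    if "f \<in> borel_measurable borel" "\<And>t. \<bar>t\<bar> \<le> 1 \<Longrightarrow> \<bar>f t\<bar> \<le> C" for f :: "real \<Rightarrow> real"
  proof -
    have "(\<lambda>x. f (v x)) \<in> borel_measurable borel" by (rule measurable_compose[OF v_meas that(1)])
    from integrable_bounded_mult[OF this that(2)[OF v_bound] test_fun_shift_mult_integrable[OF phi G_integrable, of 0]]
    show ?thesis by (simp add: mult_ac)
  qed
  have i3: "integrable lborel (\<lambda>x. (\<phi> x * \<Phi>' (v x)) * G x $ l)" by (rule gen[OF meas(2) Phi_bnd(2)])
  have i4: "integrable lborel (\<lambda>x. (\<phi> x * (2 * L * v x)) * G x $ l)"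
  proof (rule gen)
    show "\<bar>2 * L * t\<bar> \<le> C" if "\<bar>t\<bar> \<le> 1" for t
    proof -
      have "\<bar>2 * L * t\<bar> \<le> 2 * L" using L that by (simp add: abs_mult)
      then show ?thesis by (simp add: C_def)
    qed
  qed simp
  have "(\<integral>x. dpart [l] \<phi> x * primitive (v x / \<epsilon>) \<partial>lborel)
    = (\<integral>x. dpart [l] \<phi> x * \<Phi> (v x) - dpart [l] \<phi> x * (L * (v x)\<^sup>2) \<partial>lborel)"
    by (simp add: \<Phi>_def distrib_left)
  also have "\<dots> = - (\<integral>x. (\<phi> x * \<Phi>' (v x)) * G x $ l - (\<phi> x * (2 * L * v x)) * G x $ l \<partial>lborel)"
    using 1 2 Bochner_Integration.integral_diff[OF i1 i2] Bochner_Integration.integral_diff[OF i3 i4] by simp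
  also have "\<dots> = - (\<integral>x. (\<phi> x * force x) * G x $ l \<partial>lborel)"
    by (simp add: \<Phi>'_def force_def algebra_simps)
  finally show ?thesis .
qed

end

section \<open>The stress tensor and its divergence\<close>

context borel_solution
begin

definition stress :: "real^'n \<Rightarrow> 'n \<Rightarrow> 'n \<Rightarrow> real" where
  "stress x l m = Ttensor p (G x) $ l $ m - (if l = m then p * primitive (v x / \<epsilon>) else 0)"

lemma Ttensor_nth: "Ttensor p (G x) $ l $ m = p * (A x $ l * G x $ m) - (if l = m then norm (G x) powr p else 0)"
  by (simp add: Ttensor_def A_def)

lemma primitive_meas: "(\<lambda>x. primitive (v x / \<epsilon>)) \<in> borel_measurable borel"
proof -
  have "continuous_on UNIV primitive"
    using primitive_deriv by (meson DERIV_isCont continuous_at_imp_continuous_on)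
  then have "primitive \<in> borel_measurable borel" by (rule borel_measurable_continuous_onI)
  moreover have "(\<lambda>x. v x / \<epsilon>) \<in> borel_measurable borel" using v_meas by simp
  ultimately show ?thesis by (rule measurable_compose[rotated])
qed

lemma primitive_integrable: "integrable lborel (\<lambda>x. primitive (v x / \<epsilon>))"
proof -
  have "(\<lambda>x. primitive (v x / \<epsilon>) * indicator (cball 0 1) x) = (\<lambda>x. primitive (v x / \<epsilon>))"
    using v_out by (intro ext) (auto simp: indicator_def primitive_0)
  moreover have "integrable lborel (\<lambda>x. primitive (v x / \<epsilon>) * indicator (cball 0 1) x)"
    by (rule integrable_bounded_mult[OF primitive_meas _ integrable_indicator_cball, of "primitive 1"])
      (simp add: primitive_bounds)
  ultimately show ?thesis by simp
qed

lemma A_G_integrable: "integrable lborel (\<lambda>x. A x $ l * G x $ m)"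
proof (rule Bochner_Integration.integrable_bound[OF norm_G_integrable])
  show "(\<lambda>x. A x $ l * G x $ m) \<in> borel_measurable lborel" using A_nth_meas G_nth_meas by simp
  have "\<bar>A x $ l * G x $ m\<bar> \<le> norm (G x) powr p" for x
  proof -
    have "\<bar>A x $ l * G x $ m\<bar> \<le> norm (A x) * norm (G x)"
      unfolding abs_mult by (intro mult_mono component_le_norm_cart) auto
    also have "\<dots> = A x \<bullet> G x" by (simp add: A_def power2_norm_eq_inner[symmetric] power2_eq_square)
    finally show ?thesis by (simp add: A_inner_G)
  qed
  then show "AE x in lborel. norm (A x $ l * G x $ m) \<le> norm (norm (G x) powr p)" by simp
qed

lemma Ttensor_integrable: "integrable lborel (\<lambda>x. Ttensor p (G x) $ l $ m)"
  unfolding Ttensor_nth using A_G_integrable[of l m] norm_G_integrable by (cases "l = m") simp_all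

lemma stress_integrable: "integrable lborel (\<lambda>x. stress x l m)"
  unfolding stress_def using Ttensor_integrable[of l m] primitive_integrable by (cases "l = m") simp_all

lemma stress_mult_integrable:
  assumes "test_fun U \<psi>" shows "integrable lborel (\<lambda>x. stress x l m * dpart [m] \<psi> x)"
  using test_fun_shift_mult_integrable[OF test_fun_dpart[OF assms] stress_integrable, of m 0 l m]
  by (simp add: mult.commute)

end

context borel_solution_test
begin

text \<open>Expanding the contraction leaves four integrals. \<open>inner_variation\<close> cancels
  the \<open>w0\<close> term against the energy term, and \<open>force_chain_rule\<close> cancels
  the force term against the one with \<open>primitive\<close>; the factor p in the tensor matches
  the 1/p in the energy density.\<close>

lemma stress_identity_nonneg: "(\<Sum>m\<in>UNIV. \<integral>x. stress x l m * dpart [m] \<phi> x \<partial>lborel) = 0"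
proof -
  have pt: "(\<Sum>m\<in>UNIV. stress x l m * dpart [m] \<phi> x)
    = p * (w0 x * G x $ l) - p * ((\<phi> x * force x) * G x $ l)
      - p * (dpart [l] \<phi> x * (norm (G x) powr p / p)) - p * (dpart [l] \<phi> x * primitive (v x / \<epsilon>))" for x
  proof -
    have "(\<Sum>m\<in>UNIV. stress x l m * dpart [m] \<phi> x)
      = (\<Sum>m\<in>UNIV. p * (G x $ l * (A x $ m * dpart [m] \<phi> x))
          - (if l = m then (norm (G x) powr p + p * primitive (v x / \<epsilon>)) * dpart [m] \<phi> x else 0))"
      by (intro sum.cong refl) (auto simp: stress_def Ttensor_nth A_def algebra_simps)
    also have "\<dots> = p * (G x $ l * (A x \<bullet> grad \<phi> x))
      - (norm (G x) powr p + p * primitive (v x / \<epsilon>)) * dpart [l] \<phi> x"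
      by (simp add: sum_subtractf sum_distrib_left[symmetric] inner_vec_def)
    finally show ?thesis using pq by (simp add: w0_def algebra_simps)
  qed
  have i1: "integrable lborel (\<lambda>x. w0 x * G x $ l)"
    using pairing_integrable_bound(1)[OF pq w0_meas w0_Lq G_nth_meas G_Lp, where y = 0] by simp
  obtain C where C: "\<And>x. \<bar>force x\<bar> \<le> C" by (rule force_bounded) blast
  have i2: "integrable lborel (\<lambda>x. (\<phi> x * force x) * G x $ l)"
    using integrable_bounded_mult[OF force_meas C test_fun_shift_mult_integrable[OF phi G_integrable, of 0]]
    by (simp add: mult_ac)
  have i3: "integrable lborel (\<lambda>x. dpart [l] \<phi> x * (norm (G x) powr p / p))"
  proof -
    have "integrable lborel (\<lambda>x. norm (G x) powr p / p)" using norm_G_integrable by simp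
    from test_fun_shift_mult_integrable[OF test_fun_dpart[OF phi] this, of l 0] show ?thesis by simp
  qed
  have i4: "integrable lborel (\<lambda>x. dpart [l] \<phi> x * primitive (v x / \<epsilon>))"
    using test_fun_shift_mult_integrable[OF test_fun_dpart[OF phi] primitive_integrable, of l 0] by simp
  have "(\<Sum>m\<in>UNIV. \<integral>x. stress x l m * dpart [m] \<phi> x \<partial>lborel) = (\<integral>x. (\<Sum>m\<in>UNIV. stress x l m * dpart [m] \<phi> x) \<partial>lborel)"
    by (rule Bochner_Integration.integral_sum[symmetric]) (rule stress_mult_integrable[OF phi])
  also have "\<dots> = p * (\<integral>x. w0 x * G x $ l \<partial>lborel) - p * (\<integral>x. (\<phi> x * force x) * G x $ l \<partial>lborel)
      - p * (\<integral>x. dpart [l] \<phi> x * (norm (G x) powr p / p) \<partial>lborel) - p * (\<integral>x. dpart [l] \<phi> x * primitive (v x / \<epsilon>) \<partial>lborel)"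
    unfolding pt using i1 i2 i3 i4 by (simp del: times_divide_eq_right)
  also have "\<dots> = 0" unfolding inner_variation force_chain_rule by simp
  finally show ?thesis .
qed

end

text \<open>Testing the inclusion at the point of the closed ball farthest from the origin gives a
  strict inequality, and with it room for larger concentric balls.\<close>

lemma cball_subset_unit_ball:
  fixes c :: "real^'n::finite"
  assumes "cball c r \<subseteq> ball 0 1" "0 \<le> r"
  shows "norm c + r < 1"
proof (cases "c = 0")
  case True
  \<comment> \<open>For a centred ball every direction is extremal; \<open>undefined\<close> merely
    names some coordinate.\<close>
  let ?x = "r *\<^sub>R axis (undefined :: 'n) (1::real) :: real^'n"
  have "?x \<in> cball c r" using assms True by simp
  then have "?x \<in> ball 0 1" using assms by blast
  then show ?thesis using assms True by simp
next
  case False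
  let ?x = "c + (r / norm c) *\<^sub>R c"
  have "?x \<in> cball c r" using assms False by (simp add: dist_norm)
  then have "?x \<in> ball 0 1" using assms by blast
  moreover have "norm ?x = norm c + r"
  proof -
    have "?x = (1 + r / norm c) *\<^sub>R c" by (simp add: scaleR_left_distrib)
    then have "norm ?x = (1 + r / norm c) * norm c" using assms False by (simp add: abs_of_nonneg)
    then show ?thesis using False by (simp add: distrib_right)
  qed
  ultimately show ?thesis by simp
qed

text \<open>The sign condition is removed by linearity: with \<open>f = K * \<eta>\<close>, both f
  and \<phi> + f are nonnegative, and the identity for \<phi> is the difference of theirs.\<close>

lemma (in borel_solution) stress_identity:
  assumes r: "0 \<le> r" "cball c r \<subseteq> ball 0 1" and \<phi>: "test_fun (ball c r) \<phi>"
  shows "(\<Sum>m\<in>UNIV. \<integral>x. stress x l m * dpart [m] \<phi> x \<partial>lborel) = 0"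
proof -
  \<comment> \<open>A third of the room is spent on enlarging r to s, a third on s to s', and the
    last third keeps the ball of radius s' strictly inside the unit ball.\<close>
  define gap where "gap = (1 - (norm c + r)) / 3"
  have gap: "gap > 0" using cball_subset_unit_ball[OF r(2,1)] by (simp add: gap_def)
  define s where "s = r + gap"
  define s' where "s' = s + gap"
  have s: "0 \<le> s" "s < s'" "r < s" using gap r by (auto simp: s_def s'_def)
  have sub: "cball c s' \<subseteq> ball 0 1"
  proof
    fix x assume "x \<in> cball c s'"
    then have "norm (x - c) \<le> s'" by (simp add: dist_norm norm_minus_commute)
    moreover have "norm x \<le> norm c + norm (x - c)" using norm_triangle_sub by blast
    moreover have "norm c + s' < 1" using gap unfolding s'_def s_def by (simp add: gap_def field_simps)
    ultimately show "x \<in> ball 0 1" by simp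
  qed
  obtain \<eta> where \<eta>: "smooth_on UNIV \<eta>" "\<And>x. 0 \<le> \<eta> x" "\<And>x. \<eta> x \<le> 1"
    "\<And>x. x \<in> cball c r \<Longrightarrow> \<eta> x = 1" "\<And>x. x \<notin> ball c s \<Longrightarrow> \<eta> x = 0"
    using cutoff_exists[OF r(1) s(3), of c] by metis
  obtain K where K: "0 < K" "\<And>x. \<bar>\<phi> x\<bar> \<le> K" using test_fun_bounded[OF \<phi>] by metis
  define f where "f x = K * \<eta> x" for x
  have sb: "cball c s \<subseteq> ball 0 1" using sub s by (meson order.strict_implies_order order_trans subset_cball)
  have fs: "smooth_on UNIV f" unfolding f_def by (rule smooth_on_UNIV_mult[OF smooth_on_UNIV_const \<eta>(1)])
  have f: "test_fun (ball 0 1) f"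
    by (rule test_funI[OF fs compact_cball sb]) (use \<eta>(5) in \<open>simp add: f_def\<close>)
  have \<phi>0: "\<phi> x = 0" if "x \<notin> ball c r" for x using test_fun_support[OF \<phi> that] .
  have \<phi>1: "test_fun (ball 0 1) \<phi>"
    by (rule test_fun_mono[OF \<phi>]) (use r(2) ball_subset_cball in blast)
  have g: "test_fun (ball 0 1) (\<lambda>x. \<phi> x + f x)" by (rule test_fun_add[OF \<phi>1 f])
  have f0: "0 \<le> f x" for x using \<eta>(2) K(1) by (simp add: f_def)
  have g0: "0 \<le> \<phi> x + f x" for x
  proof (cases "x \<in> ball c r")
    case True
    then have "f x = K" using \<eta>(4)[of x] by (simp add: f_def)
    then show ?thesis using K(2)[of x] by linarith
  qed (use \<phi>0 f0 in simp)
  have fout: "f x = 0" if "x \<notin> cball c s" for x using \<eta>(5)[of x] that by (simp add: f_def)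
  have gout: "\<phi> x + f x = 0" if "x \<notin> cball c s" for x using fout[OF that] \<phi>0[of x] that s by auto
  interpret F: borel_solution_test \<beta> p q \<epsilon> v G f c s s'
    by unfold_locales (use f f0 fout s sub in auto)
  interpret H: borel_solution_test \<beta> p q \<epsilon> v G "\<lambda>x. \<phi> x + f x" c s s'
    by unfold_locales (use g g0 gout s sub in auto)
  have d: "dpart [m] (\<lambda>x. \<phi> x + f x) x = dpart [m] \<phi> x + dpart [m] f x" for m x
    by (intro dpart_add smooth_on_UNIV_differentiable fs test_fun_smooth[OF \<phi>])
  have "(\<integral>x. stress x l m * dpart [m] (\<lambda>x. \<phi> x + f x) x \<partial>lborel)
    = (\<integral>x. stress x l m * dpart [m] \<phi> x \<partial>lborel) + (\<integral>x. stress x l m * dpart [m] f x \<partial>lborel)" for m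
    unfolding d distrib_left
    by (rule Bochner_Integration.integral_add[OF stress_mult_integrable[OF \<phi>] stress_mult_integrable[OF f]])
  then show ?thesis
    using H.stress_identity_nonneg[of l] F.stress_identity_nonneg[of l] by (simp add: sum.distrib)
qed

subsection \<open>Borel representatives and mean oscillation\<close>

text \<open>Passes between the Lebesgue-measurable data of the definitions and Borel functions on
  the whole space, for which translations and Fubini are available. Completeness of Lebesgue measure
  supplies the measurability of f on U.\<close>

lemma lebesgue_set_integral_transfer:
  fixes f h :: "real^'n::finite \<Rightarrow> real"
  assumes h: "h \<in> borel_measurable borel" "\<And>x. x \<notin> U \<Longrightarrow> h x = 0"
    and ae: "AE x in lebesgue. x \<in> U \<longrightarrow> f x = h x"
  shows "(LINT x:U|lebesgue. f x) = (\<integral>x. h x \<partial>lborel)"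
    and "set_integrable lebesgue U f \<longleftrightarrow> integrable lborel h"
proof -
  have hm: "h \<in> borel_measurable lebesgue" using h(1) by (simp add: measurable_completion)
  have ae': "AE x in lebesgue. h x = indicator U x *\<^sub>R f x"
    using ae by (rule AE_mp) (use h(2) in \<open>auto simp: indicator_def\<close>)
  have fm: "(\<lambda>x. indicator U x *\<^sub>R f x) \<in> borel_measurable lebesgue"
    by (rule borel_measurable_AE[OF hm ae'])
  have ae'': "AE x in lebesgue. indicator U x *\<^sub>R f x = h x"
    using ae' by (rule AE_mp) simp
  show "(LINT x:U|lebesgue. f x) = (\<integral>x. h x \<partial>lborel)"
    unfolding set_lebesgue_integral_def
    using integral_cong_AE[OF fm hm ae''] integral_completion[of h lborel] h(1) by simp
  show "set_integrable lebesgue U f \<longleftrightarrow> integrable lborel h"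
    unfolding set_integrable_def
    using integrable_cong_AE[OF fm hm ae''] integrable_completion[of h lborel] h(1) by simp
qed

lemma borel_representative:
  fixes f :: "real^'n::finite \<Rightarrow> real"
  assumes "f \<in> borel_measurable (lebesgue_on U)" "U \<in> sets borel"
  shows "\<exists>g. g \<in> borel_measurable borel \<and> (\<forall>x. x \<notin> U \<longrightarrow> g x = 0) \<and> (AE x in lebesgue. x \<in> U \<longrightarrow> f x = g x)"
proof -
  have U: "U \<inter> space lebesgue \<in> sets lebesgue" using assms(2) by (simp add: sets_completionI_sets)
  have "(\<lambda>x. indicator U x *\<^sub>R f x) \<in> borel_measurable lebesgue"
    using assms(1) borel_measurable_restrict_space_iff[OF U] by blast
  then obtain g0 where g0: "g0 \<in> borel_measurable lborel" "AE x in lborel. indicator U x *\<^sub>R f x = g0 x"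
    using completion_ex_borel_measurable_real by blast
  define g where "g x = indicator U x * g0 x" for x
  have "g \<in> borel_measurable borel"
    unfolding g_def[abs_def] using g0(1) assms(2) by simp
  moreover have "AE x in lebesgue. x \<in> U \<longrightarrow> f x = g x"
    using AE_completion[OF g0(2)] by (rule AE_mp) (auto simp: g_def)
  moreover have "g x = 0" if "x \<notin> U" for x using that by (simp add: g_def)
  ultimately show ?thesis by blast
qed

text \<open>Every requirement on a weak solution is an integral identity or an almost-everywhere
  statement, so it survives a change on a null set; values outside the ball are set to 0.\<close>

lemma (in bump) weak_solution_borel_representative:
  fixes u :: "real^'n::finite \<Rightarrow> real" and Du :: "real^'n \<Rightarrow> real^'n"
  assumes p: "1 < p" and \<epsilon>: "0 < \<epsilon>" and ws: "weak_solution p \<beta> \<epsilon> u Du"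
  shows "\<exists>v G. borel_solution \<beta> p (p / (p - 1)) \<epsilon> v G \<and>
    (AE x in lebesgue. x \<in> ball 0 1 \<longrightarrow> u x = v x \<and> Du x = G x)"
proof -
  let ?U = "ball 0 1 :: (real^'n) set"
  have U: "?U \<in> sets borel" by simp
  have sob: "sobolev ?U p u Du" using ws unfolding weak_solution_def by (elim conjE)
  have u_meas: "u \<in> borel_measurable (lebesgue_on ?U)"
    and Du_meas: "(\<lambda>x. Du x $ i) \<in> borel_measurable (lebesgue_on ?U)"
    and Du_Lp: "set_integrable lebesgue ?U (\<lambda>x. \<bar>Du x $ i\<bar> powr p)" for i
    using sob unfolding sobolev_def Lp_def by simp_all
  obtain v0 where v0: "v0 \<in> borel_measurable borel" "\<forall>x. x \<notin> ?U \<longrightarrow> v0 x = 0"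
    "AE x in lebesgue. x \<in> ?U \<longrightarrow> u x = v0 x"
    using borel_representative[OF u_meas U] by (elim exE conjE)
  have "\<forall>i. \<exists>g. g \<in> borel_measurable borel \<and> (\<forall>x. x \<notin> ?U \<longrightarrow> g x = 0) \<and> (AE x in lebesgue. x \<in> ?U \<longrightarrow> Du x $ i = g x)"
    using borel_representative[OF Du_meas U] by (rule allI)
  from choice[OF this] obtain g where g0: "\<forall>i. g i \<in> borel_measurable borel \<and> (\<forall>x. x \<notin> ?U \<longrightarrow> g i x = 0)
      \<and> (AE x in lebesgue. x \<in> ?U \<longrightarrow> Du x $ i = g i x)" ..
  have g: "g i \<in> borel_measurable borel" "\<forall>x. x \<notin> ?U \<longrightarrow> g i x = 0"
    "AE x in lebesgue. x \<in> ?U \<longrightarrow> Du x $ i = g i x" for i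
    using spec[OF g0, of i] by simp_all
  \<comment> \<open>Truncation makes the bound 1 hold at every point and changes the representative
    only on a null set, since |u| <= 1 almost everywhere in the ball.\<close>
  define v where "v x = clamp_to 1 (v0 x)" for x
  define G where "G x = (\<chi> i. g i x)" for x
  have v_meas: "v \<in> borel_measurable borel" unfolding v_def[abs_def] using v0(1) by simp
  have v_out: "v x = 0" if "x \<notin> ?U" for x using v0(2) that by (simp add: v_def clamp_to_0)
  have v_bound: "\<bar>v x\<bar> \<le> 1" for x by (simp add: v_def clamp_to_bound)
  have aev: "AE x in lebesgue. x \<in> ?U \<longrightarrow> u x = v x"
  proof -
    have "AE x in lebesgue. x \<in> ?U \<longrightarrow> \<bar>u x\<bar> \<le> 1" using ws unfolding weak_solution_def by (elim conjE)
    with v0(3) show ?thesis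
      by eventually_elim (auto simp: v_def clamp_to_id)
  qed
  have Gi_meas: "(\<lambda>x. G x $ i) \<in> borel_measurable borel" for i unfolding G_def using g(1) by simp
  have G_meas: "G \<in> borel_measurable borel"
  proof (rule borel_measurable_euclidean_space[THEN iffD2], rule ballI)
    fix b :: "real^'n" assume "b \<in> Basis"
    then obtain i where "b = axis i 1" unfolding Basis_vec_def by auto
    then have "(\<lambda>x. G x \<bullet> b) = (\<lambda>x. G x $ i)" by (simp add: inner_axis)
    then show "(\<lambda>x. G x \<bullet> b) \<in> borel_measurable borel" using Gi_meas[of i] by simp
  qed
  have G_out: "G x = 0" if "x \<notin> ?U" for x using g(2) that by (simp add: G_def vec_eq_iff)
  have aeG: "AE x in lebesgue. x \<in> ?U \<longrightarrow> Du x = G x"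
  proof -
    have "AE x in lebesgue. \<forall>i\<in>UNIV. x \<in> ?U \<longrightarrow> Du x $ i = g i x"
      by (rule AE_finite_allI) (simp, rule g(3))
    then show ?thesis by eventually_elim (simp add: G_def vec_eq_iff)
  qed
  have ae: "AE x in lebesgue. x \<in> ?U \<longrightarrow> u x = v x \<and> Du x = G x"
    using aev aeG by eventually_elim simp
  have "borel_solution \<beta> p (p / (p - 1)) \<epsilon> v G"
  proof unfold_locales
    show "1 < p / (p - 1)" "1 / p + 1 / (p / (p - 1)) = 1" using p by (simp_all add: field_simps)
    show "integrable lborel (\<lambda>x. \<bar>G x $ i\<bar> powr p)" for i
    proof -
      have "set_integrable lebesgue ?U (\<lambda>x. \<bar>Du x $ i\<bar> powr p)" by (rule Du_Lp)
      moreover have "AE x in lebesgue. x \<in> ?U \<longrightarrow> \<bar>Du x $ i\<bar> powr p = \<bar>G x $ i\<bar> powr p"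
        using aeG by eventually_elim simp
      moreover have "(\<lambda>x. \<bar>G x $ i\<bar> powr p) \<in> borel_measurable borel" using Gi_meas by simp
      ultimately show ?thesis
        using lebesgue_set_integral_transfer(2)[of "\<lambda>x. \<bar>G x $ i\<bar> powr p" ?U "\<lambda>x. \<bar>Du x $ i\<bar> powr p"] G_out by simp
    qed
    fix f :: "real^'n \<Rightarrow> real" assume f: "test_fun ?U f"
    show "(\<integral>x. v x * dpart [i] f x \<partial>lborel) = - (\<integral>x. G x $ i * f x \<partial>lborel)" for i
    proof -
      have m: "(\<lambda>x. v x * dpart [i] f x) \<in> borel_measurable borel" "(\<lambda>x. G x $ i * f x) \<in> borel_measurable borel"
        using v_meas Gi_meas test_fun_measurable[OF f] test_fun_measurable[OF test_fun_dpart[OF f, of i]] by simp_all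
      have "(LINT x:?U|lebesgue. u x * dpart [i] f x) = (\<integral>x. v x * dpart [i] f x \<partial>lborel)"
      proof (rule lebesgue_set_integral_transfer(1)[OF m(1)])
        show "AE x in lebesgue. x \<in> ?U \<longrightarrow> u x * dpart [i] f x = v x * dpart [i] f x"
          using ae by eventually_elim simp
      qed (simp add: v_out)
      moreover have "(LINT x:?U|lebesgue. Du x $ i * f x) = (\<integral>x. G x $ i * f x \<partial>lborel)"
      proof (rule lebesgue_set_integral_transfer(1)[OF m(2)])
        show "AE x in lebesgue. x \<in> ?U \<longrightarrow> Du x $ i * f x = G x $ i * f x"
          using ae by eventually_elim simp
      qed (simp add: G_out)
      moreover have "(LINT x:?U|lebesgue. u x * dpart [i] f x) = - (LINT x:?U|lebesgue. Du x $ i * f x)"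
        using sob f unfolding sobolev_def weak_gradient_def by simp
      ultimately show ?thesis by simp
    qed
    show "- (\<integral>x. norm (G x) powr (p - 2) * (G x \<bullet> grad f x) \<partial>lborel) = (\<integral>x. beta_eps \<beta> \<epsilon> (v x) * f x \<partial>lborel)"
    proof -
      have gm: "grad f \<in> borel_measurable borel"
        by (intro borel_measurable_continuous_onI continuous_grad test_fun_smooth[OF f])
      have m1: "(\<lambda>x. norm (G x) powr (p - 2) * (G x \<bullet> grad f x)) \<in> borel_measurable borel"
        using G_meas gm by simp
      have "\<beta> \<in> borel_measurable borel" by (intro borel_measurable_continuous_onI continuous_beta)
      moreover have "(\<lambda>x. v x / \<epsilon>) \<in> borel_measurable borel" using v_meas by simp
      ultimately have "(\<lambda>x. \<beta> (v x / \<epsilon>)) \<in> borel_measurable borel" by (rule measurable_compose[rotated])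
      then have m2: "(\<lambda>x. beta_eps \<beta> \<epsilon> (v x) * f x) \<in> borel_measurable borel"
        unfolding beta_eps_def using test_fun_measurable[OF f] by simp
      have "(LINT x:?U|lebesgue. norm (Du x) powr (p - 2) * (Du x \<bullet> grad f x))
          = (\<integral>x. norm (G x) powr (p - 2) * (G x \<bullet> grad f x) \<partial>lborel)"
      proof (rule lebesgue_set_integral_transfer(1)[OF m1])
        show "AE x in lebesgue. x \<in> ?U \<longrightarrow>
            norm (Du x) powr (p - 2) * (Du x \<bullet> grad f x) = norm (G x) powr (p - 2) * (G x \<bullet> grad f x)"
          using ae by eventually_elim simp
      qed (simp add: G_out)
      moreover have "(LINT x:?U|lebesgue. beta_eps \<beta> \<epsilon> (u x) * f x) = (\<integral>x. beta_eps \<beta> \<epsilon> (v x) * f x \<partial>lborel)"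
      proof (rule lebesgue_set_integral_transfer(1)[OF m2])
        show "AE x in lebesgue. x \<in> ?U \<longrightarrow> beta_eps \<beta> \<epsilon> (u x) * f x = beta_eps \<beta> \<epsilon> (v x) * f x"
          using ae by eventually_elim simp
      qed (use test_fun_support[OF f] in simp)
      moreover have "- (LINT x:?U|lebesgue. norm (Du x) powr (p - 2) * (Du x \<bullet> grad f x))
          = (LINT x:?U|lebesgue. beta_eps \<beta> \<epsilon> (u x) * f x)"
        using ws test_fun_sobolev0[OF f open_ball p] unfolding weak_solution_def by simp
      ultimately show ?thesis by simp
    qed
  qed (use p \<epsilon> v_meas v_bound v_out G_meas G_out in simp_all)
  then show ?thesis using ae by blast
qed

text \<open>On any ball the mean is at most K in absolute value, so the function deviates from it by
  at most 2K.\<close>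

lemma bounded_in_BMO:
  fixes f :: "real^'n::finite \<Rightarrow> real"
  assumes f: "f \<in> borel_measurable (lebesgue_on (ball c r))" "\<And>x. x \<in> ball c r \<Longrightarrow> \<bar>f x\<bar> \<le> K"
    and K: "0 \<le> K"
  shows "in_BMO (ball c r) f" "bmo_seminorm (ball c r) f \<le> ereal (2 * K)"
proof -
  \<comment> \<open>Used for local integrability, for the mean and for the mean oscillation.\<close>
  have fin: "integrable lebesgue (\<lambda>x. indicator S x *\<^sub>R h x)" "\<bar>LINT x:S|lebesgue. h x\<bar> \<le> C * measure lebesgue S"
    if "S \<in> sets lebesgue" "emeasure lebesgue S < \<infinity>" "(\<lambda>x. indicator S x *\<^sub>R h x) \<in> borel_measurable lebesgue"
      "\<And>x. x \<in> S \<Longrightarrow> \<bar>h x\<bar> \<le> C" for S :: "(real^'n) set" and h C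
  proof -
    have i: "integrable lebesgue (\<lambda>x. C * indicator S x :: real)"
      using that by (intro integrable_mult_right integrable_real_indicator)
    have b: "norm (indicator S x *\<^sub>R h x) \<le> C * indicator S x" for x
      using that(4)[of x] by (simp add: indicator_def)
    show j: "integrable lebesgue (\<lambda>x. indicator S x *\<^sub>R h x)"
      by (rule Bochner_Integration.integrable_bound[OF i that(3)])
        (use b in \<open>auto intro: order_trans[OF _ abs_ge_self]\<close>)
    show "\<bar>LINT x:S|lebesgue. h x\<bar> \<le> C * measure lebesgue S"
      using Bochner_Integration.integral_norm_bound_integral[OF j i b] that(1)
      by (simp add: set_lebesgue_integral_def)
  qed
  have fm: "(\<lambda>x. indicator S x *\<^sub>R h (f x)) \<in> borel_measurable lebesgue"
    if S: "S \<in> sets lebesgue" "S \<subseteq> ball c r" and h: "h \<in> borel_measurable borel" for S and h :: "real \<Rightarrow> real"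
  proof -
    have "f \<in> borel_measurable (lebesgue_on S)" by (rule measurable_restrict_mono[OF f(1) S(2)])
    then have "(\<lambda>x. h (f x)) \<in> borel_measurable (lebesgue_on S)" using h by (rule measurable_compose)
    then show ?thesis using borel_measurable_restrict_space_iff[of S lebesgue "\<lambda>x. h (f x)"] S(1) by simp
  qed
  have loc: "loc_integrable (ball c r) f"
    unfolding loc_integrable_def set_integrable_def
  proof (intro allI impI)
    fix S assume S: "compact S \<and> S \<subseteq> ball c r"
    show "integrable lebesgue (\<lambda>x. indicator S x *\<^sub>R f x)"
    proof (rule fin(1))
      show S1: "S \<in> sets lebesgue" using S by (simp add: borel_compact sets_completionI_sets)
      show "emeasure lebesgue S < \<infinity>" using S emeasure_compact_finite[of S] by (simp add: borel_compact)
      show "(\<lambda>x. indicator S x *\<^sub>R f x) \<in> borel_measurable lebesgue"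
        using fm[OF S1, of "\<lambda>t. t"] S by simp
      show "\<bar>f x\<bar> \<le> K" if "x \<in> S" for x using S f(2) that by blast
    qed
  qed
  have avg: "ball_avg B (\<lambda>x. \<bar>f x - ball_avg B f\<bar>) \<le> 2 * K" if B: "B \<in> {ball a s | a s. 0 < s \<and> ball a s \<subseteq> ball c r}" for B
  proof -
    from B obtain a s where B: "B = ball a s" "0 < s" "B \<subseteq> ball c r" by auto
    have B1: "B \<in> sets lebesgue" "emeasure lebesgue B < \<infinity>"
      using B emeasure_bounded_finite[of B] by simp_all
    have B2: "0 < measure lebesgue B" using B content_ball_pos by simp
    have 1: "\<bar>ball_avg B f\<bar> \<le> K"
    proof -
      have "\<bar>LINT x:B|lebesgue. f x\<bar> \<le> K * measure lebesgue B"
        using fm[OF B1(1) B(3), of "\<lambda>t. t"] B(3) f(2) by (intro fin(2)[OF B1]) auto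
      then show ?thesis using B2 by (simp add: ball_avg_def pos_divide_le_eq)
    qed
    have "\<bar>LINT x:B|lebesgue. \<bar>f x - ball_avg B f\<bar>\<bar> \<le> (2 * K) * measure lebesgue B"
    proof (rule fin(2)[OF B1])
      show "(\<lambda>x. indicator B x *\<^sub>R \<bar>f x - ball_avg B f\<bar>) \<in> borel_measurable lebesgue"
        by (rule fm[OF B1(1) B(3), of "\<lambda>t. \<bar>t - ball_avg B f\<bar>"]) simp
      show "\<bar>\<bar>f x - ball_avg B f\<bar>\<bar> \<le> 2 * K" if "x \<in> B" for x
      proof -
        have "\<bar>f x\<bar> \<le> K" using f(2) B(3) that by blast
        then show ?thesis using 1 by linarith
      qed
    qed
    then show ?thesis using B2 unfolding ball_avg_def[of B "\<lambda>x. \<bar>_ x\<bar>"] by (simp add: pos_divide_le_eq)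
  qed
  show le: "bmo_seminorm (ball c r) f \<le> ereal (2 * K)"
    unfolding bmo_seminorm_def by (rule SUP_least) (use avg in simp)
  have "bmo_seminorm (ball c r) f < \<infinity>" by (rule le_less_trans[OF le]) simp
  then show "in_BMO (ball c r) f" using loc by (simp add: in_BMO_def)
qed

section \<open>Decomposition with a bound uniform in the parameter\<close>

theorem mainTheorem16:
  fixes p :: real and \<beta> :: "real \<Rightarrow> real"
    and u :: "real \<Rightarrow> real^'n::finite \<Rightarrow> real"
    and Du :: "real \<Rightarrow> real^'n \<Rightarrow> real^'n"
  assumes p: "1 < p"
    and beta: "Cc_infty_01 \<beta>" "\<forall>t. 0 \<le> \<beta> t" "(LBINT t=0..1. \<beta> t) > 0"
    and sol: "\<forall>\<epsilon>>0. weak_solution p \<beta> \<epsilon> (u \<epsilon>) (Du \<epsilon>)"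
  shows "\<forall>c r. 0 < r \<and> cball c r \<subseteq> ball 0 1 \<longrightarrow>
    (\<exists>C::real. \<forall>\<epsilon>>0. \<exists>T0 That :: real^'n \<Rightarrow> real^'n^'n.
        (AE x in lebesgue. x \<in> ball c r \<longrightarrow> Ttensor p (Du \<epsilon> x) = T0 x + That x)
      \<and> div_free (ball c r) T0
      \<and> (\<forall>l m. in_BMO (ball c r) (\<lambda>x. That x $ l $ m)
                \<and> bmo_seminorm (ball c r) (\<lambda>x. That x $ l $ m) \<le> ereal C))"
proof (intro allI impI)
  fix c :: "real^'n" and r :: real
  assume cr: "0 < r \<and> cball c r \<subseteq> ball 0 1"
  interpret bump \<beta> by unfold_locales (use beta in auto)
  have sub: "ball c r \<subseteq> ball 0 1" using cr ball_subset_cball by blast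
  show "\<exists>C::real. \<forall>\<epsilon>>0. \<exists>T0 That :: real^'n \<Rightarrow> real^'n^'n.
        (AE x in lebesgue. x \<in> ball c r \<longrightarrow> Ttensor p (Du \<epsilon> x) = T0 x + That x)
      \<and> div_free (ball c r) T0
      \<and> (\<forall>l m. in_BMO (ball c r) (\<lambda>x. That x $ l $ m)
                \<and> bmo_seminorm (ball c r) (\<lambda>x. That x $ l $ m) \<le> ereal C)"
  \<comment> \<open>\<open>primitive 1\<close> is the integral M of \<beta>. The remainder lies
    between 0 and p M, and passing to mean oscillation costs the factor 2; the constant involves
    neither \<epsilon> nor the ball.\<close>
  proof (intro exI[of _ "2 * (p * primitive 1)"] allI impI)
    fix \<epsilon> :: real assume \<epsilon>: "\<epsilon> > 0"
    have "weak_solution p \<beta> \<epsilon> (u \<epsilon>) (Du \<epsilon>)" using sol \<epsilon> by simp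
    from weak_solution_borel_representative[OF p \<epsilon> this]
    obtain v G where bs: "borel_solution \<beta> p (p / (p - 1)) \<epsilon> v G"
      and ae: "AE x in lebesgue. x \<in> ball 0 1 \<longrightarrow> u \<epsilon> x = v x \<and> Du \<epsilon> x = G x"
      by (elim exE conjE)
    interpret borel_solution \<beta> p "p / (p - 1)" \<epsilon> v G by (rule bs)
    define T0 :: "real^'n \<Rightarrow> real^'n^'n" where "T0 x = (\<chi> l m. stress x l m)" for x
    define That :: "real^'n \<Rightarrow> real^'n^'n" where
      "That x = (\<chi> l m. if l = m then p * primitive (v x / \<epsilon>) else 0)" for x
    show "\<exists>T0 That :: real^'n \<Rightarrow> real^'n^'n.
        (AE x in lebesgue. x \<in> ball c r \<longrightarrow> Ttensor p (Du \<epsilon> x) = T0 x + That x)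
      \<and> div_free (ball c r) T0
      \<and> (\<forall>l m. in_BMO (ball c r) (\<lambda>x. That x $ l $ m)
                \<and> bmo_seminorm (ball c r) (\<lambda>x. That x $ l $ m) \<le> ereal (2 * (p * primitive 1)))"
    proof (rule exI[of _ T0], rule exI[of _ That], intro conjI)
      have dec: "Ttensor p (G x) = T0 x + That x" for x
        by (simp add: T0_def That_def stress_def vec_eq_iff)
      show "AE x in lebesgue. x \<in> ball c r \<longrightarrow> Ttensor p (Du \<epsilon> x) = T0 x + That x"
      proof (rule AE_mp[OF ae], rule AE_I2, intro impI)
        fix x assume "x \<in> ball 0 1 \<longrightarrow> u \<epsilon> x = v x \<and> Du \<epsilon> x = G x" "x \<in> ball c r"
        then have "Du \<epsilon> x = G x" using subsetD[OF sub, of x] by blast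
        then show "Ttensor p (Du \<epsilon> x) = T0 x + That x" using dec[of x] by simp
      qed
      have Li: "integrable lebesgue (\<lambda>x. T0 x $ l $ m)" for l m
        using stress_integrable[of l m] integrable_completion[of "\<lambda>x. stress x l m" lborel]
        by (simp add: T0_def borel_measurable_integrable)
      show "div_free (ball c r) T0"
        unfolding div_free_def
      proof (intro conjI allI impI)
        show "loc_integrable (ball c r) (\<lambda>x. T0 x $ l $ m)" for l m
          unfolding loc_integrable_def set_integrable_def
          by (intro allI impI integrable_mult_indicator Li)
            (simp add: borel_compact sets_completionI_sets)
        fix \<phi> :: "real^'n \<Rightarrow> real" and l
        assume \<phi>: "test_fun (ball c r) \<phi>"
        have "(LINT x:ball c r|lebesgue. T0 x $ l $ m * dpart [m] \<phi> x) = (\<integral>x. stress x l m * dpart [m] \<phi> x \<partial>lborel)" for m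
          using set_integral_lebesgue_eq_lborel[of "\<lambda>x. stress x l m * dpart [m] \<phi> x" "ball c r"]
            borel_measurable_integrable[OF stress_mult_integrable[OF \<phi>, of l m]] test_fun_support[OF test_fun_dpart[OF \<phi>]]
          by (simp add: T0_def)
        then show "(\<Sum>m\<in>UNIV. LINT x:ball c r|lebesgue. T0 x $ l $ m * dpart [m] \<phi> x) = 0"
          using stress_identity[of r c \<phi> l] cr \<phi> by simp
      qed
      have hat: "(\<lambda>x. That x $ l $ m) \<in> borel_measurable (lebesgue_on (ball c r))" "\<bar>That x $ l $ m\<bar> \<le> p * primitive 1" for l m x
      proof -
        have "(\<lambda>x. That x $ l $ m) \<in> borel_measurable borel"
          using primitive_meas by (cases "l = m") (simp_all add: That_def)
        then have "(\<lambda>x. That x $ l $ m) \<in> borel_measurable lebesgue" by (simp add: measurable_completion)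
        then show "(\<lambda>x. That x $ l $ m) \<in> borel_measurable (lebesgue_on (ball c r))" by (rule measurable_restrict_space1)
        show "\<bar>That x $ l $ m\<bar> \<le> p * primitive 1"
          using p primitive_bounds[of "v x / \<epsilon>"] primitive_1_pos by (simp add: That_def abs_mult mult_left_mono)
      qed
      have K: "0 \<le> p * primitive 1" using p primitive_1_pos by simp
      show "\<forall>l m. in_BMO (ball c r) (\<lambda>x. That x $ l $ m)
          \<and> bmo_seminorm (ball c r) (\<lambda>x. That x $ l $ m) \<le> ereal (2 * (p * primitive 1))"
        using bounded_in_BMO[OF hat(1) hat(2) K] by blast
    qed
  qed
qed

end
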